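(* Let $\mathcal K$ be a representable plumbus with enhanced 2-classifier $u:\Omega_\bullet\to\Omega$, and let $(T,i,m)$ be an opfibrantly cartesian enhanced 2-monad on $\mathcal K$. Then the plumbus $\mathrm{LaxAlg}(T)$ of lax $T$-algebras and lax $T$-morphisms is representable too, with the same 2-classifier $u:\Omega_\bullet\to\Omega$, where $\Omega$ and $\Omega_\bullet$ are equipped with their canonical lax $T$-algebra structures (described in the context) and $u$ is a strict $T$-morphism.
   Context: Enhanced 2-categories. An enhanced 2-category $\mathcal K$ is a 2-category, whose 1-cells are called loose (written $\rightsquigarrow$), with a wide and locally full sub-2-category whose 1-cells are called tight (written $\to$). It is repletely enhanced if $f$ tight and $f\cong g$ imply $g$ tight. An enhanced 2-functor is a 2-functor preserving tight 1-cells. An enhanced 2-monad $(T,i,m)$ is a 2-monad with $T$ preserving tight 1-cells and $i,m$ having tight components. A tight terminal object is a terminal object $1$ all of whose maps $X\to 1$ are tight. Algebras. A lax $T$-algebra is $(A,\alpha,\upsilon,\mu)$ with $\alpha:TA\to A$ tight, $\upsilon:\mathrm{id}_A\Rightarrow\alpha i_A$ and $\mu:\alpha\circ T\alpha\Rightarrow\alpha\circ m_A$ such that $(\mu\, i_{TA})(\upsilon\alpha)=\mathrm{id}_\alpha$, $(\mu\, Ti_A)(\alpha\, T\upsilon)=\mathrm{id}_\alpha$, $(\mu\, m_{TA})(\mu\, T^2\alpha)=(\mu\, Tm_A)(\alpha\, T\mu)$. A lax $T$-morphism $(f,\bar f):(A,\alpha)\rightsquigarrow(B,\beta)$ is a loose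 $f:A\rightsquigarrow B$ with $\bar f:\beta\circ Tf\Rightarrow f\circ\alpha$ such that $f\upsilon_A=(\bar f i_A)(\upsilon_B f)$ and $(f\mu_A)(\bar f\,T\alpha)(\beta\,T\bar f)=(\bar f m_A)(\mu_B\,T^2f)$; it is pseudo if $\bar f$ is invertible and strict if $\bar f$ is an identity. A $T$-2-morphism $f\Rightarrow f'$ is a 2-cell $\varphi$ with $(\varphi\alpha)\bar f=\bar f'(\beta\,T\varphi)$. $\mathrm{LaxAlg}(T)$ (the paper's $\mathrm{Alg}^{\mathrm{lx}}_{\mathrm{lx},t\mathrm{ps}}(T)$) is the enhanced 2-category of lax $T$-algebras, lax $T$-morphisms as loose 1-cells, pseudo-$T$-morphisms with tight underlying 1-cell as tight 1-cells, and $T$-2-morphisms. Discrete opfibrations and pullbacks. A tight discrete opfibration is a tight $p:E\to B$ such that for all $e:X\rightsquigarrow E$, $b:X\rightsquigarrow B$, $\varphi:pe\Rightarrow b$ there is a unique 2-cell $\lambda$ with domain $e$ and $p\lambda=\varphi$. A left-tight pullback of a tight $f:B\to C$ along a loose $g:A\rightsquigarrow C$ is a (strict 2-categorical) pullback whose projection $p_A$ to $A$ is tight and detects tightness: $h$ is tight whenever $p_Ah$ is. Plumbus. A smallness structure on $\mathcal K$ is a class of tight discrete opfibrations, called small, stable under left-tight pullback along arbitrary loose 1-cells, with strictly functorial chosen such pullbacks. Equivalently, let $\mathrm{SDO}(\mathcal K)$ be the enhanced 2-category of small discrete opfibrations, commuting squares with loose sides (tight when both sides are tight), and pairs of compatible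 2-cells; the codomain 2-functor $\partial_1:\mathrm{SDO}(\mathcal K)\to\mathcal K$ is a split enhanced discrete 2-fibration. A plumbus is a repletely enhanced 2-category with a tight terminal object and a smallness structure. $\mathrm{LaxAlg}(T)$ is a plumbus whose small discrete opfibrations are the strict $T$-morphisms whose underlying map is small in $\mathcal K$. Representability. An enhanced 2-classifier is a small discrete opfibration $u:\Omega_\bullet\to\Omega$ that is marked-lax terminal in $\mathrm{SDO}(\mathcal K)$ (marked squares being the pullback squares), explicitly: (1) every small $p:E\to B$ has a chosen pullback square $(d_\bullet p:E\rightsquigarrow\Omega_\bullet,\ dp:B\rightsquigarrow\Omega)$ from $p$ to $u$; (2) for every commuting square $(g:E\rightsquigarrow E',f:B\rightsquigarrow B')$ from small $p$ to small $p'$ there is a unique pair of 2-cells $\gamma_\bullet:d_\bullet p\Rightarrow d_\bullet p'\circ g$, $\gamma:dp\Rightarrow dp'\circ f$ with $u\gamma_\bullet=\gamma p$; (3) these are invertible if the square is a pullback; (4) there is an isomorphism $(d_\bullet u,du)\cong(\mathrm{id},\mathrm{id})$. A plumbus with an enhanced 2-classifier is representable; one always assumes then that $\mathrm{id}_1$ is small. A small $p$ is perfect if its classifying map $dp$ is tight. Opfibrantly cartesian. $(T,i,m)$ is opfibrantly cartesian if (A) $Tu$ is a small discrete opfibration, (B) $T$ preserves pullbacks of $u$, (C) $Tu$ is perfect, i.e. $\omega:=d(Tu):T\Omega\to\Omega$ is tight. Canonical structure. Let $(\omega_\bullet,\omega)$ be the pullback square from $Tu$ to $u$ classifying $Tu$.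 The canonical lax algebra structures on $\Omega_\bullet,\Omega$ have structure maps $\omega_\bullet,\omega$; their unitors are the unique pair of 2-cells $\mathrm{id}\Rightarrow\omega_\bullet i$, $\mathrm{id}\Rightarrow\omega i$ compatible with $u$ (i.e. forming a 2-cell in $\mathrm{SDO}(\mathcal K)$), and their multiplicators are the unique pair of 2-cells $\omega_\bullet T\omega_\bullet\Rightarrow\omega_\bullet m$, $\omega T\omega\Rightarrow\omega m$ compatible with $u$. *)

theory Defs
  imports Main
begin

text \<open>All composition symbols are in the order of composition of functions: \<open>g \<cdot> f\<close> is
  ``first \<open>f\<close>, then \<open>g\<close>''. The operations are only meaningful on the carriers \<open>Obj\<close>, \<open>Arr\<close>,
  \<open>Cell\<close> and on composable arguments.\<close>

record ('o, 'a, 'c) two_cat =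
  Obj  :: "'o set"
  Arr  :: "'a set"
  Cell :: "'c set"
  dom1 :: "'a \<Rightarrow> 'o"
  cod1 :: "'a \<Rightarrow> 'o"
  dom2 :: "'c \<Rightarrow> 'a"
  cod2 :: "'c \<Rightarrow> 'a"
  Id1   :: "'o \<Rightarrow> 'a"
  Comp1 :: "'a \<Rightarrow> 'a \<Rightarrow> 'a"  (infixr \<open>\<cdot>\<index>\<close> 75)
  Id2   :: "'a \<Rightarrow> 'c"
  Vcomp :: "'c \<Rightarrow> 'c \<Rightarrow> 'c"  (infixr \<open>\<bullet>\<index>\<close> 65)
  Hcomp :: "'c \<Rightarrow> 'c \<Rightarrow> 'c"  (infixr \<open>\<star>\<index>\<close> 70)

definition hom1 :: "('o, 'a, 'c, 'm) two_cat_scheme \<Rightarrow> 'o \<Rightarrow> 'o \<Rightarrow> 'a set" where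
  "hom1 K X Y = {f \<in> Arr K. dom1 K f = X \<and> cod1 K f = Y}"

definition hom2 :: "('o, 'a, 'c, 'm) two_cat_scheme \<Rightarrow> 'a \<Rightarrow> 'a \<Rightarrow> 'c set" where
  "hom2 K f g = {\<phi> \<in> Cell K. dom2 K \<phi> = f \<and> cod2 K \<phi> = g}"

definition whiskL :: "('o, 'a, 'c, 'm) two_cat_scheme \<Rightarrow> 'a \<Rightarrow> 'c \<Rightarrow> 'c"  (infixr \<open>\<rhd>\<index>\<close> 70) where
  "g \<rhd>\<^bsub>K\<^esub> \<phi> = Id2 K g \<star>\<^bsub>K\<^esub> \<phi>"

definition whiskR :: "('o, 'a, 'c, 'm) two_cat_scheme \<Rightarrow> 'c \<Rightarrow> 'a \<Rightarrow> 'c"  (infixl \<open>\<lhd>\<index>\<close> 70) where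
  "\<phi> \<lhd>\<^bsub>K\<^esub> f = \<phi> \<star>\<^bsub>K\<^esub> Id2 K f"

definition iso2 :: "('o, 'a, 'c, 'm) two_cat_scheme \<Rightarrow> 'c \<Rightarrow> bool" where
  "iso2 K \<phi> \<longleftrightarrow> \<phi> \<in> Cell K \<and>
     (\<exists>\<psi> \<in> hom2 K (cod2 K \<phi>) (dom2 K \<phi>).
        \<psi> \<bullet>\<^bsub>K\<^esub> \<phi> = Id2 K (dom2 K \<phi>) \<and> \<phi> \<bullet>\<^bsub>K\<^esub> \<psi> = Id2 K (cod2 K \<phi>))"

locale two_category =
  fixes K :: "('o, 'a, 'c, 'm) two_cat_scheme" (structure)
  assumes arr_obj: "f \<in> Arr K \<Longrightarrow> dom1 K f \<in> Obj K \<and> cod1 K f \<in> Obj K"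
    and cell_arr: "\<phi> \<in> Cell K \<Longrightarrow> dom2 K \<phi> \<in> Arr K \<and> cod2 K \<phi> \<in> Arr K
           \<and> dom1 K (dom2 K \<phi>) = dom1 K (cod2 K \<phi>)
           \<and> cod1 K (dom2 K \<phi>) = cod1 K (cod2 K \<phi>)"
    and id1_in: "X \<in> Obj K \<Longrightarrow> Id1 K X \<in> hom1 K X X"
    and comp1_in: "f \<in> hom1 K X Y \<Longrightarrow> g \<in> hom1 K Y Z \<Longrightarrow> g \<cdot> f \<in> hom1 K X Z"
    and comp1_id_left: "f \<in> hom1 K X Y \<Longrightarrow> Id1 K Y \<cdot> f = f"
    and comp1_id_right: "f \<in> hom1 K X Y \<Longrightarrow> f \<cdot> Id1 K X = f"
    and comp1_assoc: "f \<in> hom1 K W X \<Longrightarrow> g \<in> hom1 K X Y \<Longrightarrow> h \<in> hom1 K Y Z \<Longrightarrow>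
           (h \<cdot> g) \<cdot> f = h \<cdot> (g \<cdot> f)"
    and id2_in: "f \<in> Arr K \<Longrightarrow> Id2 K f \<in> hom2 K f f"
    and vcomp_in: "\<phi> \<in> hom2 K f g \<Longrightarrow> \<psi> \<in> hom2 K g h \<Longrightarrow> \<psi> \<bullet> \<phi> \<in> hom2 K f h"
    and vcomp_id_left: "\<phi> \<in> hom2 K f g \<Longrightarrow> Id2 K g \<bullet> \<phi> = \<phi>"
    and vcomp_id_right: "\<phi> \<in> hom2 K f g \<Longrightarrow> \<phi> \<bullet> Id2 K f = \<phi>"
    and vcomp_assoc: "\<phi> \<in> hom2 K f g \<Longrightarrow> \<psi> \<in> hom2 K g h \<Longrightarrow> \<chi> \<in> hom2 K h k \<Longrightarrow>
           (\<chi> \<bullet> \<psi>) \<bullet> \<phi> = \<chi> \<bullet> (\<psi> \<bullet> \<phi>)"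
    and hcomp_in: "f \<in> hom1 K X Y \<Longrightarrow> g \<in> hom1 K Y Z \<Longrightarrow>
           \<phi> \<in> hom2 K f f' \<Longrightarrow> \<psi> \<in> hom2 K g g' \<Longrightarrow> \<psi> \<star> \<phi> \<in> hom2 K (g \<cdot> f) (g' \<cdot> f')"
    and hcomp_id_left: "f \<in> hom1 K X Y \<Longrightarrow> \<phi> \<in> hom2 K f f' \<Longrightarrow> Id2 K (Id1 K Y) \<star> \<phi> = \<phi>"
    and hcomp_id_right: "f \<in> hom1 K X Y \<Longrightarrow> \<phi> \<in> hom2 K f f' \<Longrightarrow> \<phi> \<star> Id2 K (Id1 K X) = \<phi>"
    and hcomp_assoc: "f \<in> hom1 K W X \<Longrightarrow> g \<in> hom1 K X Y \<Longrightarrow> h \<in> hom1 K Y Z \<Longrightarrow>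
           \<phi> \<in> hom2 K f f' \<Longrightarrow> \<psi> \<in> hom2 K g g' \<Longrightarrow> \<chi> \<in> hom2 K h h' \<Longrightarrow>
           (\<chi> \<star> \<psi>) \<star> \<phi> = \<chi> \<star> (\<psi> \<star> \<phi>)"
    and hcomp_id2: "f \<in> hom1 K X Y \<Longrightarrow> g \<in> hom1 K Y Z \<Longrightarrow>
           Id2 K g \<star> Id2 K f = Id2 K (g \<cdot> f)"
    and interchange: "f \<in> hom1 K X Y \<Longrightarrow> g \<in> hom1 K Y Z \<Longrightarrow>
           \<phi> \<in> hom2 K f f' \<Longrightarrow> \<phi>' \<in> hom2 K f' f'' \<Longrightarrow>
           \<psi> \<in> hom2 K g g' \<Longrightarrow> \<psi>' \<in> hom2 K g' g'' \<Longrightarrow>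
           (\<psi>' \<bullet> \<psi>) \<star> (\<phi>' \<bullet> \<phi>) = (\<psi>' \<star> \<phi>') \<bullet> (\<psi> \<star> \<phi>)"

text \<open>The 1-cells in \<open>Arr\<close> are the loose ones. Local fullness of the tight sub-2-category means
  that it is determined by its 1-cells.\<close>

record ('o, 'a, 'c) enh_two_cat = "('o, 'a, 'c) two_cat" +
  Tight :: "'a set"

locale enhanced_two_category = two_category K
  for K :: "('o, 'a, 'c, 'm) enh_two_cat_scheme" (structure) +
  assumes tight_arr: "Tight K \<subseteq> Arr K"
    and tight_id1: "X \<in> Obj K \<Longrightarrow> Id1 K X \<in> Tight K"
    and tight_comp1: "f \<in> Tight K \<Longrightarrow> g \<in> Tight K \<Longrightarrow> cod1 K f = dom1 K g \<Longrightarrow> g \<cdot> f \<in> Tight K"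

locale repletely_enhanced_two_category = enhanced_two_category K
  for K :: "('o, 'a, 'c, 'm) enh_two_cat_scheme" (structure) +
  assumes tight_replete: "f \<in> Tight K \<Longrightarrow> \<phi> \<in> hom2 K f g \<Longrightarrow> iso2 K \<phi> \<Longrightarrow> g \<in> Tight K"

definition tight_terminal :: "('o, 'a, 'c, 'm) enh_two_cat_scheme \<Rightarrow> 'o \<Rightarrow> bool" where
  "tight_terminal K t \<longleftrightarrow> t \<in> Obj K \<and>
     (\<forall>X \<in> Obj K. (\<exists>!f. f \<in> hom1 K X t) \<and> hom1 K X t \<subseteq> Tight K \<and>
        (\<forall>f \<in> hom1 K X t. \<forall>g \<in> hom1 K X t. \<exists>!\<phi>. \<phi> \<in> hom2 K f g))"

definition tight_discrete_opfibration :: "('o, 'a, 'c, 'm) enh_two_cat_scheme \<Rightarrow> 'a \<Rightarrow> bool" where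
  "tight_discrete_opfibration K p \<longleftrightarrow> p \<in> Tight K \<and>
     (\<forall>X \<in> Obj K. \<forall>e \<in> hom1 K X (dom1 K p). \<forall>b \<in> hom1 K X (cod1 K p).
        \<forall>\<phi> \<in> hom2 K (p \<cdot>\<^bsub>K\<^esub> e) b.
          \<exists>!\<kappa>. \<kappa> \<in> Cell K \<and> dom2 K \<kappa> = e \<and> p \<rhd>\<^bsub>K\<^esub> \<kappa> = \<phi>)"

text \<open>\<open>pullback K p f p' q\<close>: the square \<open>p \<cdot> q = f \<cdot> p'\<close> exhibits \<open>p' : P \<leadsto> A\<close> and
  \<open>q : P \<leadsto> E\<close> as a strict 2-categorical pullback of \<open>p : E \<leadsto> B\<close> along \<open>f : A \<leadsto> B\<close>.\<close>

definition pullback :: "('o, 'a, 'c, 'm) two_cat_scheme \<Rightarrow> 'a \<Rightarrow> 'a \<Rightarrow> 'a \<Rightarrow> 'a \<Rightarrow> bool" where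
  "pullback K p f p' q \<longleftrightarrow>
     p \<in> Arr K \<and> f \<in> Arr K \<and> cod1 K f = cod1 K p \<and>
     p' \<in> hom1 K (dom1 K p') (dom1 K f) \<and> q \<in> hom1 K (dom1 K p') (dom1 K p) \<and>
     p \<cdot>\<^bsub>K\<^esub> q = f \<cdot>\<^bsub>K\<^esub> p' \<and>
     (\<forall>X \<in> Obj K. \<forall>h \<in> hom1 K X (dom1 K f). \<forall>k \<in> hom1 K X (dom1 K p).
        p \<cdot>\<^bsub>K\<^esub> k = f \<cdot>\<^bsub>K\<^esub> h \<longrightarrow>
          (\<exists>!l. l \<in> hom1 K X (dom1 K p') \<and> p' \<cdot>\<^bsub>K\<^esub> l = h \<and> q \<cdot>\<^bsub>K\<^esub> l = k)) \<and>
     (\<forall>X \<in> Obj K. \<forall>l \<in> hom1 K X (dom1 K p'). \<forall>l' \<in> hom1 K X (dom1 K p').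
        \<forall>\<phi> \<in> hom2 K (p' \<cdot>\<^bsub>K\<^esub> l) (p' \<cdot>\<^bsub>K\<^esub> l'). \<forall>\<psi> \<in> hom2 K (q \<cdot>\<^bsub>K\<^esub> l) (q \<cdot>\<^bsub>K\<^esub> l').
          p \<rhd>\<^bsub>K\<^esub> \<psi> = f \<rhd>\<^bsub>K\<^esub> \<phi> \<longrightarrow>
            (\<exists>!\<kappa>. \<kappa> \<in> hom2 K l l' \<and> p' \<rhd>\<^bsub>K\<^esub> \<kappa> = \<phi> \<and> q \<rhd>\<^bsub>K\<^esub> \<kappa> = \<psi>))"

definition left_tight_pullback ::
    "('o, 'a, 'c, 'm) enh_two_cat_scheme \<Rightarrow> 'a \<Rightarrow> 'a \<Rightarrow> 'a \<Rightarrow> 'a \<Rightarrow> bool" where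
  "left_tight_pullback K p f p' q \<longleftrightarrow> pullback K p f p' q \<and> p \<in> Tight K \<and> p' \<in> Tight K \<and>
     (\<forall>h \<in> Arr K. cod1 K h = dom1 K p' \<and> p' \<cdot>\<^bsub>K\<^esub> h \<in> Tight K \<longrightarrow> h \<in> Tight K)"

text \<open>\<open>pb p f\<close> is the chosen pullback of the small \<open>p\<close> along \<open>f\<close>, and \<open>pbtop p f\<close> is the
  opposite projection, from the domain of \<open>pb p f\<close> to the domain of \<open>p\<close>. Smallness is required
  of the chosen pullbacks only: a class that contains every left-tight pullback of its members
  would be closed under precomposition with tight isomorphisms, and strict morphisms of algebras are
  not closed under precomposition with pseudo isomorphisms.\<close>

record ('o, 'a, 'c) plumbus_data = "('o, 'a, 'c) enh_two_cat" +
  One   :: 'o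
  Small :: "'a set"
  pb    :: "'a \<Rightarrow> 'a \<Rightarrow> 'a"
  pbtop :: "'a \<Rightarrow> 'a \<Rightarrow> 'a"

locale plumbus = repletely_enhanced_two_category K
  for K :: "('o, 'a, 'c, 'm) plumbus_data_scheme" (structure) +
  assumes one_terminal: "tight_terminal K (One K)"
    and small_opfib: "p \<in> Small K \<Longrightarrow> tight_discrete_opfibration K p"
    and pb_small: "p \<in> Small K \<Longrightarrow> f \<in> Arr K \<Longrightarrow> cod1 K f = cod1 K p \<Longrightarrow> pb K p f \<in> Small K"
    and pb_pullback: "p \<in> Small K \<Longrightarrow> f \<in> Arr K \<Longrightarrow> cod1 K f = cod1 K p \<Longrightarrow>
           left_tight_pullback K p f (pb K p f) (pbtop K p f)"
    and pb_id1: "p \<in> Small K \<Longrightarrow>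
           pb K p (Id1 K (cod1 K p)) = p \<and> pbtop K p (Id1 K (cod1 K p)) = Id1 K (dom1 K p)"
    and pb_comp1: "p \<in> Small K \<Longrightarrow> f \<in> Arr K \<Longrightarrow> g \<in> Arr K \<Longrightarrow>
           cod1 K f = cod1 K p \<Longrightarrow> cod1 K g = dom1 K f \<Longrightarrow>
           pb K p (f \<cdot> g) = pb K (pb K p f) g \<and>
           pbtop K p (f \<cdot> g) = pbtop K p f \<cdot> pbtop K (pb K p f) g"

text \<open>A commuting square from \<open>p : E \<rightarrow> B\<close> to \<open>p' : E' \<rightarrow> B'\<close> is a pair \<open>(g, f)\<close> with
  \<open>g : E \<leadsto> E'\<close>, \<open>f : B \<leadsto> B'\<close>. Together with the compatible pairs of 2-cells below, these are
  the 1-cells and 2-cells of the 2-category of small discrete opfibrations.\<close>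

definition comm_square :: "('o, 'a, 'c, 'm) two_cat_scheme \<Rightarrow> 'a \<Rightarrow> 'a \<Rightarrow> 'a \<times> 'a \<Rightarrow> bool" where
  "comm_square K p p' s \<longleftrightarrow>
     fst s \<in> hom1 K (dom1 K p) (dom1 K p') \<and> snd s \<in> hom1 K (cod1 K p) (cod1 K p') \<and>
     p' \<cdot>\<^bsub>K\<^esub> fst s = snd s \<cdot>\<^bsub>K\<^esub> p"

definition square_cells ::
    "('o, 'a, 'c, 'm) two_cat_scheme \<Rightarrow> 'a \<Rightarrow> 'a \<Rightarrow> 'a \<times> 'a \<Rightarrow> 'a \<times> 'a \<Rightarrow> ('c \<times> 'c) set" where
  "square_cells K p p' s s' =
     {(\<gamma>t, \<gamma>). \<gamma>t \<in> hom2 K (fst s) (fst s') \<and> \<gamma> \<in> hom2 K (snd s) (snd s') \<and>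
               p' \<rhd>\<^bsub>K\<^esub> \<gamma>t = \<gamma> \<lhd>\<^bsub>K\<^esub> p}"

text \<open>\<open>dt p\<close> and \<open>d p\<close> are the top and the bottom side of the chosen classifying square from
  \<open>p\<close> to \<open>u\<close>.\<close>

locale enhanced_two_classifier = plumbus K
  for K :: "('o, 'a, 'c, 'm) plumbus_data_scheme" (structure)
    and u :: 'a and dt :: "'a \<Rightarrow> 'a" and d :: "'a \<Rightarrow> 'a" +
  assumes u_small: "u \<in> Small K"
    and classify: "p \<in> Small K \<Longrightarrow>
           comm_square K p u (dt p, d p) \<and> pullback K u (d p) p (dt p)"
    and classify_cells: "p \<in> Small K \<Longrightarrow> p' \<in> Small K \<Longrightarrow> comm_square K p p' (g, f) \<Longrightarrow>
           \<exists>!\<gamma>. \<gamma> \<in> square_cells K p u (dt p, d p) (dt p' \<cdot> g, d p' \<cdot> f)"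
    and classify_iso: "p \<in> Small K \<Longrightarrow> p' \<in> Small K \<Longrightarrow> comm_square K p p' (g, f) \<Longrightarrow>
           pullback K p' f p g \<Longrightarrow>
           (\<gamma>t, \<gamma>) \<in> square_cells K p u (dt p, d p) (dt p' \<cdot> g, d p' \<cdot> f) \<Longrightarrow>
           iso2 K \<gamma>t \<and> iso2 K \<gamma>"
    and classify_u: "\<exists>\<gamma>t \<gamma>. (\<gamma>t, \<gamma>) \<in> square_cells K u u (dt u, d u)
                               (Id1 K (dom1 K u), Id1 K (cod1 K u)) \<and> iso2 K \<gamma>t \<and> iso2 K \<gamma>"

locale representable_plumbus = enhanced_two_classifier K u dt d
  for K :: "('o, 'a, 'c, 'm) plumbus_data_scheme" (structure)
    and u :: 'a and dt :: "'a \<Rightarrow> 'a" and d :: "'a \<Rightarrow> 'a" +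
  assumes id_one_small: "Id1 K (One K) \<in> Small K"

definition perfect :: "('o, 'a, 'c, 'm) plumbus_data_scheme \<Rightarrow> ('a \<Rightarrow> 'a) \<Rightarrow> 'a \<Rightarrow> bool" where
  "perfect K d p \<longleftrightarrow> p \<in> Small K \<and> d p \<in> Tight K"

record ('o, 'a, 'c) monad_data =
  T0  :: "'o \<Rightarrow> 'o"
  T1  :: "'a \<Rightarrow> 'a"
  T2  :: "'c \<Rightarrow> 'c"
  unt :: "'o \<Rightarrow> 'a"
  mul :: "'o \<Rightarrow> 'a"

locale enhanced_two_monad = enhanced_two_category K
  for K :: "('o, 'a, 'c, 'm) enh_two_cat_scheme" (structure)
    and T :: "('o, 'a, 'c) monad_data" +
  assumes T0_in: "X \<in> Obj K \<Longrightarrow> T0 T X \<in> Obj K"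
    and T1_in: "f \<in> hom1 K X Y \<Longrightarrow> T1 T f \<in> hom1 K (T0 T X) (T0 T Y)"
    and T2_in: "\<phi> \<in> hom2 K f g \<Longrightarrow> T2 T \<phi> \<in> hom2 K (T1 T f) (T1 T g)"
    and T1_id1: "X \<in> Obj K \<Longrightarrow> T1 T (Id1 K X) = Id1 K (T0 T X)"
    and T1_comp1: "f \<in> hom1 K X Y \<Longrightarrow> g \<in> hom1 K Y Z \<Longrightarrow> T1 T (g \<cdot> f) = T1 T g \<cdot> T1 T f"
    and T2_id2: "f \<in> Arr K \<Longrightarrow> T2 T (Id2 K f) = Id2 K (T1 T f)"
    and T2_vcomp: "\<phi> \<in> hom2 K f g \<Longrightarrow> \<psi> \<in> hom2 K g h \<Longrightarrow>
           T2 T (\<psi> \<bullet> \<phi>) = T2 T \<psi> \<bullet> T2 T \<phi>"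
    and T2_hcomp: "f \<in> hom1 K X Y \<Longrightarrow> g \<in> hom1 K Y Z \<Longrightarrow>
           \<phi> \<in> hom2 K f f' \<Longrightarrow> \<psi> \<in> hom2 K g g' \<Longrightarrow> T2 T (\<psi> \<star> \<phi>) = T2 T \<psi> \<star> T2 T \<phi>"
    and T1_tight: "f \<in> Tight K \<Longrightarrow> T1 T f \<in> Tight K"
    and unt_in: "X \<in> Obj K \<Longrightarrow> unt T X \<in> hom1 K X (T0 T X)"
    and unt_tight: "X \<in> Obj K \<Longrightarrow> unt T X \<in> Tight K"
    and unt_nat1: "f \<in> hom1 K X Y \<Longrightarrow> unt T Y \<cdot> f = T1 T f \<cdot> unt T X"
    and unt_nat2: "f \<in> hom1 K X Y \<Longrightarrow> \<phi> \<in> hom2 K f g \<Longrightarrow> unt T Y \<rhd> \<phi> = T2 T \<phi> \<lhd> unt T X"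
    and mul_in: "X \<in> Obj K \<Longrightarrow> mul T X \<in> hom1 K (T0 T (T0 T X)) (T0 T X)"
    and mul_tight: "X \<in> Obj K \<Longrightarrow> mul T X \<in> Tight K"
    and mul_nat1: "f \<in> hom1 K X Y \<Longrightarrow> mul T Y \<cdot> T1 T (T1 T f) = T1 T f \<cdot> mul T X"
    and mul_nat2: "f \<in> hom1 K X Y \<Longrightarrow> \<phi> \<in> hom2 K f g \<Longrightarrow>
           mul T Y \<rhd> T2 T (T2 T \<phi>) = T2 T \<phi> \<lhd> mul T X"
    and mul_unt: "X \<in> Obj K \<Longrightarrow> mul T X \<cdot> unt T (T0 T X) = Id1 K (T0 T X)"
    and mul_T_unt: "X \<in> Obj K \<Longrightarrow> mul T X \<cdot> T1 T (unt T X) = Id1 K (T0 T X)"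
    and mul_mul: "X \<in> Obj K \<Longrightarrow> mul T X \<cdot> mul T (T0 T X) = mul T X \<cdot> T1 T (mul T X)"

locale opfibrantly_cartesian = enhanced_two_monad K T
  for K :: "('o, 'a, 'c, 'm) plumbus_data_scheme" (structure)
    and T :: "('o, 'a, 'c) monad_data"
    and u :: 'a and d :: "'a \<Rightarrow> 'a" +
  assumes T_u_small: "T1 T u \<in> Small K"
    and T_pullback_u: "pullback K u f p q \<Longrightarrow> pullback K (T1 T u) (T1 T f) (T1 T p) (T1 T q)"
    and T_u_perfect: "perfect K d (T1 T u)"

datatype ('o, 'a, 'c) lalg = LAlg (carr: 'o) (act: 'a) (unitor: 'c) (multor: 'c)
datatype ('o, 'a, 'c) lmor =
  LMor (ldom: "('o, 'a, 'c) lalg") (lcod: "('o, 'a, 'c) lalg") (und1: 'a) (str2: 'c)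
datatype ('o, 'a, 'c) lcell =
  LCell (ldom2: "('o, 'a, 'c) lmor") (lcod2: "('o, 'a, 'c) lmor") (und2: 'c)

definition lax_algebra ::
    "('o, 'a, 'c, 'm) enh_two_cat_scheme \<Rightarrow> ('o, 'a, 'c) monad_data \<Rightarrow> ('o, 'a, 'c) lalg \<Rightarrow> bool" where
  "lax_algebra K T A \<longleftrightarrow>
     (let X = carr A; \<alpha> = act A; \<upsilon> = unitor A; \<mu> = multor A; TX = T0 T X in
      X \<in> Obj K \<and> \<alpha> \<in> hom1 K TX X \<and> \<alpha> \<in> Tight K \<and>
      \<upsilon> \<in> hom2 K (Id1 K X) (\<alpha> \<cdot>\<^bsub>K\<^esub> unt T X) \<and>
      \<mu> \<in> hom2 K (\<alpha> \<cdot>\<^bsub>K\<^esub> T1 T \<alpha>) (\<alpha> \<cdot>\<^bsub>K\<^esub> mul T X) \<and>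
      (\<mu> \<lhd>\<^bsub>K\<^esub> unt T TX) \<bullet>\<^bsub>K\<^esub> (\<upsilon> \<lhd>\<^bsub>K\<^esub> \<alpha>) = Id2 K \<alpha> \<and>
      (\<mu> \<lhd>\<^bsub>K\<^esub> T1 T (unt T X)) \<bullet>\<^bsub>K\<^esub> (\<alpha> \<rhd>\<^bsub>K\<^esub> T2 T \<upsilon>) = Id2 K \<alpha> \<and>
      (\<mu> \<lhd>\<^bsub>K\<^esub> mul T TX) \<bullet>\<^bsub>K\<^esub> (\<mu> \<lhd>\<^bsub>K\<^esub> T1 T (T1 T \<alpha>))
        = (\<mu> \<lhd>\<^bsub>K\<^esub> T1 T (mul T X)) \<bullet>\<^bsub>K\<^esub> (\<alpha> \<rhd>\<^bsub>K\<^esub> T2 T \<mu>))"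

definition lax_morphism ::
    "('o, 'a, 'c, 'm) enh_two_cat_scheme \<Rightarrow> ('o, 'a, 'c) monad_data \<Rightarrow> ('o, 'a, 'c) lmor \<Rightarrow> bool" where
  "lax_morphism K T F \<longleftrightarrow>
     (let A = ldom F; B = lcod F; f = und1 F; \<phi> = str2 F; \<alpha> = act A; \<beta> = act B in
      lax_algebra K T A \<and> lax_algebra K T B \<and>
      f \<in> hom1 K (carr A) (carr B) \<and>
      \<phi> \<in> hom2 K (\<beta> \<cdot>\<^bsub>K\<^esub> T1 T f) (f \<cdot>\<^bsub>K\<^esub> \<alpha>) \<and>
      f \<rhd>\<^bsub>K\<^esub> unitor A = (\<phi> \<lhd>\<^bsub>K\<^esub> unt T (carr A)) \<bullet>\<^bsub>K\<^esub> (unitor B \<lhd>\<^bsub>K\<^esub> f) \<and>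
      (f \<rhd>\<^bsub>K\<^esub> multor A) \<bullet>\<^bsub>K\<^esub> (\<phi> \<lhd>\<^bsub>K\<^esub> T1 T \<alpha>) \<bullet>\<^bsub>K\<^esub> (\<beta> \<rhd>\<^bsub>K\<^esub> T2 T \<phi>)
        = (\<phi> \<lhd>\<^bsub>K\<^esub> mul T (carr A)) \<bullet>\<^bsub>K\<^esub> (multor B \<lhd>\<^bsub>K\<^esub> T1 T (T1 T f)))"

definition pseudo_morphism ::
    "('o, 'a, 'c, 'm) enh_two_cat_scheme \<Rightarrow> ('o, 'a, 'c) monad_data \<Rightarrow> ('o, 'a, 'c) lmor \<Rightarrow> bool" where
  "pseudo_morphism K T F \<longleftrightarrow> lax_morphism K T F \<and> iso2 K (str2 F)"

definition strict_morphism ::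
    "('o, 'a, 'c, 'm) enh_two_cat_scheme \<Rightarrow> ('o, 'a, 'c) monad_data \<Rightarrow> ('o, 'a, 'c) lmor \<Rightarrow> bool" where
  "strict_morphism K T F \<longleftrightarrow> lax_morphism K T F \<and> str2 F = Id2 K (dom2 K (str2 F))"

definition T_two_morphism ::
    "('o, 'a, 'c, 'm) enh_two_cat_scheme \<Rightarrow> ('o, 'a, 'c) monad_data \<Rightarrow> ('o, 'a, 'c) lcell \<Rightarrow> bool" where
  "T_two_morphism K T \<Phi> \<longleftrightarrow>
     (let F = ldom2 \<Phi>; G = lcod2 \<Phi>; \<phi> = und2 \<Phi> in
      lax_morphism K T F \<and> lax_morphism K T G \<and> ldom F = ldom G \<and> lcod F = lcod G \<and>
      \<phi> \<in> hom2 K (und1 F) (und1 G) \<and>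
      (\<phi> \<lhd>\<^bsub>K\<^esub> act (ldom F)) \<bullet>\<^bsub>K\<^esub> str2 F = str2 G \<bullet>\<^bsub>K\<^esub> (act (lcod F) \<rhd>\<^bsub>K\<^esub> T2 T \<phi>))"

definition lmor_id ::
    "('o, 'a, 'c, 'm) enh_two_cat_scheme \<Rightarrow> ('o, 'a, 'c) lalg \<Rightarrow> ('o, 'a, 'c) lmor" where
  "lmor_id K A = LMor A A (Id1 K (carr A)) (Id2 K (act A))"

definition lmor_comp ::
    "('o, 'a, 'c, 'm) enh_two_cat_scheme \<Rightarrow> ('o, 'a, 'c) monad_data \<Rightarrow>
     ('o, 'a, 'c) lmor \<Rightarrow> ('o, 'a, 'c) lmor \<Rightarrow> ('o, 'a, 'c) lmor" where
  "lmor_comp K T G F = LMor (ldom F) (lcod G) (und1 G \<cdot>\<^bsub>K\<^esub> und1 F)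
     ((und1 G \<rhd>\<^bsub>K\<^esub> str2 F) \<bullet>\<^bsub>K\<^esub> (str2 G \<lhd>\<^bsub>K\<^esub> T1 T (und1 F)))"

definition one_lalg ::
    "('o, 'a, 'c, 'm) plumbus_data_scheme \<Rightarrow> ('o, 'a, 'c) monad_data \<Rightarrow> ('o, 'a, 'c) lalg" where
  "one_lalg K T = (let a = (THE a. a \<in> hom1 K (T0 T (One K)) (One K))
                   in LAlg (One K) a (Id2 K (Id1 K (One K))) (Id2 K (a \<cdot>\<^bsub>K\<^esub> T1 T a)))"

definition small_strict ::
    "('o, 'a, 'c, 'm) plumbus_data_scheme \<Rightarrow> ('o, 'a, 'c) monad_data \<Rightarrow> ('o, 'a, 'c) lmor \<Rightarrow> bool" where
  "small_strict K T P \<longleftrightarrow> strict_morphism K T P \<and> und1 P \<in> Small K"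

text \<open>The chosen pullback of a small strict \<open>P\<close> along a lax \<open>F\<close> is the unique commuting square of
  lax morphisms that lies over the chosen pullback square in \<open>K\<close> and whose left side is strict. Its
  algebra structure is the one obtained by lifting the structure 2-cell of \<open>F\<close> along \<open>P\<close>: the
  action, the structure 2-cell of the opposite projection, the unitor and the multiplicator are all
  determined by these requirements, as \<open>P\<close> and its pullback are discrete opfibrations.\<close>

definition lax_pb ::
    "('o, 'a, 'c, 'm) plumbus_data_scheme \<Rightarrow> ('o, 'a, 'c) monad_data \<Rightarrow>
     ('o, 'a, 'c) lmor \<Rightarrow> ('o, 'a, 'c) lmor \<Rightarrow> ('o, 'a, 'c) lmor \<times> ('o, 'a, 'c) lmor" where
  "lax_pb K T P F = (THE s.
     strict_morphism K T (fst s) \<and> lax_morphism K T (snd s) \<and>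
     ldom (snd s) = ldom (fst s) \<and> lcod (fst s) = ldom F \<and> lcod (snd s) = ldom P \<and>
     und1 (fst s) = pb K (und1 P) (und1 F) \<and> und1 (snd s) = pbtop K (und1 P) (und1 F) \<and>
     lmor_comp K T P (snd s) = lmor_comp K T F (fst s))"

definition LaxAlg ::
    "('o, 'a, 'c, 'm) plumbus_data_scheme \<Rightarrow> ('o, 'a, 'c) monad_data \<Rightarrow>
     (('o, 'a, 'c) lalg, ('o, 'a, 'c) lmor, ('o, 'a, 'c) lcell) plumbus_data" where
  "LaxAlg K T = \<lparr>
     Obj = {A. lax_algebra K T A},
     Arr = {F. lax_morphism K T F},
     Cell = {\<Phi>. T_two_morphism K T \<Phi>},
     dom1 = ldom, cod1 = lcod, dom2 = ldom2, cod2 = lcod2,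
     Id1 = lmor_id K,
     Comp1 = lmor_comp K T,
     Id2 = (\<lambda>F. LCell F F (Id2 K (und1 F))),
     Vcomp = (\<lambda>\<Psi> \<Phi>. LCell (ldom2 \<Phi>) (lcod2 \<Psi>) (und2 \<Psi> \<bullet>\<^bsub>K\<^esub> und2 \<Phi>)),
     Hcomp = (\<lambda>\<Psi> \<Phi>. LCell (lmor_comp K T (ldom2 \<Psi>) (ldom2 \<Phi>))
                          (lmor_comp K T (lcod2 \<Psi>) (lcod2 \<Phi>)) (und2 \<Psi> \<star>\<^bsub>K\<^esub> und2 \<Phi>)),
     Tight = {F. pseudo_morphism K T F \<and> und1 F \<in> Tight K},
     One = one_lalg K T,
     Small = {P. small_strict K T P},
     pb = (\<lambda>P F. fst (lax_pb K T P F)),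
     pbtop = (\<lambda>P F. snd (lax_pb K T P F)) \<rparr>"

text \<open>Pairs have the cell for the domain of \<open>u\<close> first and the one for its codomain second.\<close>

definition canonical_unitors ::
    "('o, 'a, 'c, 'm) two_cat_scheme \<Rightarrow> ('o, 'a, 'c) monad_data \<Rightarrow>
     'a \<Rightarrow> ('a \<Rightarrow> 'a) \<Rightarrow> ('a \<Rightarrow> 'a) \<Rightarrow> 'c \<times> 'c" where
  "canonical_unitors K T u dt d =
     (let \<omega>t = dt (T1 T u); \<omega> = d (T1 T u) in
      THE \<gamma>. \<gamma> \<in> square_cells K u u
        (Id1 K (dom1 K u), Id1 K (cod1 K u))
        (\<omega>t \<cdot>\<^bsub>K\<^esub> unt T (dom1 K u), \<omega> \<cdot>\<^bsub>K\<^esub> unt T (cod1 K u)))"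

definition canonical_multors ::
    "('o, 'a, 'c, 'm) two_cat_scheme \<Rightarrow> ('o, 'a, 'c) monad_data \<Rightarrow>
     'a \<Rightarrow> ('a \<Rightarrow> 'a) \<Rightarrow> ('a \<Rightarrow> 'a) \<Rightarrow> 'c \<times> 'c" where
  "canonical_multors K T u dt d =
     (let \<omega>t = dt (T1 T u); \<omega> = d (T1 T u) in
      THE \<gamma>. \<gamma> \<in> square_cells K (T1 T (T1 T u)) u
        (\<omega>t \<cdot>\<^bsub>K\<^esub> T1 T \<omega>t, \<omega> \<cdot>\<^bsub>K\<^esub> T1 T \<omega>)
        (\<omega>t \<cdot>\<^bsub>K\<^esub> mul T (dom1 K u), \<omega> \<cdot>\<^bsub>K\<^esub> mul T (cod1 K u)))"

definition canonical_top ::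
    "('o, 'a, 'c, 'm) two_cat_scheme \<Rightarrow> ('o, 'a, 'c) monad_data \<Rightarrow>
     'a \<Rightarrow> ('a \<Rightarrow> 'a) \<Rightarrow> ('a \<Rightarrow> 'a) \<Rightarrow> ('o, 'a, 'c) lalg" where
  "canonical_top K T u dt d = LAlg (dom1 K u) (dt (T1 T u))
     (fst (canonical_unitors K T u dt d)) (fst (canonical_multors K T u dt d))"

definition canonical_base ::
    "('o, 'a, 'c, 'm) two_cat_scheme \<Rightarrow> ('o, 'a, 'c) monad_data \<Rightarrow>
     'a \<Rightarrow> ('a \<Rightarrow> 'a) \<Rightarrow> ('a \<Rightarrow> 'a) \<Rightarrow> ('o, 'a, 'c) lalg" where
  "canonical_base K T u dt d = LAlg (cod1 K u) (d (T1 T u))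
     (snd (canonical_unitors K T u dt d)) (snd (canonical_multors K T u dt d))"

definition canonical_u ::
    "('o, 'a, 'c, 'm) two_cat_scheme \<Rightarrow> ('o, 'a, 'c) monad_data \<Rightarrow>
     'a \<Rightarrow> ('a \<Rightarrow> 'a) \<Rightarrow> ('a \<Rightarrow> 'a) \<Rightarrow> ('o, 'a, 'c) lmor" where
  "canonical_u K T u dt d = LMor (canonical_top K T u dt d) (canonical_base K T u dt d)
     u (Id2 K (u \<cdot>\<^bsub>K\<^esub> dt (T1 T u)))"

end

theory Submission
  imports Defs
begin

text \<open>Two principles carry the proof, one for each half of the claim.

  \<^item> A 2-cell is determined by its domain and its image under a discrete opfibration \<open>p\<close>
    (\<open>opf_eqI\<close>), and any 2-cell that starts at \<open>p \<cdot> e\<close> has a lift that starts at \<open>e\<close>. Let \<open>P\<close> be a strict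
    morphism over such a \<open>p\<close>. Any equation demanded of a lax morphism into the domain of \<open>P\<close>, of an
    algebra structure on the domain of \<open>p\<close>, or of a 2-cell of lax morphisms has two sides with the
    same domain, so it may be checked after applying \<open>p\<close>, where it is the corresponding equation
    downstairs (\<open>lax_morphism_reflect\<close>, \<open>lax_algebra_reflect\<close>, \<open>T_two_morphism_reflect\<close>). Hence
    strict morphisms over discrete opfibrations are discrete opfibrations of lax algebras. Along a
    lax \<open>F\<close>, the structure 2-cell of \<open>F\<close> is lifted to obtain the only possible algebra structure
    on the pullback; and every square of lax morphisms that has two parallel sides of this
    kind and lies over a pullback is a pullback (\<open>pullback_lift\<close>). This makes the lax algebras a
    plumbus; the functoriality of its chosen pullbacks is a matter of uniqueness.

  \<^item> A pullback square from any \<open>p\<close> to the classifier \<open>u\<close> is initial among all the commuting squares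
    from \<open>p\<close> to \<open>u\<close> (\<open>pullback_initial\<close>). For small \<open>p\<close> this restates that \<open>u\<close> is marked-lax
    terminal, and an arbitrary pullback of \<open>u\<close> is isomorphic over its base to a small one. As \<open>T\<close>
    preserves pullbacks of \<open>u\<close> and \<open>T u\<close> is itself a pullback of \<open>u\<close>, the squares that arise from
    \<open>u\<close> or from classifying squares by applying \<open>T\<close> repeatedly and pasting with the classifying
    square of \<open>T u\<close> are pullbacks again (\<open>pullback_T_step\<close>). So the pairs of 2-cells that have to be found
    start at an initial square, and so do both sides of the equations between them that have to be
    checked. The equations always come in pairs, one over the codomain and one over the
    domain of \<open>u\<close>, and compatibility with \<open>u\<close> is the only thing to verify. In this way one gets the
    laws of the canonical algebras, the lax structure on a classifying map \<open>d p\<close>, and the fact that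
    the classifying 2-cells of the underlying squares are 2-cells of lax morphisms.

  One clause of the classifier runs in the opposite direction: a pullback square of lax algebras must
  induce invertible 2-cells. Such a square is isomorphic to the chosen pullback, which lies over
  a pullback, so it lies over a pullback too (\<open>LaxAlg_pullback_underlying\<close>).

  All calculations with 2-cells use one normal form: a vertical composite, bracketed to the right, of
  cells \<open>(h \<rhd> \<phi>) \<lhd> f\<close> with composite arrows \<open>h\<close> and \<open>f\<close>. The typing facts and the laws that lead to
  it are rewrite rules, so most equations reduce to quoting an axiom whiskered on either side.\<close>

section \<open>Whiskering calculus in a 2-category\<close>

lemma mem_hom1 [simp]: "f \<in> hom1 K X Y \<longleftrightarrow> f \<in> Arr K \<and> dom1 K f = X \<and> cod1 K f = Y"
  by (auto simp: hom1_def)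

lemma mem_hom2 [simp]: "\<phi> \<in> hom2 K f g \<longleftrightarrow> \<phi> \<in> Cell K \<and> dom2 K \<phi> = f \<and> cod2 K \<phi> = g"
  by (auto simp: hom2_def)

context two_category
begin

text \<open>The axioms speak of hom-sets, whose end points occur in the assumptions only. Rewriting needs
  composability to be a side condition on \<open>dom1\<close>, \<open>cod1\<close>, \<open>dom2\<close>, \<open>cod2\<close> that can itself be
  solved by rewriting, so the axioms are restated in that form.\<close>

lemma arr_dom_cod [simp]:
  assumes "f \<in> Arr K"
  shows "dom1 K f \<in> Obj K" "cod1 K f \<in> Obj K"
  using arr_obj[OF assms] by auto

lemma id1_typing [simp]:
  assumes "X \<in> Obj K"
  shows "Id1 K X \<in> Arr K" "dom1 K (Id1 K X) = X" "cod1 K (Id1 K X) = X"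
  using id1_in[OF assms] by auto

lemma comp1_typing [simp]:
  assumes "f \<in> Arr K" "g \<in> Arr K" "cod1 K f = dom1 K g"
  shows "g \<cdot> f \<in> Arr K" "dom1 K (g \<cdot> f) = dom1 K f" "cod1 K (g \<cdot> f) = cod1 K g"
  using comp1_in[of f "dom1 K f" "dom1 K g" g "cod1 K g"] assms by auto

lemma comp1_assoc' [simp]:
  assumes "f \<in> Arr K" "g \<in> Arr K" "h \<in> Arr K" "cod1 K f = dom1 K g" "cod1 K g = dom1 K h"
  shows "(h \<cdot> g) \<cdot> f = h \<cdot> g \<cdot> f"
  using comp1_assoc[of f "dom1 K f" "dom1 K g" g "dom1 K h" h "cod1 K h"] assms by auto

lemma comp1_id [simp]:
  assumes "f \<in> Arr K"
  shows "cod1 K f = Y \<Longrightarrow> Id1 K Y \<cdot> f = f" "dom1 K f = X \<Longrightarrow> f \<cdot> Id1 K X = f"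
  using comp1_id_left[of f] comp1_id_right[of f] assms by auto

lemma cell_typing [simp]:
  assumes "\<phi> \<in> Cell K"
  shows "dom2 K \<phi> \<in> Arr K" "cod2 K \<phi> \<in> Arr K"
    "dom1 K (cod2 K \<phi>) = dom1 K (dom2 K \<phi>)" "cod1 K (cod2 K \<phi>) = cod1 K (dom2 K \<phi>)"
  using cell_arr[OF assms] by auto

lemma id2_typing [simp]:
  assumes "f \<in> Arr K"
  shows "Id2 K f \<in> Cell K" "dom2 K (Id2 K f) = f" "cod2 K (Id2 K f) = f"
  using id2_in[OF assms] by auto

lemma vcomp_typing [simp]:
  assumes "\<phi> \<in> Cell K" "\<psi> \<in> Cell K" "cod2 K \<phi> = dom2 K \<psi>"
  shows "\<psi> \<bullet> \<phi> \<in> Cell K" "dom2 K (\<psi> \<bullet> \<phi>) = dom2 K \<phi>" "cod2 K (\<psi> \<bullet> \<phi>) = cod2 K \<psi>"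
  using vcomp_in[of \<phi> "dom2 K \<phi>" "dom2 K \<psi>" \<psi> "cod2 K \<psi>"] assms by auto

lemma vcomp_assoc' [simp]:
  assumes "\<phi> \<in> Cell K" "\<psi> \<in> Cell K" "\<chi> \<in> Cell K" "cod2 K \<phi> = dom2 K \<psi>" "cod2 K \<psi> = dom2 K \<chi>"
  shows "(\<chi> \<bullet> \<psi>) \<bullet> \<phi> = \<chi> \<bullet> \<psi> \<bullet> \<phi>"
  using vcomp_assoc[of \<phi> "dom2 K \<phi>" "dom2 K \<psi>" \<psi> "dom2 K \<chi>" \<chi> "cod2 K \<chi>"] assms by auto

lemma vcomp_id [simp]:
  assumes "\<phi> \<in> Cell K"
  shows "cod2 K \<phi> = g \<Longrightarrow> Id2 K g \<bullet> \<phi> = \<phi>" "dom2 K \<phi> = f \<Longrightarrow> \<phi> \<bullet> Id2 K f = \<phi>"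
  using vcomp_id_left[of \<phi>] vcomp_id_right[of \<phi>] assms by auto

lemma hcomp_typing [simp]:
  assumes "\<phi> \<in> Cell K" "\<psi> \<in> Cell K" "cod1 K (dom2 K \<phi>) = dom1 K (dom2 K \<psi>)"
  shows "\<psi> \<star> \<phi> \<in> Cell K" "dom2 K (\<psi> \<star> \<phi>) = dom2 K \<psi> \<cdot> dom2 K \<phi>"
    "cod2 K (\<psi> \<star> \<phi>) = cod2 K \<psi> \<cdot> cod2 K \<phi>"
  using hcomp_in[of "dom2 K \<phi>" "dom1 K (dom2 K \<phi>)" "dom1 K (dom2 K \<psi>)" "dom2 K \<psi>"
      "cod1 K (dom2 K \<psi>)" \<phi> "cod2 K \<phi>" \<psi> "cod2 K \<psi>"] assms by auto

lemma interchange':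
  assumes "\<phi> \<in> Cell K" "\<phi>' \<in> Cell K" "cod2 K \<phi> = dom2 K \<phi>'"
    "\<psi> \<in> Cell K" "\<psi>' \<in> Cell K" "cod2 K \<psi> = dom2 K \<psi>'"
    "cod1 K (dom2 K \<phi>) = dom1 K (dom2 K \<psi>)"
  shows "(\<psi>' \<bullet> \<psi>) \<star> (\<phi>' \<bullet> \<phi>) = (\<psi>' \<star> \<phi>') \<bullet> (\<psi> \<star> \<phi>)"
  using interchange[of "dom2 K \<phi>" "dom1 K (dom2 K \<phi>)" "dom1 K (dom2 K \<psi>)" "dom2 K \<psi>"
      "cod1 K (dom2 K \<psi>)" \<phi> "cod2 K \<phi>" \<phi>' "cod2 K \<phi>'" \<psi> "cod2 K \<psi>" \<psi>' "cod2 K \<psi>'"] assms by auto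

lemma hcomp_assoc':
  assumes "\<phi> \<in> Cell K" "\<psi> \<in> Cell K" "\<chi> \<in> Cell K"
    "cod1 K (dom2 K \<phi>) = dom1 K (dom2 K \<psi>)" "cod1 K (dom2 K \<psi>) = dom1 K (dom2 K \<chi>)"
  shows "(\<chi> \<star> \<psi>) \<star> \<phi> = \<chi> \<star> (\<psi> \<star> \<phi>)"
  using hcomp_assoc[of "dom2 K \<phi>" "dom1 K (dom2 K \<phi>)" "dom1 K (dom2 K \<psi>)" "dom2 K \<psi>"
      "dom1 K (dom2 K \<chi>)" "dom2 K \<chi>" "cod1 K (dom2 K \<chi>)" \<phi> "cod2 K \<phi>" \<psi> "cod2 K \<psi>" \<chi> "cod2 K \<chi>"]
    assms by auto

lemma hcomp_id2' [simp]:
  assumes "f \<in> Arr K" "g \<in> Arr K" "cod1 K f = dom1 K g"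
  shows "Id2 K g \<star> Id2 K f = Id2 K (g \<cdot> f)"
  using hcomp_id2[of f "dom1 K f" "dom1 K g" g "cod1 K g"] assms by auto

lemma whiskL_typing [simp]:
  assumes "\<phi> \<in> Cell K" "g \<in> Arr K" "cod1 K (dom2 K \<phi>) = dom1 K g"
  shows "g \<rhd> \<phi> \<in> Cell K" "dom2 K (g \<rhd> \<phi>) = g \<cdot> dom2 K \<phi>" "cod2 K (g \<rhd> \<phi>) = g \<cdot> cod2 K \<phi>"
  using assms by (simp_all add: whiskL_def)

lemma whiskR_typing [simp]:
  assumes "\<phi> \<in> Cell K" "f \<in> Arr K" "cod1 K f = dom1 K (dom2 K \<phi>)"
  shows "\<phi> \<lhd> f \<in> Cell K" "dom2 K (\<phi> \<lhd> f) = dom2 K \<phi> \<cdot> f" "cod2 K (\<phi> \<lhd> f) = cod2 K \<phi> \<cdot> f"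
  using assms by (simp_all add: whiskR_def)

lemma whiskL_vcomp [simp]:
  assumes "\<phi> \<in> Cell K" "\<psi> \<in> Cell K" "cod2 K \<phi> = dom2 K \<psi>" "g \<in> Arr K"
    "cod1 K (dom2 K \<phi>) = dom1 K g"
  shows "g \<rhd> (\<psi> \<bullet> \<phi>) = (g \<rhd> \<psi>) \<bullet> (g \<rhd> \<phi>)"
  using interchange'[of \<phi> \<psi> "Id2 K g" "Id2 K g"] assms by (simp add: whiskL_def)

lemma whiskR_vcomp [simp]:
  assumes "\<phi> \<in> Cell K" "\<psi> \<in> Cell K" "cod2 K \<phi> = dom2 K \<psi>" "f \<in> Arr K"
    "cod1 K f = dom1 K (dom2 K \<phi>)"
  shows "(\<psi> \<bullet> \<phi>) \<lhd> f = (\<psi> \<lhd> f) \<bullet> (\<phi> \<lhd> f)"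
proof -
  have "dom1 K (dom2 K \<psi>) = dom1 K (dom2 K \<phi>)"
    using assms(1,3) cell_typing(3) by metis
  then show ?thesis
    using interchange'[of "Id2 K f" "Id2 K f" \<phi> \<psi>] assms by (simp add: whiskR_def)
qed

lemma whiskL_id2 [simp]:
  assumes "f \<in> Arr K" "g \<in> Arr K" "cod1 K f = dom1 K g"
  shows "g \<rhd> Id2 K f = Id2 K (g \<cdot> f)" "Id2 K g \<lhd> f = Id2 K (g \<cdot> f)"
  using assms by (simp_all add: whiskL_def whiskR_def)

lemma whisk_id1 [simp]:
  assumes "\<phi> \<in> Cell K"
  shows "cod1 K (dom2 K \<phi>) = Y \<Longrightarrow> Id1 K Y \<rhd> \<phi> = \<phi>" "dom1 K (dom2 K \<phi>) = X \<Longrightarrow> \<phi> \<lhd> Id1 K X = \<phi>"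
  using hcomp_id_left[of "dom2 K \<phi>" _ _ \<phi>] hcomp_id_right[of "dom2 K \<phi>" _ _ \<phi>] assms
  by (auto simp: whiskL_def whiskR_def)

lemma whiskL_comp1 [simp]:
  assumes "\<phi> \<in> Cell K" "g \<in> Arr K" "h \<in> Arr K" "cod1 K (dom2 K \<phi>) = dom1 K g" "cod1 K g = dom1 K h"
  shows "h \<rhd> (g \<rhd> \<phi>) = (h \<cdot> g) \<rhd> \<phi>"
  using hcomp_assoc'[of \<phi> "Id2 K g" "Id2 K h"] assms by (simp add: whiskL_def)

lemma whiskR_comp1 [simp]:
  assumes "\<phi> \<in> Cell K" "g \<in> Arr K" "f \<in> Arr K" "cod1 K g = dom1 K (dom2 K \<phi>)" "cod1 K f = dom1 K g"
  shows "(\<phi> \<lhd> g) \<lhd> f = \<phi> \<lhd> (g \<cdot> f)"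
  using hcomp_assoc'[of "Id2 K f" "Id2 K g" \<phi>] assms by (simp add: whiskR_def)

lemma whiskL_whiskR [simp]:
  assumes "\<phi> \<in> Cell K" "h \<in> Arr K" "f \<in> Arr K" "cod1 K (dom2 K \<phi>) = dom1 K h"
    "cod1 K f = dom1 K (dom2 K \<phi>)"
  shows "h \<rhd> (\<phi> \<lhd> f) = (h \<rhd> \<phi>) \<lhd> f"
  using hcomp_assoc'[of "Id2 K f" \<phi> "Id2 K h"] assms by (simp add: whiskR_def whiskL_def)

lemma hcomp_whisk:
  assumes "\<phi> \<in> Cell K" "\<psi> \<in> Cell K" "cod1 K (dom2 K \<phi>) = dom1 K (dom2 K \<psi>)"
  shows "\<psi> \<star> \<phi> = (\<psi> \<lhd> cod2 K \<phi>) \<bullet> (dom2 K \<psi> \<rhd> \<phi>)"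
    and "\<psi> \<star> \<phi> = (cod2 K \<psi> \<rhd> \<phi>) \<bullet> (\<psi> \<lhd> dom2 K \<phi>)"
  using interchange'[of \<phi> "Id2 K (cod2 K \<phi>)" "Id2 K (dom2 K \<psi>)" \<psi>]
    interchange'[of "Id2 K (dom2 K \<phi>)" \<phi> \<psi> "Id2 K (cod2 K \<psi>)"] assms
  by (simp_all add: whiskR_def whiskL_def)

text \<open>Naturality of whiskering is the only law that is not oriented, since neither side is simpler; it is
  instantiated by hand.\<close>

lemma whisk_exchange:
  assumes "\<phi> \<in> Cell K" "\<psi> \<in> Cell K" "cod1 K (dom2 K \<phi>) = dom1 K (dom2 K \<psi>)"
    "dom2 K \<phi> = f" "cod2 K \<phi> = f'" "dom2 K \<psi> = g" "cod2 K \<psi> = g'"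
  shows "(\<psi> \<lhd> f') \<bullet> (g \<rhd> \<phi>) = (g' \<rhd> \<phi>) \<bullet> (\<psi> \<lhd> f)"
  using hcomp_whisk[of \<phi> \<psi>] assms by simp

text \<open>The analogue for 1-cells. Most commuting squares below are accompanied by their tail version.\<close>

lemma comp1_rewrite_tail:
  assumes "a \<cdot> b = c" "a \<in> Arr K" "b \<in> Arr K" "x \<in> Arr K" "cod1 K b = dom1 K a" "cod1 K x = dom1 K b"
  shows "a \<cdot> b \<cdot> x = c \<cdot> x"
  using assms by (metis comp1_assoc')

text \<open>Right-bracketed composites hide a left-hand side \<open>a \<bullet> b\<close> whenever something follows \<open>b\<close>. Such a
  tail version of an equation makes it applicable as a rewrite rule inside longer composites.\<close>

lemma vcomp_cong_tail:
  assumes "a \<bullet> b = c" "a \<in> Cell K" "b \<in> Cell K" "x \<in> Cell K" "cod2 K b = dom2 K a" "cod2 K x = dom2 K b"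
  shows "a \<bullet> (b \<bullet> x) = c \<bullet> x"
  using assms by (metis vcomp_assoc')

lemma iso2I:
  assumes "\<phi> \<in> Cell K" "\<psi> \<in> Cell K" "dom2 K \<psi> = cod2 K \<phi>" "cod2 K \<psi> = dom2 K \<phi>"
    "\<psi> \<bullet> \<phi> = Id2 K (dom2 K \<phi>)" "\<phi> \<bullet> \<psi> = Id2 K (cod2 K \<phi>)"
  shows "iso2 K \<phi>"
  using assms by (auto simp: iso2_def)

lemma iso2E:
  assumes "iso2 K \<phi>"
  obtains \<psi> where "\<phi> \<in> Cell K" "\<psi> \<in> Cell K" "dom2 K \<psi> = cod2 K \<phi>" "cod2 K \<psi> = dom2 K \<phi>"
    "\<psi> \<bullet> \<phi> = Id2 K (dom2 K \<phi>)" "\<phi> \<bullet> \<psi> = Id2 K (cod2 K \<phi>)"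
  using assms by (auto simp: iso2_def)

lemma iso2_id2 [simp]: "f \<in> Arr K \<Longrightarrow> iso2 K (Id2 K f)"
  by (rule iso2I[where \<psi> = "Id2 K f"]) simp_all

lemma iso2_vcomp:
  assumes "iso2 K \<phi>" "iso2 K \<psi>" "cod2 K \<phi> = dom2 K \<psi>"
  shows "iso2 K (\<psi> \<bullet> \<phi>)"
proof -
  obtain \<phi>' where p: "\<phi> \<in> Cell K" "\<phi>' \<in> Cell K" "dom2 K \<phi>' = cod2 K \<phi>" "cod2 K \<phi>' = dom2 K \<phi>"
    "\<phi>' \<bullet> \<phi> = Id2 K (dom2 K \<phi>)" "\<phi> \<bullet> \<phi>' = Id2 K (cod2 K \<phi>)" using assms(1) by (rule iso2E)
  obtain \<psi>' where q: "\<psi> \<in> Cell K" "\<psi>' \<in> Cell K" "dom2 K \<psi>' = cod2 K \<psi>" "cod2 K \<psi>' = dom2 K \<psi>"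
    "\<psi>' \<bullet> \<psi> = Id2 K (dom2 K \<psi>)" "\<psi> \<bullet> \<psi>' = Id2 K (cod2 K \<psi>)" using assms(2) by (rule iso2E)
  show ?thesis
    by (rule iso2I[where \<psi> = "\<phi>' \<bullet> \<psi>'"])
      (simp_all add: p q assms(3) vcomp_cong_tail[OF p(6)] vcomp_cong_tail[OF q(5)])
qed

lemma iso2_whiskL:
  assumes "iso2 K \<phi>" "g \<in> Arr K" "cod1 K (dom2 K \<phi>) = dom1 K g"
  shows "iso2 K (g \<rhd> \<phi>)"
proof -
  obtain \<phi>' where p: "\<phi> \<in> Cell K" "\<phi>' \<in> Cell K" "dom2 K \<phi>' = cod2 K \<phi>" "cod2 K \<phi>' = dom2 K \<phi>"
    "\<phi>' \<bullet> \<phi> = Id2 K (dom2 K \<phi>)" "\<phi> \<bullet> \<phi>' = Id2 K (cod2 K \<phi>)" using assms(1) by (rule iso2E)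
  show ?thesis
    by (rule iso2I[where \<psi> = "g \<rhd> \<phi>'"]) (simp_all add: p assms(2,3) flip: whiskL_vcomp)
qed

lemma iso2_whiskR:
  assumes "iso2 K \<phi>" "f \<in> Arr K" "cod1 K f = dom1 K (dom2 K \<phi>)"
  shows "iso2 K (\<phi> \<lhd> f)"
proof -
  obtain \<phi>' where p: "\<phi> \<in> Cell K" "\<phi>' \<in> Cell K" "dom2 K \<phi>' = cod2 K \<phi>" "cod2 K \<phi>' = dom2 K \<phi>"
    "\<phi>' \<bullet> \<phi> = Id2 K (dom2 K \<phi>)" "\<phi> \<bullet> \<phi>' = Id2 K (cod2 K \<phi>)" using assms(1) by (rule iso2E)
  show ?thesis
    by (rule iso2I[where \<psi> = "\<phi>' \<lhd> f"]) (simp_all add: p assms(2,3) flip: whiskR_vcomp)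
qed

end

section \<open>Pullbacks and discrete opfibrations\<close>

context two_category
begin

lemma pullback_typing:
  assumes "pullback K p f p' q"
  shows "p \<in> Arr K" "f \<in> Arr K" "cod1 K f = cod1 K p" "p' \<in> Arr K" "cod1 K p' = dom1 K f"
    "q \<in> Arr K" "dom1 K q = dom1 K p'" "cod1 K q = dom1 K p" "p \<cdot> q = f \<cdot> p'"
  using assms unfolding pullback_def mem_hom1 by blast+

lemma pullback_arr:
  assumes "pullback K p f p' q" "h \<in> Arr K" "k \<in> Arr K" "dom1 K k = dom1 K h" "cod1 K h = dom1 K f"
    "cod1 K k = dom1 K p" "p \<cdot> k = f \<cdot> h"
  obtains l where "l \<in> Arr K" "dom1 K l = dom1 K h" "cod1 K l = dom1 K p'" "p' \<cdot> l = h" "q \<cdot> l = k"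
proof -
  have "h \<in> hom1 K (dom1 K h) (dom1 K f)" "k \<in> hom1 K (dom1 K h) (dom1 K p)" "dom1 K h \<in> Obj K"
    using assms by simp_all
  then have "\<exists>!l. l \<in> hom1 K (dom1 K h) (dom1 K p') \<and> p' \<cdot> l = h \<and> q \<cdot> l = k"
    using assms(1,7) unfolding pullback_def by blast
  then show thesis using that by auto
qed

lemma pullback_arr_eqI:
  assumes "pullback K p f p' q" "l \<in> Arr K" "l' \<in> Arr K" "dom1 K l = dom1 K l'" "cod1 K l = dom1 K p'"
    "cod1 K l' = dom1 K p'" "p' \<cdot> l = p' \<cdot> l'" "q \<cdot> l = q \<cdot> l'"
  shows "l = l'"
proof -
  note t = pullback_typing[OF assms(1)]
  have "p \<cdot> (q \<cdot> l) = (p \<cdot> q) \<cdot> l" using t(1-8) assms by simp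
  also have "\<dots> = f \<cdot> (p' \<cdot> l)" unfolding t(9) using t(1-8) assms by simp
  finally have 1: "p \<cdot> (q \<cdot> l) = f \<cdot> (p' \<cdot> l)" .
  have "p' \<cdot> l \<in> hom1 K (dom1 K l) (dom1 K f)" "q \<cdot> l \<in> hom1 K (dom1 K l) (dom1 K p)" "dom1 K l \<in> Obj K"
    using assms t(1-8) by simp_all
  then have "\<exists>!k. k \<in> hom1 K (dom1 K l) (dom1 K p') \<and> p' \<cdot> k = p' \<cdot> l \<and> q \<cdot> k = q \<cdot> l"
    using assms(1) 1 unfolding pullback_def by blast
  moreover have "l \<in> hom1 K (dom1 K l) (dom1 K p')" "l' \<in> hom1 K (dom1 K l) (dom1 K p')"
    using assms by simp_all
  ultimately show ?thesis using assms(7,8) by metis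
qed

lemma pullback_cell:
  assumes "pullback K p f p' q" "l \<in> Arr K" "l' \<in> Arr K" "dom1 K l = dom1 K l'" "cod1 K l = dom1 K p'"
    "cod1 K l' = dom1 K p'"
    "\<phi> \<in> Cell K" "dom2 K \<phi> = p' \<cdot> l" "cod2 K \<phi> = p' \<cdot> l'"
    "\<psi> \<in> Cell K" "dom2 K \<psi> = q \<cdot> l" "cod2 K \<psi> = q \<cdot> l'" "p \<rhd> \<psi> = f \<rhd> \<phi>"
  obtains \<kappa> where "\<kappa> \<in> Cell K" "dom2 K \<kappa> = l" "cod2 K \<kappa> = l'" "p' \<rhd> \<kappa> = \<phi>" "q \<rhd> \<kappa> = \<psi>"
proof -
  have "l \<in> hom1 K (dom1 K l) (dom1 K p')" "l' \<in> hom1 K (dom1 K l) (dom1 K p')" "dom1 K l \<in> Obj K"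
    "\<phi> \<in> hom2 K (p' \<cdot> l) (p' \<cdot> l')" "\<psi> \<in> hom2 K (q \<cdot> l) (q \<cdot> l')"
    using assms by simp_all
  then have "\<exists>!\<kappa>. \<kappa> \<in> hom2 K l l' \<and> p' \<rhd> \<kappa> = \<phi> \<and> q \<rhd> \<kappa> = \<psi>"
    using assms(1,13) unfolding pullback_def by blast
  then show thesis using that by auto
qed

lemma pullback_cell_eqI:
  assumes "pullback K p f p' q" "\<kappa> \<in> Cell K" "\<kappa>' \<in> Cell K" "dom2 K \<kappa> = dom2 K \<kappa>'" "cod2 K \<kappa> = cod2 K \<kappa>'"
    "cod1 K (dom2 K \<kappa>) = dom1 K p'" "p' \<rhd> \<kappa> = p' \<rhd> \<kappa>'" "q \<rhd> \<kappa> = q \<rhd> \<kappa>'"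
  shows "\<kappa> = \<kappa>'"
proof -
  note t = pullback_typing[OF assms(1)]
  let ?l = "dom2 K \<kappa>" and ?l' = "cod2 K \<kappa>"
  have "p \<rhd> (q \<rhd> \<kappa>) = (p \<cdot> q) \<rhd> \<kappa>" using t(1-8) assms(2,6) by simp
  also have "\<dots> = f \<rhd> (p' \<rhd> \<kappa>)" unfolding t(9) using t(1-8) assms(2,6) by simp
  finally have 1: "p \<rhd> (q \<rhd> \<kappa>) = f \<rhd> (p' \<rhd> \<kappa>)" .
  have "?l \<in> hom1 K (dom1 K ?l) (dom1 K p')" "?l' \<in> hom1 K (dom1 K ?l) (dom1 K p')" "dom1 K ?l \<in> Obj K"
    "p' \<rhd> \<kappa> \<in> hom2 K (p' \<cdot> ?l) (p' \<cdot> ?l')" "q \<rhd> \<kappa> \<in> hom2 K (q \<cdot> ?l) (q \<cdot> ?l')"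
    using assms(2,6) t(1-8) by simp_all
  then have "\<exists>!\<chi>. \<chi> \<in> hom2 K ?l ?l' \<and> p' \<rhd> \<chi> = p' \<rhd> \<kappa> \<and> q \<rhd> \<chi> = q \<rhd> \<kappa>"
    using assms(1) 1 unfolding pullback_def by blast
  moreover have "\<kappa> \<in> hom2 K ?l ?l'" "\<kappa>' \<in> hom2 K ?l ?l'"
    using assms by simp_all
  ultimately show ?thesis using assms(7,8) by metis
qed

lemma pullbackI:
  assumes "p \<in> Arr K" "f \<in> Arr K" "cod1 K f = cod1 K p" "p' \<in> Arr K" "cod1 K p' = dom1 K f"
    "q \<in> Arr K" "dom1 K q = dom1 K p'" "cod1 K q = dom1 K p" "p \<cdot> q = f \<cdot> p'"
    and arr: "\<And>h k. \<lbrakk>h \<in> Arr K; k \<in> Arr K; dom1 K k = dom1 K h; cod1 K h = dom1 K f; cod1 K k = dom1 K p;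
       p \<cdot> k = f \<cdot> h\<rbrakk> \<Longrightarrow> \<exists>l. l \<in> Arr K \<and> dom1 K l = dom1 K h \<and> cod1 K l = dom1 K p' \<and> p' \<cdot> l = h \<and> q \<cdot> l = k"
    and arr_eq: "\<And>l l'. \<lbrakk>l \<in> Arr K; l' \<in> Arr K; dom1 K l = dom1 K l'; cod1 K l = dom1 K p';
      cod1 K l' = dom1 K p'; p' \<cdot> l = p' \<cdot> l'; q \<cdot> l = q \<cdot> l'\<rbrakk> \<Longrightarrow> l = l'"
    and cell: "\<And>l l' \<phi> \<psi>. \<lbrakk>l \<in> Arr K; l' \<in> Arr K; dom1 K l = dom1 K l'; cod1 K l = dom1 K p';
      cod1 K l' = dom1 K p'; \<phi> \<in> Cell K; dom2 K \<phi> = p' \<cdot> l; cod2 K \<phi> = p' \<cdot> l';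
      \<psi> \<in> Cell K; dom2 K \<psi> = q \<cdot> l; cod2 K \<psi> = q \<cdot> l'; p \<rhd> \<psi> = f \<rhd> \<phi>\<rbrakk> \<Longrightarrow>
      \<exists>\<kappa>. \<kappa> \<in> Cell K \<and> dom2 K \<kappa> = l \<and> cod2 K \<kappa> = l' \<and> p' \<rhd> \<kappa> = \<phi> \<and> q \<rhd> \<kappa> = \<psi>"
    and cell_eq: "\<And>\<kappa> \<kappa>'. \<lbrakk>\<kappa> \<in> Cell K; \<kappa>' \<in> Cell K; dom2 K \<kappa> = dom2 K \<kappa>'; cod2 K \<kappa> = cod2 K \<kappa>';
      cod1 K (dom2 K \<kappa>) = dom1 K p'; p' \<rhd> \<kappa> = p' \<rhd> \<kappa>'; q \<rhd> \<kappa> = q \<rhd> \<kappa>'\<rbrakk> \<Longrightarrow> \<kappa> = \<kappa>'"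
  shows "pullback K p f p' q"
  unfolding pullback_def
proof (intro conjI ballI impI)
  fix X h k assume *: "h \<in> hom1 K X (dom1 K f)" "k \<in> hom1 K X (dom1 K p)" "p \<cdot> k = f \<cdot> h"
  then obtain l where l: "l \<in> Arr K" "dom1 K l = X" "cod1 K l = dom1 K p'" "p' \<cdot> l = h" "q \<cdot> l = k"
    using arr[of h k] by auto
  show "\<exists>!l. l \<in> hom1 K X (dom1 K p') \<and> p' \<cdot> l = h \<and> q \<cdot> l = k"
    using l arr_eq by (intro ex1I[of _ l]) auto
next
  fix X l l' \<phi> \<psi> assume *: "l \<in> hom1 K X (dom1 K p')" "l' \<in> hom1 K X (dom1 K p')"
    "\<phi> \<in> hom2 K (p' \<cdot> l) (p' \<cdot> l')" "\<psi> \<in> hom2 K (q \<cdot> l) (q \<cdot> l')" "p \<rhd> \<psi> = f \<rhd> \<phi>"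
  then obtain \<kappa> where "\<kappa> \<in> Cell K" "dom2 K \<kappa> = l" "cod2 K \<kappa> = l'" "p' \<rhd> \<kappa> = \<phi>" "q \<rhd> \<kappa> = \<psi>"
    using cell[of l l' \<phi> \<psi>] by auto
  then show "\<exists>!\<kappa>. \<kappa> \<in> hom2 K l l' \<and> p' \<rhd> \<kappa> = \<phi> \<and> q \<rhd> \<kappa> = \<psi>"
    using * cell_eq by (intro ex1I[of _ \<kappa>]) auto
qed (use assms in simp_all)

lemma pullback_paste:
  assumes R: "pullback K p f p' q" and L: "pullback K p' g p'' q'"
  shows "pullback K p (f \<cdot> g) p'' (q \<cdot> q')"
proof -
  note tR = pullback_typing[OF R] and tL = pullback_typing[OF L]
  note [simp] = tR(1-8) tL(1-8)
  have sR: "p \<cdot> q \<cdot> x = f \<cdot> p' \<cdot> x" if "x \<in> Arr K" "cod1 K x = dom1 K p'" for x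
  proof -
    have "p \<cdot> q \<cdot> x = (p \<cdot> q) \<cdot> x" using that by simp
    then show ?thesis unfolding tR(9) using that by simp
  qed
  have sL: "p' \<cdot> q' \<cdot> x = g \<cdot> p'' \<cdot> x" if "x \<in> Arr K" "cod1 K x = dom1 K p''" for x
  proof -
    have "p' \<cdot> q' \<cdot> x = (p' \<cdot> q') \<cdot> x" using that by simp
    then show ?thesis unfolding tL(9) using that by simp
  qed
  have [simp]: "cod1 K g = dom1 K f" by simp
  show ?thesis
  proof (rule pullbackI, goal_cases)
    case 9
    show ?case using sR[of q'] by (simp add: tL(9))
  next
    case (10 h k)
    then have [simp]: "h \<in> Arr K" "k \<in> Arr K" "dom1 K k = dom1 K h" "cod1 K h = dom1 K g" "cod1 K k = dom1 K p"
      and e: "p \<cdot> k = f \<cdot> g \<cdot> h" by simp_all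
    obtain x where [simp]: "x \<in> Arr K" "dom1 K x = dom1 K h" "cod1 K x = dom1 K p'" and x: "p' \<cdot> x = g \<cdot> h" "q \<cdot> x = k"
      by (rule pullback_arr[OF R, of "g \<cdot> h" k]) (simp_all add: e)
    obtain l where [simp]: "l \<in> Arr K" "dom1 K l = dom1 K h" "cod1 K l = dom1 K p''" and l: "p'' \<cdot> l = h" "q' \<cdot> l = x"
      by (rule pullback_arr[OF L, of h x]) (simp_all add: x)
    show ?case by (intro exI[of _ l]) (simp add: l x)
  next
    case (11 l l')
    then have [simp]: "l \<in> Arr K" "l' \<in> Arr K" "dom1 K l = dom1 K l'" "cod1 K l = dom1 K p''" "cod1 K l' = dom1 K p''"
      and e: "p'' \<cdot> l = p'' \<cdot> l'" "q \<cdot> q' \<cdot> l = q \<cdot> q' \<cdot> l'" by simp_all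
    have x: "q' \<cdot> l = q' \<cdot> l'" by (rule pullback_arr_eqI[OF R]) (simp_all add: e sL)
    show ?case by (rule pullback_arr_eqI[OF L]) (simp_all add: e x)
  next
    case (12 l l' \<phi> \<psi>)
    then have [simp]: "l \<in> Arr K" "l' \<in> Arr K" "dom1 K l = dom1 K l'" "cod1 K l = dom1 K p''" "cod1 K l' = dom1 K p''"
      "\<phi> \<in> Cell K" "dom2 K \<phi> = p'' \<cdot> l" "cod2 K \<phi> = p'' \<cdot> l'" "\<psi> \<in> Cell K" "dom2 K \<psi> = q \<cdot> q' \<cdot> l"
      "cod2 K \<psi> = q \<cdot> q' \<cdot> l'" and e: "p \<rhd> \<psi> = (f \<cdot> g) \<rhd> \<phi>" by simp_all
    obtain \<chi> where [simp]: "\<chi> \<in> Cell K" "dom2 K \<chi> = q' \<cdot> l" "cod2 K \<chi> = q' \<cdot> l'"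
      and x: "p' \<rhd> \<chi> = g \<rhd> \<phi>" "q \<rhd> \<chi> = \<psi>"
      by (rule pullback_cell[OF R, of "q' \<cdot> l" "q' \<cdot> l'" "g \<rhd> \<phi>" \<psi>]) (simp_all add: e sL)
    obtain \<kappa> where [simp]: "\<kappa> \<in> Cell K" "dom2 K \<kappa> = l" "cod2 K \<kappa> = l'"
      and k: "p'' \<rhd> \<kappa> = \<phi>" "q' \<rhd> \<kappa> = \<chi>"
      by (rule pullback_cell[OF L, of l l' \<phi> \<chi>]) (simp_all add: x)
    show ?case by (intro exI[of _ \<kappa>]) (simp add: k x flip: whiskL_comp1)
  next
    case (13 \<kappa> \<kappa>')
    then have [simp]: "\<kappa> \<in> Cell K" "\<kappa>' \<in> Cell K" "dom2 K \<kappa> = dom2 K \<kappa>'" "cod2 K \<kappa> = cod2 K \<kappa>'"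
      "cod1 K (dom2 K \<kappa>') = dom1 K p''"
      and e: "p'' \<rhd> \<kappa> = p'' \<rhd> \<kappa>'" "(q \<cdot> q') \<rhd> \<kappa> = (q \<cdot> q') \<rhd> \<kappa>'" by simp_all
    have "p' \<rhd> (q' \<rhd> \<kappa>) = g \<rhd> (p'' \<rhd> \<kappa>)" "p' \<rhd> (q' \<rhd> \<kappa>') = g \<rhd> (p'' \<rhd> \<kappa>')" by (simp_all add: tL(9))
    then have 1: "p' \<rhd> (q' \<rhd> \<kappa>) = p' \<rhd> (q' \<rhd> \<kappa>')" using e(1) by metis
    have x: "q' \<rhd> \<kappa> = q' \<rhd> \<kappa>'"
      by (rule pullback_cell_eqI[OF R]) (use 1 e(2) in simp_all)
    show ?case by (rule pullback_cell_eqI[OF L]) (simp_all add: e x)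
  qed simp_all
qed

lemma pullback_iso:
  assumes R: "pullback K p f p' q" and j: "j \<in> Arr K" "cod1 K j = dom1 K p'"
    and k: "k \<in> Arr K" "dom1 K k = dom1 K p'" "cod1 K k = dom1 K j"
    and jk: "j \<cdot> k = Id1 K (dom1 K p')" and kj: "k \<cdot> j = Id1 K (dom1 K j)"
  shows "pullback K p f (p' \<cdot> j) (q \<cdot> j)"
proof -
  note tR = pullback_typing[OF R]
  note [simp] = tR(1-8) j k
  have jkt: "j \<cdot> k \<cdot> x = x" if "x \<in> Arr K" "cod1 K x = dom1 K p'" for x
  proof -
    have "j \<cdot> k \<cdot> x = (j \<cdot> k) \<cdot> x" using that by simp
    then show ?thesis unfolding jk using that by simp
  qed
  have kjt: "k \<cdot> j \<cdot> x = x" if "x \<in> Arr K" "cod1 K x = dom1 K j" for x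
  proof -
    have "k \<cdot> j \<cdot> x = (k \<cdot> j) \<cdot> x" using that by simp
    then show ?thesis unfolding kj using that by simp
  qed
  have sR: "p \<cdot> q \<cdot> x = f \<cdot> p' \<cdot> x" if "x \<in> Arr K" "cod1 K x = dom1 K p'" for x
  proof -
    have "p \<cdot> q \<cdot> x = (p \<cdot> q) \<cdot> x" using that by simp
    then show ?thesis unfolding tR(9) using that by simp
  qed
  show ?thesis
  proof (rule pullbackI, goal_cases)
    case 9
    show ?case by (simp add: sR)
  next
    case (10 h x)
    obtain l where [simp]: "l \<in> Arr K" "dom1 K l = dom1 K h" "cod1 K l = dom1 K p'" and l: "p' \<cdot> l = h" "q \<cdot> l = x"
      by (rule pullback_arr[OF R, of h x]) (use 10 in simp_all)
    show ?case by (intro exI[of _ "k \<cdot> l"]) (simp add: l jkt)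
  next
    case (11 l l')
    then have [simp]: "l \<in> Arr K" "l' \<in> Arr K" "dom1 K l = dom1 K l'" "cod1 K l = dom1 K j" "cod1 K l' = dom1 K j"
      and e: "p' \<cdot> j \<cdot> l = p' \<cdot> j \<cdot> l'" "q \<cdot> j \<cdot> l = q \<cdot> j \<cdot> l'" by simp_all
    have "j \<cdot> l = j \<cdot> l'" by (rule pullback_arr_eqI[OF R]) (simp_all add: e)
    then have "k \<cdot> j \<cdot> l = k \<cdot> j \<cdot> l'" by (simp only:)
    then show ?case by (simp add: kjt)
  next
    case (12 l l' \<phi> \<psi>)
    then have [simp]: "l \<in> Arr K" "l' \<in> Arr K" "dom1 K l = dom1 K l'" "cod1 K l = dom1 K j" "cod1 K l' = dom1 K j"
      "\<phi> \<in> Cell K" "dom2 K \<phi> = p' \<cdot> j \<cdot> l" "cod2 K \<phi> = p' \<cdot> j \<cdot> l'" "\<psi> \<in> Cell K" "dom2 K \<psi> = q \<cdot> j \<cdot> l"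
      "cod2 K \<psi> = q \<cdot> j \<cdot> l'" and e: "p \<rhd> \<psi> = f \<rhd> \<phi>" by simp_all
    obtain \<chi> where [simp]: "\<chi> \<in> Cell K" "dom2 K \<chi> = j \<cdot> l" "cod2 K \<chi> = j \<cdot> l'"
      and x: "p' \<rhd> \<chi> = \<phi>" "q \<rhd> \<chi> = \<psi>"
      by (rule pullback_cell[OF R, of "j \<cdot> l" "j \<cdot> l'" \<phi> \<psi>]) (simp_all add: e)
    show ?case by (intro exI[of _ "k \<rhd> \<chi>"]) (simp add: jkt kjt jk x)
  next
    case (13 \<kappa> \<kappa>')
    then have [simp]: "\<kappa> \<in> Cell K" "\<kappa>' \<in> Cell K" "dom2 K \<kappa> = dom2 K \<kappa>'" "cod2 K \<kappa> = cod2 K \<kappa>'"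
      "cod1 K (dom2 K \<kappa>') = dom1 K j"
      and e: "(p' \<cdot> j) \<rhd> \<kappa> = (p' \<cdot> j) \<rhd> \<kappa>'" "(q \<cdot> j) \<rhd> \<kappa> = (q \<cdot> j) \<rhd> \<kappa>'" by simp_all
    have "j \<rhd> \<kappa> = j \<rhd> \<kappa>'"
      by (rule pullback_cell_eqI[OF R]) (use e in simp_all)
    then have "k \<rhd> (j \<rhd> \<kappa>) = k \<rhd> (j \<rhd> \<kappa>')" by metis
    then show ?case by (simp add: kj)
  qed simp_all
qed

end

lemma opf_tight: "tight_discrete_opfibration K p \<Longrightarrow> p \<in> Tight K"
  by (simp add: tight_discrete_opfibration_def)

context enhanced_two_category
begin

lemma tight_arrI [simp]: "f \<in> Tight K \<Longrightarrow> f \<in> Arr K"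
  using tight_arr by auto

lemma opf_arr: "tight_discrete_opfibration K p \<Longrightarrow> p \<in> Arr K"
  by (auto simp: tight_discrete_opfibration_def)

lemma opf_lift:
  assumes "tight_discrete_opfibration K p" "e \<in> Arr K" "cod1 K e = dom1 K p"
    "\<phi> \<in> Cell K" "dom2 K \<phi> = p \<cdot> e"
  obtains \<kappa> where "\<kappa> \<in> Cell K" "dom2 K \<kappa> = e" "p \<rhd> \<kappa> = \<phi>"
proof -
  have p: "p \<in> Arr K" using assms(1) by (rule opf_arr)
  have "dom1 K (cod2 K \<phi>) = dom1 K e" "cod1 K (cod2 K \<phi>) = cod1 K p" "cod2 K \<phi> \<in> Arr K"
    using assms p by simp_all
  moreover have "dom1 K e \<in> Obj K" using assms by simp
  ultimately show thesis
    using assms that unfolding tight_discrete_opfibration_def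
    by (metis (no_types, lifting) mem_hom1 mem_hom2)
qed

lemma opf_eqI:
  assumes "tight_discrete_opfibration K p" "\<kappa> \<in> Cell K" "\<kappa>' \<in> Cell K"
    "dom2 K \<kappa> = dom2 K \<kappa>'" "cod1 K (dom2 K \<kappa>') = dom1 K p" "p \<rhd> \<kappa> = p \<rhd> \<kappa>'"
  shows "\<kappa> = \<kappa>'"
proof -
  have p: "p \<in> Arr K" using assms(1) by (rule opf_arr)
  let ?e = "dom2 K \<kappa>'" and ?\<phi> = "p \<rhd> \<kappa>'"
  have 1: "?e \<in> hom1 K (dom1 K ?e) (dom1 K p)" "dom1 K ?e \<in> Obj K"
    "cod2 K ?\<phi> \<in> hom1 K (dom1 K ?e) (cod1 K p)" "?\<phi> \<in> hom2 K (p \<cdot> ?e) (cod2 K ?\<phi>)"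
    using assms p by simp_all
  then have "\<exists>!\<kappa>. \<kappa> \<in> Cell K \<and> dom2 K \<kappa> = ?e \<and> p \<rhd> \<kappa> = ?\<phi>"
    using assms(1) unfolding tight_discrete_opfibration_def by blast
  then show ?thesis using assms by metis
qed

text \<open>Lifting the inverse of \<open>p \<rhd> \<kappa>\<close> gives a left inverse of \<open>\<kappa>\<close>, because the composite lies over an
  identity. This fixes the codomain of the lift, so the same argument makes it a right inverse.\<close>

lemma opf_reflect_iso:
  assumes "tight_discrete_opfibration K p" "\<kappa> \<in> Cell K" "cod1 K (dom2 K \<kappa>) = dom1 K p"
    "iso2 K (p \<rhd> \<kappa>)"
  shows "iso2 K \<kappa>"
proof -
  have p: "p \<in> Arr K" using assms(1) by (rule opf_arr)
  obtain \<psi> where q: "\<psi> \<in> Cell K" "dom2 K \<psi> = p \<cdot> cod2 K \<kappa>" "cod2 K \<psi> = p \<cdot> dom2 K \<kappa>"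
    "\<psi> \<bullet> (p \<rhd> \<kappa>) = Id2 K (p \<cdot> dom2 K \<kappa>)" "(p \<rhd> \<kappa>) \<bullet> \<psi> = Id2 K (p \<cdot> cod2 K \<kappa>)"
    using assms(4) by (rule iso2E) (use assms p in simp)
  obtain \<kappa>' where k: "\<kappa>' \<in> Cell K" "dom2 K \<kappa>' = cod2 K \<kappa>" "p \<rhd> \<kappa>' = \<psi>"
    by (rule opf_lift[OF assms(1), of "cod2 K \<kappa>" \<psi>]) (use assms q in auto)
  have 1: "\<kappa>' \<bullet> \<kappa> = Id2 K (dom2 K \<kappa>)"
    by (rule opf_eqI[OF assms(1)]) (use assms k q p in simp_all)
  then have 2: "cod2 K \<kappa>' = dom2 K \<kappa>"
    by (metis assms(2) cell_typing(1) id2_typing(3) k(1,2) vcomp_typing(3))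
  have 3: "\<kappa> \<bullet> \<kappa>' = Id2 K (cod2 K \<kappa>)"
    by (rule opf_eqI[OF assms(1)]) (use assms k q p 2 in simp_all)
  show ?thesis by (rule iso2I[of \<kappa> \<kappa>']) (use 1 2 3 k assms in simp_all)
qed

lemma left_tight_pullbackD:
  assumes "left_tight_pullback K p f p' q"
  shows "pullback K p f p' q" "p \<in> Tight K" "p' \<in> Tight K"
    "\<And>h. \<lbrakk>h \<in> Arr K; cod1 K h = dom1 K p'; p' \<cdot> h \<in> Tight K\<rbrakk> \<Longrightarrow> h \<in> Tight K"
  using assms unfolding left_tight_pullback_def by blast+

end

section \<open>Lax algebras, lax morphisms and their 2-cells\<close>

context enhanced_two_monad
begin

lemma T_typing [simp]:
  assumes "f \<in> Arr K"
  shows "T1 T f \<in> Arr K" "dom1 K (T1 T f) = T0 T (dom1 K f)" "cod1 K (T1 T f) = T0 T (cod1 K f)"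
  using T1_in[of f "dom1 K f" "cod1 K f"] assms by auto

lemma T_cell_typing [simp]:
  assumes "\<phi> \<in> Cell K"
  shows "T2 T \<phi> \<in> Cell K" "dom2 K (T2 T \<phi>) = T1 T (dom2 K \<phi>)" "cod2 K (T2 T \<phi>) = T1 T (cod2 K \<phi>)"
  using T2_in[of \<phi> "dom2 K \<phi>" "cod2 K \<phi>"] assms by auto

lemma unt_typing [simp]:
  assumes "X \<in> Obj K"
  shows "unt T X \<in> Arr K" "dom1 K (unt T X) = X" "cod1 K (unt T X) = T0 T X"
  using unt_in[OF assms] by auto

lemma mul_typing [simp]:
  assumes "X \<in> Obj K"
  shows "mul T X \<in> Arr K" "dom1 K (mul T X) = T0 T (T0 T X)" "cod1 K (mul T X) = T0 T X"
  using mul_in[OF assms] by auto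

declare T0_in [simp] T1_id1 [simp] T2_id2 [simp] mul_unt [simp] mul_T_unt [simp] mul_mul [simp]

lemma T_comp1 [simp]:
  assumes "f \<in> Arr K" "g \<in> Arr K" "cod1 K f = dom1 K g"
  shows "T1 T (g \<cdot> f) = T1 T g \<cdot> T1 T f"
  using T1_comp1[of f _ "dom1 K g" g] assms by auto

lemma T_vcomp [simp]:
  assumes "\<phi> \<in> Cell K" "\<psi> \<in> Cell K" "cod2 K \<phi> = dom2 K \<psi>"
  shows "T2 T (\<psi> \<bullet> \<phi>) = T2 T \<psi> \<bullet> T2 T \<phi>"
  using T2_vcomp[of \<phi> _ "dom2 K \<psi>" \<psi>] assms by auto

lemma T_whisk [simp]:
  assumes "\<phi> \<in> Cell K"
  shows "g \<in> Arr K \<Longrightarrow> cod1 K (dom2 K \<phi>) = dom1 K g \<Longrightarrow> T2 T (g \<rhd> \<phi>) = T1 T g \<rhd> T2 T \<phi>"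
    and "f \<in> Arr K \<Longrightarrow> cod1 K f = dom1 K (dom2 K \<phi>) \<Longrightarrow> T2 T (\<phi> \<lhd> f) = T2 T \<phi> \<lhd> T1 T f"
  using T2_hcomp[of "dom2 K \<phi>" _ "dom1 K g" g _ \<phi> _ "Id2 K g"]
    T2_hcomp[of f _ "dom1 K (dom2 K \<phi>)" "dom2 K \<phi>" _ "Id2 K f" _ \<phi>] assms
  by (auto simp: whiskL_def whiskR_def)

lemma unt_nat [simp]:
  assumes "f \<in> Arr K" "cod1 K f = Y"
  shows "unt T Y \<cdot> f = T1 T f \<cdot> unt T (dom1 K f)"
  using unt_nat1[of f _ Y] assms by auto

lemma mul_nat [simp]:
  assumes "f \<in> Arr K" "cod1 K f = Y"
  shows "mul T Y \<cdot> T1 T (T1 T f) = T1 T f \<cdot> mul T (dom1 K f)"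
  using mul_nat1[of f _ Y] assms by auto

lemma mul_nat_tail [simp]:
  assumes "f \<in> Arr K" "cod1 K f = Y" "g \<in> Arr K" "cod1 K g = T0 T (T0 T (dom1 K f))"
  shows "mul T Y \<cdot> T1 T (T1 T f) \<cdot> g = T1 T f \<cdot> mul T (dom1 K f) \<cdot> g"
proof -
  have "Y \<in> Obj K" using assms by auto
  then show ?thesis
    using comp1_rewrite_tail[OF mul_nat[OF assms(1,2)], of g] assms by simp
qed

text \<open>Only the typing of the data becomes rewrite rules. The laws are kept separate, as their two sides
  are not oriented.\<close>

lemma lax_algebra_typing [simp]:
  assumes "lax_algebra K T A"
  shows "carr A \<in> Obj K" "act A \<in> Arr K" "dom1 K (act A) = T0 T (carr A)" "cod1 K (act A) = carr A"
    "unitor A \<in> Cell K" "dom2 K (unitor A) = Id1 K (carr A)"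
    "cod2 K (unitor A) = act A \<cdot> unt T (carr A)"
    "multor A \<in> Cell K" "dom2 K (multor A) = act A \<cdot> T1 T (act A)"
    "cod2 K (multor A) = act A \<cdot> mul T (carr A)"
  using assms unfolding lax_algebra_def Let_def mem_hom1 mem_hom2 by blast+

lemma lax_algebra_tight: "lax_algebra K T A \<Longrightarrow> act A \<in> Tight K"
  unfolding lax_algebra_def Let_def by blast

lemma lax_algebra_laws:
  assumes "lax_algebra K T A"
  shows "(multor A \<lhd> unt T (T0 T (carr A))) \<bullet> (unitor A \<lhd> act A) = Id2 K (act A)"
    "(multor A \<lhd> T1 T (unt T (carr A))) \<bullet> (act A \<rhd> T2 T (unitor A)) = Id2 K (act A)"
    "(multor A \<lhd> mul T (T0 T (carr A))) \<bullet> (multor A \<lhd> T1 T (T1 T (act A)))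
        = (multor A \<lhd> T1 T (mul T (carr A))) \<bullet> (act A \<rhd> T2 T (multor A))"
  using assms unfolding lax_algebra_def Let_def mem_hom1 mem_hom2 by blast+

lemma lax_algebraI:
  assumes "X \<in> Obj K" "a \<in> Tight K" "dom1 K a = T0 T X" "cod1 K a = X"
    "y \<in> Cell K" "dom2 K y = Id1 K X" "cod2 K y = a \<cdot> unt T X"
    "m \<in> Cell K" "dom2 K m = a \<cdot> T1 T a" "cod2 K m = a \<cdot> mul T X"
    "(m \<lhd> unt T (T0 T X)) \<bullet> (y \<lhd> a) = Id2 K a"
    "(m \<lhd> T1 T (unt T X)) \<bullet> (a \<rhd> T2 T y) = Id2 K a"
    "(m \<lhd> mul T (T0 T X)) \<bullet> (m \<lhd> T1 T (T1 T a))
        = (m \<lhd> T1 T (mul T X)) \<bullet> (a \<rhd> T2 T m)"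
  shows "lax_algebra K T (LAlg X a y m)"
  using assms tight_arrI[OF assms(2)] unfolding lax_algebra_def Let_def mem_hom1 mem_hom2 lalg.sel lmor.sel lcell.sel by blast

lemma lax_morphism_typing [simp]:
  assumes "lax_morphism K T F"
  shows "lax_algebra K T (ldom F)" "lax_algebra K T (lcod F)"
    "und1 F \<in> Arr K" "dom1 K (und1 F) = carr (ldom F)" "cod1 K (und1 F) = carr (lcod F)"
    "str2 F \<in> Cell K" "dom2 K (str2 F) = act (lcod F) \<cdot> T1 T (und1 F)"
    "cod2 K (str2 F) = und1 F \<cdot> act (ldom F)"
  using assms unfolding lax_morphism_def Let_def mem_hom1 mem_hom2 by blast+

lemma lax_morphism_laws:
  assumes "lax_morphism K T F"
  shows "und1 F \<rhd> unitor (ldom F)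
      = (str2 F \<lhd> unt T (carr (ldom F))) \<bullet> (unitor (lcod F) \<lhd> und1 F)"
    "(und1 F \<rhd> multor (ldom F)) \<bullet> (str2 F \<lhd> T1 T (act (ldom F))) \<bullet> (act (lcod F) \<rhd> T2 T (str2 F))
        = (str2 F \<lhd> mul T (carr (ldom F))) \<bullet> (multor (lcod F) \<lhd> T1 T (T1 T (und1 F)))"
  using assms unfolding lax_morphism_def Let_def mem_hom1 mem_hom2 by blast+

lemma lax_morphismI:
  assumes "lax_algebra K T A" "lax_algebra K T B"
    "f \<in> Arr K" "dom1 K f = carr A" "cod1 K f = carr B"
    "s \<in> Cell K" "dom2 K s = act B \<cdot> T1 T f" "cod2 K s = f \<cdot> act A"
    "f \<rhd> unitor A = (s \<lhd> unt T (carr A)) \<bullet> (unitor B \<lhd> f)"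
    "(f \<rhd> multor A) \<bullet> (s \<lhd> T1 T (act A)) \<bullet> (act B \<rhd> T2 T s)
        = (s \<lhd> mul T (carr A)) \<bullet> (multor B \<lhd> T1 T (T1 T f))"
  shows "lax_morphism K T (LMor A B f s)"
  using assms unfolding lax_morphism_def Let_def mem_hom1 mem_hom2 lalg.sel lmor.sel lcell.sel by blast

lemma T_two_morphism_typing [simp]:
  assumes "T_two_morphism K T \<Phi>"
  shows "lax_morphism K T (ldom2 \<Phi>)" "lax_morphism K T (lcod2 \<Phi>)"
    "ldom (lcod2 \<Phi>) = ldom (ldom2 \<Phi>)" "lcod (lcod2 \<Phi>) = lcod (ldom2 \<Phi>)"
    "und2 \<Phi> \<in> Cell K" "dom2 K (und2 \<Phi>) = und1 (ldom2 \<Phi>)" "cod2 K (und2 \<Phi>) = und1 (lcod2 \<Phi>)"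
  using assms unfolding T_two_morphism_def Let_def mem_hom1 mem_hom2 by metis+

lemma T_two_morphism_law:
  assumes "T_two_morphism K T \<Phi>"
  shows "(und2 \<Phi> \<lhd> act (ldom (ldom2 \<Phi>))) \<bullet> str2 (ldom2 \<Phi>)
    = str2 (lcod2 \<Phi>) \<bullet> (act (lcod (ldom2 \<Phi>)) \<rhd> T2 T (und2 \<Phi>))"
  using assms unfolding T_two_morphism_def Let_def mem_hom1 mem_hom2 by blast+

lemma T_two_morphismI:
  assumes "lax_morphism K T F" "lax_morphism K T G" "ldom F = ldom G" "lcod F = lcod G"
    "\<phi> \<in> Cell K" "dom2 K \<phi> = und1 F" "cod2 K \<phi> = und1 G"
    "(\<phi> \<lhd> act (ldom F)) \<bullet> str2 F = str2 G \<bullet> (act (lcod F) \<rhd> T2 T \<phi>)"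
  shows "T_two_morphism K T (LCell F G \<phi>)"
  using assms unfolding T_two_morphism_def Let_def mem_hom1 mem_hom2 lalg.sel lmor.sel lcell.sel by blast

lemma lmor_id_lax [simp]:
  assumes "lax_algebra K T A"
  shows "lax_morphism K T (lmor_id K A)"
  unfolding lmor_id_def by (rule lax_morphismI) (use assms in simp_all)

lemma lmor_id_sel [simp]:
  "ldom (lmor_id K A) = A" "lcod (lmor_id K A) = A" "und1 (lmor_id K A) = Id1 K (carr A)"
  "str2 (lmor_id K A) = Id2 K (act A)"
  by (simp_all add: lmor_id_def)

lemma lmor_comp_sel [simp]:
  "ldom (lmor_comp K T G F) = ldom F" "lcod (lmor_comp K T G F) = lcod G"
  "und1 (lmor_comp K T G F) = und1 G \<cdot> und1 F"
  "str2 (lmor_comp K T G F) = (und1 G \<rhd> str2 F) \<bullet> (str2 G \<lhd> T1 T (und1 F))"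
  by (simp_all add: lmor_comp_def)

text \<open>The multiplication law for the composite is obtained by pasting the law for \<open>F\<close> onto that for \<open>G\<close>;
  in between, the structure cell of \<open>G\<close> has to be moved past \<open>T\<close> applied to that of \<open>F\<close>.\<close>

lemma lmor_comp_lax [simp]:
  assumes F: "lax_morphism K T F" and G: "lax_morphism K T G" and FG: "lcod F = ldom G"
  shows "lax_morphism K T (lmor_comp K T G F)"
proof -
  note [simp] = F G FG
  let ?A = "ldom F" and ?B = "ldom G" and ?C = "lcod G"
  let ?f = "und1 F" and ?g = "und1 G" and ?fb = "str2 F" and ?gb = "str2 G"
  let ?a = "act (ldom F)" and ?b = "act (ldom G)" and ?c = "act (lcod G)"
  let ?s = "(?g \<rhd> ?fb) \<bullet> (?gb \<lhd> T1 T ?f)"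
  have unit: "(?g \<cdot> ?f) \<rhd> unitor ?A
      = (?s \<lhd> unt T (carr ?A)) \<bullet> (unitor ?C \<lhd> (?g \<cdot> ?f))"
  proof -
    have "(?g \<cdot> ?f) \<rhd> unitor ?A = ?g \<rhd> (?f \<rhd> unitor ?A)" by simp
    also have "\<dots> = ((?g \<rhd> ?fb) \<lhd> unt T (carr ?A)) \<bullet> ((?g \<rhd> unitor ?B) \<lhd> ?f)"
      unfolding lax_morphism_laws(1)[OF F] by simp
    also have "\<dots> = (?s \<lhd> unt T (carr ?A)) \<bullet> (unitor ?C \<lhd> (?g \<cdot> ?f))"
      unfolding lax_morphism_laws(1)[OF G] by simp
    finally show ?thesis .
  qed
  \<comment> \<open>The interchange that brings the axiom for \<open>F\<close> and the axiom for \<open>G\<close> next to each other.\<close>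
  have ex: "(?gb \<lhd> (T1 T ?f \<cdot> T1 T ?a)) \<bullet> ((?c \<cdot> T1 T ?g) \<rhd> T2 T ?fb)
      = ((?g \<cdot> ?b) \<rhd> T2 T ?fb) \<bullet> (?gb \<lhd> (T1 T ?b \<cdot> T1 T (T1 T ?f)))"
    by (rule whisk_exchange) simp_all
  have "((?g \<cdot> ?f) \<rhd> multor ?A) \<bullet> (?s \<lhd> T1 T ?a) \<bullet> (?c \<rhd> T2 T ?s)
    = (?g \<rhd> ((?f \<rhd> multor ?A) \<bullet> (?fb \<lhd> T1 T ?a) \<bullet> (?b \<rhd> T2 T ?fb)))
       \<bullet> (?gb \<lhd> (T1 T ?b \<cdot> T1 T (T1 T ?f))) \<bullet> ((?c \<rhd> T2 T ?gb) \<lhd> T1 T (T1 T ?f))"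
    by (simp add: ex vcomp_cong_tail[OF ex])
  also have "\<dots> = ((?g \<rhd> ?fb) \<lhd> mul T (carr ?A)) \<bullet> 
     (((?g \<rhd> multor ?B) \<bullet> (?gb \<lhd> T1 T ?b) \<bullet> (?c \<rhd> T2 T ?gb)) \<lhd> T1 T (T1 T ?f))"
    unfolding lax_morphism_laws(2)[OF F, unfolded FG] by simp
  also have "\<dots> = (?s \<lhd> mul T (carr ?A)) \<bullet> (multor ?C \<lhd> T1 T (T1 T (?g \<cdot> ?f)))"
    unfolding lax_morphism_laws(2)[OF G] by simp
  finally show ?thesis
    unfolding lmor_comp_def by (intro lax_morphismI) (use unit in simp_all)
qed

lemma lmor_comp_id [simp]:
  assumes "lax_morphism K T F"
  shows "lcod F = B \<Longrightarrow> lmor_comp K T (lmor_id K B) F = F"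
    "ldom F = A \<Longrightarrow> lmor_comp K T F (lmor_id K A) = F"
  using assms by (auto intro!: lmor.expand)

lemma lmor_comp_assoc [simp]:
  assumes "lax_morphism K T F" "lax_morphism K T G" "lax_morphism K T H" "lcod F = ldom G" "lcod G = ldom H"
  shows "lmor_comp K T (lmor_comp K T H G) F = lmor_comp K T H (lmor_comp K T G F)"
  using assms by (auto intro!: lmor.expand)

lemma T_two_id:
  assumes "lax_morphism K T F"
  shows "T_two_morphism K T (LCell F F (Id2 K (und1 F)))"
  by (rule T_two_morphismI) (use assms in simp_all)

lemma T_two_vcomp:
  assumes P: "T_two_morphism K T \<Phi>" and Q: "T_two_morphism K T \<Psi>" and PQ: "lcod2 \<Phi> = ldom2 \<Psi>"
  shows "T_two_morphism K T (LCell (ldom2 \<Phi>) (lcod2 \<Psi>) (und2 \<Psi> \<bullet> und2 \<Phi>))"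
proof -
  note [simp] = P Q PQ
  have [simp]: "ldom (ldom2 \<Phi>) = ldom (ldom2 \<Psi>)" "lcod (ldom2 \<Phi>) = lcod (ldom2 \<Psi>)"
    using T_two_morphism_typing(3,4)[OF P] by simp_all
  show ?thesis
    using T_two_morphism_law[OF P] vcomp_cong_tail[OF T_two_morphism_law[OF Q]]
    by (intro T_two_morphismI) simp_all
qed

lemma T_two_whiskL:
  assumes P: "T_two_morphism K T \<Phi>" and G: "lax_morphism K T G" and PG: "lcod (ldom2 \<Phi>) = ldom G"
  shows "T_two_morphism K T (LCell (lmor_comp K T G (ldom2 \<Phi>)) (lmor_comp K T G (lcod2 \<Phi>)) (und1 G \<rhd> und2 \<Phi>))"
proof -
  note [simp] = P G PG
  let ?F = "ldom2 \<Phi>" and ?F' = "lcod2 \<Phi>" and ?\<phi> = "und2 \<Phi>" and ?g = "und1 G"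
  have ex: "(str2 G \<lhd> T1 T (und1 ?F')) \<bullet> ((act (lcod G) \<cdot> T1 T ?g) \<rhd> T2 T ?\<phi>)
      = ((?g \<cdot> act (ldom G)) \<rhd> T2 T ?\<phi>) \<bullet> (str2 G \<lhd> T1 T (und1 ?F))"
    by (rule whisk_exchange) simp_all
  have "((?g \<rhd> ?\<phi>) \<lhd> act (ldom ?F)) \<bullet> str2 (lmor_comp K T G ?F)
      = (?g \<rhd> ((?\<phi> \<lhd> act (ldom ?F)) \<bullet> str2 ?F)) \<bullet> (str2 G \<lhd> T1 T (und1 ?F))" by simp
  also have "\<dots> = str2 (lmor_comp K T G ?F') \<bullet> (act (lcod G) \<rhd> T2 T (?g \<rhd> ?\<phi>))"
    unfolding T_two_morphism_law[OF P] by (simp add: ex)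
  finally show ?thesis by (intro T_two_morphismI) simp_all
qed

lemma T_two_whiskR:
  assumes P: "T_two_morphism K T \<Phi>" and F: "lax_morphism K T F" and FP: "lcod F = ldom (ldom2 \<Phi>)"
  shows "T_two_morphism K T (LCell (lmor_comp K T (ldom2 \<Phi>) F) (lmor_comp K T (lcod2 \<Phi>) F) (und2 \<Phi> \<lhd> und1 F))"
proof -
  note [simp] = P F FP
  let ?G = "ldom2 \<Phi>" and ?G' = "lcod2 \<Phi>" and ?\<phi> = "und2 \<Phi>" and ?f = "und1 F"
  have ex: "(?\<phi> \<lhd> (?f \<cdot> act (ldom F))) \<bullet> (und1 ?G \<rhd> str2 F)
     = (und1 ?G' \<rhd> str2 F) \<bullet> (?\<phi> \<lhd> (act (lcod F) \<cdot> T1 T ?f))"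
    by (rule whisk_exchange) simp_all
  have "((?\<phi> \<lhd> ?f) \<lhd> act (ldom F)) \<bullet> str2 (lmor_comp K T ?G F)
      = (und1 ?G' \<rhd> str2 F) \<bullet> (((?\<phi> \<lhd> act (ldom ?G)) \<bullet> str2 ?G) \<lhd> T1 T ?f)"
    using vcomp_cong_tail[OF ex] by simp
  also have "\<dots> = str2 (lmor_comp K T ?G' F) \<bullet> (act (lcod ?G) \<rhd> T2 T (?\<phi> \<lhd> ?f))"
    unfolding T_two_morphism_law[OF P] by simp
  finally show ?thesis by (intro T_two_morphismI) simp_all
qed

text \<open>A horizontal composite is a vertical composite of two whiskered cells, so the two whiskerings
  suffice.\<close>

lemma T_two_hcomp:
  assumes P: "T_two_morphism K T \<Phi>" and Q: "T_two_morphism K T \<Psi>" and PQ: "lcod (ldom2 \<Phi>) = ldom (ldom2 \<Psi>)"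
  shows "T_two_morphism K T (LCell (lmor_comp K T (ldom2 \<Psi>) (ldom2 \<Phi>))
    (lmor_comp K T (lcod2 \<Psi>) (lcod2 \<Phi>)) (und2 \<Psi> \<star> und2 \<Phi>))"
proof -
  note [simp] = P Q PQ
  show ?thesis
    using T_two_vcomp[OF T_two_whiskL[of \<Phi> "ldom2 \<Psi>"] T_two_whiskR[of \<Psi> "lcod2 \<Phi>"]]
    by (simp add: hcomp_whisk(1)[of "und2 \<Phi>" "und2 \<Psi>"])
qed

end

section \<open>The enhanced 2-category of lax algebras\<close>

lemma LaxAlg_sel [simp]:
  "Obj (LaxAlg K T) = {A. lax_algebra K T A}" "Arr (LaxAlg K T) = {F. lax_morphism K T F}"
  "Cell (LaxAlg K T) = {\<Phi>. T_two_morphism K T \<Phi>}"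
  "dom1 (LaxAlg K T) = ldom" "cod1 (LaxAlg K T) = lcod"
  "dom2 (LaxAlg K T) = ldom2" "cod2 (LaxAlg K T) = lcod2"
  "Id1 (LaxAlg K T) = lmor_id K" "Comp1 (LaxAlg K T) = lmor_comp K T"
  "Id2 (LaxAlg K T) F = LCell F F (Id2 K (und1 F))"
  "Vcomp (LaxAlg K T) \<Psi> \<Phi> = LCell (ldom2 \<Phi>) (lcod2 \<Psi>) (und2 \<Psi> \<bullet>\<^bsub>K\<^esub> und2 \<Phi>)"
  "Hcomp (LaxAlg K T) \<Psi> \<Phi> = LCell (lmor_comp K T (ldom2 \<Psi>) (ldom2 \<Phi>))
     (lmor_comp K T (lcod2 \<Psi>) (lcod2 \<Phi>)) (und2 \<Psi> \<star>\<^bsub>K\<^esub> und2 \<Phi>)"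
  "Tight (LaxAlg K T) = {F. pseudo_morphism K T F \<and> und1 F \<in> Tight K}"
  "One (LaxAlg K T) = one_lalg K T" "Small (LaxAlg K T) = {P. small_strict K T P}"
  "pb (LaxAlg K T) P F = fst (lax_pb K T P F)" "pbtop (LaxAlg K T) P F = snd (lax_pb K T P F)"
  by (simp_all add: LaxAlg_def)

lemma LaxAlg_whisk [simp]:
  "whiskL (LaxAlg K T) G \<Phi>
    = LCell (lmor_comp K T G (ldom2 \<Phi>)) (lmor_comp K T G (lcod2 \<Phi>)) (und1 G \<rhd>\<^bsub>K\<^esub> und2 \<Phi>)"
  "whiskR (LaxAlg K T) \<Phi> F
    = LCell (lmor_comp K T (ldom2 \<Phi>) F) (lmor_comp K T (lcod2 \<Phi>) F) (und2 \<Phi> \<lhd>\<^bsub>K\<^esub> und1 F)"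
  by (simp_all add: whiskL_def whiskR_def)

locale plumbus_monad = plumbus K + enhanced_two_monad K T
  for K :: "('o, 'a, 'c, 'm) plumbus_data_scheme" (structure)
    and T :: "('o, 'a, 'c) monad_data"
begin

lemma LaxAlg_two_category: "two_category (LaxAlg K T)"
proof unfold_locales
  fix \<phi> assume "\<phi> \<in> Cell (LaxAlg K T)"
  then show "dom2 (LaxAlg K T) \<phi> \<in> Arr (LaxAlg K T) \<and> cod2 (LaxAlg K T) \<phi> \<in> Arr (LaxAlg K T) \<and>
    dom1 (LaxAlg K T) (dom2 (LaxAlg K T) \<phi>) = dom1 (LaxAlg K T) (cod2 (LaxAlg K T) \<phi>) \<and>
    cod1 (LaxAlg K T) (dom2 (LaxAlg K T) \<phi>) = cod1 (LaxAlg K T) (cod2 (LaxAlg K T) \<phi>)" by simp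
next
  fix f g h k \<phi> \<psi> \<chi>
  assume "\<phi> \<in> hom2 (LaxAlg K T) f g" "\<psi> \<in> hom2 (LaxAlg K T) g h" "\<chi> \<in> hom2 (LaxAlg K T) h k"
  then show "(\<chi> \<bullet>\<^bsub>LaxAlg K T\<^esub> \<psi>) \<bullet>\<^bsub>LaxAlg K T\<^esub> \<phi> = \<chi> \<bullet>\<^bsub>LaxAlg K T\<^esub> (\<psi> \<bullet>\<^bsub>LaxAlg K T\<^esub> \<phi>)" by auto
next
  fix f g X Y Z \<phi> \<psi> f' g'
  assume "f \<in> hom1 (LaxAlg K T) X Y" "g \<in> hom1 (LaxAlg K T) Y Z"
    "\<phi> \<in> hom2 (LaxAlg K T) f f'" "\<psi> \<in> hom2 (LaxAlg K T) g g'"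
  then show "\<psi> \<star>\<^bsub>LaxAlg K T\<^esub> \<phi> \<in> hom2 (LaxAlg K T) (g \<cdot>\<^bsub>LaxAlg K T\<^esub> f) (g' \<cdot>\<^bsub>LaxAlg K T\<^esub> f')"
    using T_two_hcomp[of \<phi> \<psi>] by auto
next
  fix f W X g Y h Z \<phi> f' \<psi> g' \<chi> h'
  assume "f \<in> hom1 (LaxAlg K T) W X" "g \<in> hom1 (LaxAlg K T) X Y" "h \<in> hom1 (LaxAlg K T) Y Z"
    "\<phi> \<in> hom2 (LaxAlg K T) f f'" "\<psi> \<in> hom2 (LaxAlg K T) g g'" "\<chi> \<in> hom2 (LaxAlg K T) h h'"
  moreover from this have "lax_morphism K T f'" "lax_morphism K T g'" "lax_morphism K T h'"
    "lcod f' = ldom g'" "lcod g' = ldom h'" by auto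
  ultimately show "(\<chi> \<star>\<^bsub>LaxAlg K T\<^esub> \<psi>) \<star>\<^bsub>LaxAlg K T\<^esub> \<phi> = \<chi> \<star>\<^bsub>LaxAlg K T\<^esub> (\<psi> \<star>\<^bsub>LaxAlg K T\<^esub> \<phi>)"
    using hcomp_assoc'[of "und2 \<phi>" "und2 \<psi>" "und2 \<chi>"] by auto
next
  fix f X Y g Z \<phi> f' \<phi>' f'' \<psi> g' \<psi>' g''
  assume "f \<in> hom1 (LaxAlg K T) X Y" "g \<in> hom1 (LaxAlg K T) Y Z"
    "\<phi> \<in> hom2 (LaxAlg K T) f f'" "\<phi>' \<in> hom2 (LaxAlg K T) f' f''"
    "\<psi> \<in> hom2 (LaxAlg K T) g g'" "\<psi>' \<in> hom2 (LaxAlg K T) g' g''"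
  then show "(\<psi>' \<bullet>\<^bsub>LaxAlg K T\<^esub> \<psi>) \<star>\<^bsub>LaxAlg K T\<^esub> (\<phi>' \<bullet>\<^bsub>LaxAlg K T\<^esub> \<phi>)
    = (\<psi>' \<star>\<^bsub>LaxAlg K T\<^esub> \<phi>') \<bullet>\<^bsub>LaxAlg K T\<^esub> (\<psi> \<star>\<^bsub>LaxAlg K T\<^esub> \<phi>)"
    using interchange'[of "und2 \<phi>" "und2 \<phi>'" "und2 \<psi>" "und2 \<psi>'"] by auto
next
  fix f X Y \<phi> f'
  assume "f \<in> hom1 (LaxAlg K T) X Y" "\<phi> \<in> hom2 (LaxAlg K T) f f'"
  then have *: "lax_morphism K T f" "lax_morphism K T f'" "lcod f' = Y" "ldom f' = X" "lcod f = Y" "ldom f = X"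
      "T_two_morphism K T \<phi>" "ldom2 \<phi> = f" "lcod2 \<phi> = f'" by auto
  then have [simp]: "lax_algebra K T X" "lax_algebra K T Y" by auto
  have "und1 f \<in> hom1 K (carr X) (carr Y)" "und2 \<phi> \<in> hom2 K (und1 f) (und1 f')"
    using * T_two_morphism_typing[OF *(7)] lax_morphism_typing[OF *(1)] by simp_all
  then have h: "Id2 K (Id1 K (carr Y)) \<star> und2 \<phi> = und2 \<phi>" "und2 \<phi> \<star> Id2 K (Id1 K (carr X)) = und2 \<phi>"
    by (rule hcomp_id_left hcomp_id_right)+
  show "Id2 (LaxAlg K T) (Id1 (LaxAlg K T) Y) \<star>\<^bsub>LaxAlg K T\<^esub> \<phi> = \<phi>"
    "\<phi> \<star>\<^bsub>LaxAlg K T\<^esub> Id2 (LaxAlg K T) (Id1 (LaxAlg K T) X) = \<phi>"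
    by (rule lcell.expand; simp add: h *)+
qed (use T_two_vcomp in \<open>auto intro!: lmor.expand lcell.expand T_two_id\<close>)

text \<open>The inverse satisfies the law because the law for \<open>\<Phi>\<close> can be composed with the inverse on
  both sides.\<close>

lemma T_two_inverse:
  assumes P: "T_two_morphism K T \<Phi>"
    and q: "\<psi> \<in> Cell K" "dom2 K \<psi> = und1 (lcod2 \<Phi>)" "cod2 K \<psi> = und1 (ldom2 \<Phi>)"
      "\<psi> \<bullet> und2 \<Phi> = Id2 K (und1 (ldom2 \<Phi>))" "und2 \<Phi> \<bullet> \<psi> = Id2 K (und1 (lcod2 \<Phi>))"
  shows "T_two_morphism K T (LCell (lcod2 \<Phi>) (ldom2 \<Phi>) \<psi>)"
proof -
  note [simp] = P q
  let ?F = "ldom2 \<Phi>" and ?G = "lcod2 \<Phi>" and ?\<phi> = "und2 \<Phi>"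
  let ?a = "act (ldom ?F)" and ?b = "act (lcod ?F)"
  have 1: "(?\<phi> \<lhd> ?a) \<bullet> str2 ?F = str2 ?G \<bullet> (?b \<rhd> T2 T ?\<phi>)" by (rule T_two_morphism_law[OF P])
  have 2: "(\<psi> \<lhd> ?a) \<bullet> (?\<phi> \<lhd> ?a) = Id2 K (und1 ?F \<cdot> ?a)"
    by (simp flip: whiskR_vcomp)
  have 3: "(?b \<rhd> T2 T ?\<phi>) \<bullet> (?b \<rhd> T2 T \<psi>) = Id2 K (?b \<cdot> T1 T (und1 ?G))"
    by (simp flip: whiskL_vcomp T_vcomp)
  have "(\<psi> \<lhd> ?a) \<bullet> str2 ?G = (\<psi> \<lhd> ?a) \<bullet> (str2 ?G \<bullet> ((?b \<rhd> T2 T ?\<phi>) \<bullet> (?b \<rhd> T2 T \<psi>)))"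
    unfolding 3 by simp
  also have "\<dots> = (\<psi> \<lhd> ?a) \<bullet> ((str2 ?G \<bullet> (?b \<rhd> T2 T ?\<phi>)) \<bullet> (?b \<rhd> T2 T \<psi>))" by simp
  also have "\<dots> = ((\<psi> \<lhd> ?a) \<bullet> (?\<phi> \<lhd> ?a)) \<bullet> (str2 ?F \<bullet> (?b \<rhd> T2 T \<psi>))"
    unfolding 1[symmetric] by simp
  also have "\<dots> = str2 ?F \<bullet> (?b \<rhd> T2 T \<psi>)" unfolding 2 by simp
  finally show ?thesis by (intro T_two_morphismI) simp_all
qed

lemma LaxAlg_iso2: "iso2 (LaxAlg K T) \<Phi> \<longleftrightarrow> T_two_morphism K T \<Phi> \<and> iso2 K (und2 \<Phi>)"
proof
  assume "iso2 (LaxAlg K T) \<Phi>"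
  then obtain \<Psi> where "T_two_morphism K T \<Phi>" "T_two_morphism K T \<Psi>" "ldom2 \<Psi> = lcod2 \<Phi>"
    "lcod2 \<Psi> = ldom2 \<Phi>" "und2 \<Psi> \<bullet> und2 \<Phi> = Id2 K (und1 (ldom2 \<Phi>))"
    "und2 \<Phi> \<bullet> und2 \<Psi> = Id2 K (und1 (lcod2 \<Phi>))"
    unfolding iso2_def by auto
  then show "T_two_morphism K T \<Phi> \<and> iso2 K (und2 \<Phi>)"
    by (auto intro!: iso2I[where \<psi> = "und2 \<Psi>"])
next
  assume a: "T_two_morphism K T \<Phi> \<and> iso2 K (und2 \<Phi>)"
  then obtain \<psi> where "\<psi> \<in> Cell K" "dom2 K \<psi> = und1 (lcod2 \<Phi>)" "cod2 K \<psi> = und1 (ldom2 \<Phi>)"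
      "\<psi> \<bullet> und2 \<Phi> = Id2 K (und1 (ldom2 \<Phi>))" "und2 \<Phi> \<bullet> \<psi> = Id2 K (und1 (lcod2 \<Phi>))"
    by (auto elim!: iso2E)
  then show "iso2 (LaxAlg K T) \<Phi>"
    using a T_two_inverse[of \<Phi> \<psi>] unfolding iso2_def
    by (auto intro!: bexI[of _ "LCell (lcod2 \<Phi>) (ldom2 \<Phi>) \<psi>"])
qed

lemma lmor_comp_pseudo:
  assumes "pseudo_morphism K T F" "pseudo_morphism K T G" "lcod F = ldom G"
  shows "pseudo_morphism K T (lmor_comp K T G F)"
proof -
  have [simp]: "lax_morphism K T F" "lax_morphism K T G" "iso2 K (str2 F)" "iso2 K (str2 G)"
    using assms by (auto simp: pseudo_morphism_def)
  show ?thesis unfolding pseudo_morphism_def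
    by (auto simp: assms(3) intro!: iso2_vcomp iso2_whiskL iso2_whiskR)
qed

text \<open>An isomorphism from \<open>F\<close> to \<open>G\<close> expresses the structure cell of \<open>G\<close> as a composite of that of \<open>F\<close>
  with invertible cells.\<close>

lemma pseudo_morphism_replete:
  assumes "pseudo_morphism K T (ldom2 \<Phi>)" "iso2 (LaxAlg K T) \<Phi>"
  shows "pseudo_morphism K T (lcod2 \<Phi>)"
proof -
  have P: "T_two_morphism K T \<Phi>" and i: "iso2 K (und2 \<Phi>)" and F: "iso2 K (str2 (ldom2 \<Phi>))"
    using assms by (auto simp: LaxAlg_iso2 pseudo_morphism_def)
  obtain \<psi> where q: "\<psi> \<in> Cell K" "dom2 K \<psi> = und1 (lcod2 \<Phi>)" "cod2 K \<psi> = und1 (ldom2 \<Phi>)"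
      "\<psi> \<bullet> und2 \<Phi> = Id2 K (und1 (ldom2 \<Phi>))" "und2 \<Phi> \<bullet> \<psi> = Id2 K (und1 (lcod2 \<Phi>))"
    using i P by (auto elim!: iso2E)
  note [simp] = P q
  let ?F = "ldom2 \<Phi>" and ?G = "lcod2 \<Phi>" and ?\<phi> = "und2 \<Phi>"
  let ?a = "act (ldom ?F)" and ?b = "act (lcod ?F)"
  have 3: "T2 T ?\<phi> \<bullet> T2 T \<psi> = Id2 K (T1 T (und1 ?G))"
    by (simp flip: T_vcomp)
  have 4: "T2 T \<psi> \<bullet> T2 T ?\<phi> = Id2 K (T1 T (und1 ?F))"
    by (simp flip: T_vcomp)
  have j: "iso2 K (T2 T \<psi>)"
    by (rule iso2I[where \<psi> = "T2 T ?\<phi>"]) (simp_all add: 3 4)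
  have "str2 ?G = str2 ?G \<bullet> (?b \<rhd> (T2 T ?\<phi> \<bullet> T2 T \<psi>))"
    unfolding 3 by simp
  also have "\<dots> = (str2 ?G \<bullet> (?b \<rhd> T2 T ?\<phi>)) \<bullet> (?b \<rhd> T2 T \<psi>)" by simp
  also have "\<dots> = ((?\<phi> \<lhd> ?a) \<bullet> str2 ?F) \<bullet> (?b \<rhd> T2 T \<psi>)"
    unfolding T_two_morphism_law[OF P] ..
  finally have "str2 ?G = ((?\<phi> \<lhd> ?a) \<bullet> str2 ?F) \<bullet> (?b \<rhd> T2 T \<psi>)" .
  moreover have "iso2 K (((?\<phi> \<lhd> ?a) \<bullet> str2 ?F) \<bullet> (?b \<rhd> T2 T \<psi>))"
    by (intro iso2_vcomp iso2_whiskL iso2_whiskR i F j) simp_all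
  ultimately show ?thesis by (simp add: pseudo_morphism_def)
qed

lemma LaxAlg_repletely_enhanced: "repletely_enhanced_two_category (LaxAlg K T)"
proof -
  interpret L: two_category "LaxAlg K T" by (rule LaxAlg_two_category)
  show ?thesis
  proof unfold_locales
    show "Tight (LaxAlg K T) \<subseteq> Arr (LaxAlg K T)" by (auto simp: pseudo_morphism_def)
  next
    fix X assume "X \<in> Obj (LaxAlg K T)"
    then show "Id1 (LaxAlg K T) X \<in> Tight (LaxAlg K T)"
      by (simp add: pseudo_morphism_def tight_id1)
  next
    fix f g assume a: "f \<in> Tight (LaxAlg K T)" "g \<in> Tight (LaxAlg K T)"
      "cod1 (LaxAlg K T) f = dom1 (LaxAlg K T) g"
    then have "lax_morphism K T f" "lax_morphism K T g" by (auto simp: pseudo_morphism_def)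
    with a show "g \<cdot>\<^bsub>LaxAlg K T\<^esub> f \<in> Tight (LaxAlg K T)"
      by (simp add: lmor_comp_pseudo tight_comp1)
  next
    fix f g \<phi> assume a: "f \<in> Tight (LaxAlg K T)" "\<phi> \<in> hom2 (LaxAlg K T) f g" "iso2 (LaxAlg K T) \<phi>"
    then show "g \<in> Tight (LaxAlg K T)"
      using pseudo_morphism_replete[of \<phi>] tight_replete[of "und1 f" "und2 \<phi>" "und1 g"]
      by (auto simp: LaxAlg_iso2)
  qed
qed

lemma one_obj [simp]: "One K \<in> Obj K"
  using one_terminal by (simp add: tight_terminal_def)

lemma one_arr_ex: "X \<in> Obj K \<Longrightarrow> \<exists>f \<in> Tight K. dom1 K f = X \<and> cod1 K f = One K"
  using one_terminal unfolding tight_terminal_def by (metis mem_hom1 subsetD)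

lemma one_arr_eq:
  assumes "f \<in> Arr K" "g \<in> Arr K" "dom1 K f = dom1 K g" "cod1 K f = One K" "cod1 K g = One K"
  shows "f = g"
proof -
  have "\<exists>!f. f \<in> hom1 K (dom1 K g) (One K)"
    using one_terminal assms(2) unfolding tight_terminal_def by simp
  then show ?thesis using assms by auto
qed

text \<open>This settles the laws for all morphisms into the terminal algebra.\<close>

lemma one_cell_eq:
  assumes "\<phi> \<in> Cell K" "\<psi> \<in> Cell K" "dom1 K (dom2 K \<phi>) = dom1 K (dom2 K \<psi>)"
    "cod1 K (dom2 K \<phi>) = One K" "cod1 K (dom2 K \<psi>) = One K"
  shows "\<phi> = \<psi>"
proof -
  let ?f = "dom2 K \<psi>"
  have e: "dom2 K \<phi> = ?f" "cod2 K \<phi> = ?f" "cod2 K \<psi> = ?f"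
    by (rule one_arr_eq; use assms in simp)+
  have "?f \<in> hom1 K (dom1 K ?f) (One K)" "dom1 K ?f \<in> Obj K"
    using assms by simp_all
  then have "\<exists>!\<phi>. \<phi> \<in> hom2 K ?f ?f"
    using one_terminal unfolding tight_terminal_def by blast
  then show ?thesis using assms e by auto
qed

lemma one_act:
  obtains a where "a \<in> Tight K" "dom1 K a = T0 T (One K)" "cod1 K a = One K"
    "one_lalg K T = LAlg (One K) a (Id2 K (Id1 K (One K))) (Id2 K (a \<cdot> T1 T a))"
proof -
  obtain a where a: "a \<in> Tight K" "dom1 K a = T0 T (One K)" "cod1 K a = One K"
    using one_arr_ex[of "T0 T (One K)"] by auto
  then have "(THE a. a \<in> hom1 K (T0 T (One K)) (One K)) = a"
    by (intro the_equality) (auto intro: one_arr_eq)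
  with a show thesis using that by (simp add: one_lalg_def)
qed

lemma one_lalg_lax: "lax_algebra K T (one_lalg K T)" and one_lalg_carr [simp]: "carr (one_lalg K T) = One K"
proof -
  obtain a where a [simp]: "a \<in> Tight K" "dom1 K a = T0 T (One K)" "cod1 K a = One K"
    and e: "one_lalg K T = LAlg (One K) a (Id2 K (Id1 K (One K))) (Id2 K (a \<cdot> T1 T a))"
    by (rule one_act)
  have [simp]: "a \<in> Arr K" by simp
  have 1 [simp]: "a \<cdot> unt T (One K) = Id1 K (One K)" "a \<cdot> mul T (One K) = a \<cdot> T1 T a"
    "a \<cdot> T1 T a \<cdot> unt T (T0 T (One K)) = a" "a \<cdot> T1 T a \<cdot> T1 T (unt T (One K)) = a"
    "a \<cdot> T1 T a \<cdot> mul T (T0 T (One K)) = a \<cdot> T1 T a \<cdot> T1 T (T1 T a)"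
    "a \<cdot> T1 T a \<cdot> T1 T (mul T (One K)) = a \<cdot> T1 T a \<cdot> T1 T (T1 T a)"
    by (rule one_arr_eq; simp)+
  show "lax_algebra K T (one_lalg K T)"
    unfolding e by (rule lax_algebraI) simp_all
  show "carr (one_lalg K T) = One K" by (simp add: e)
qed

text \<open>Existence of morphisms and 2-cells reduces to the terminal object of \<open>K\<close>, with identities as
  structure cells.\<close>

lemma LaxAlg_terminal: "tight_terminal (LaxAlg K T) (one_lalg K T)"
proof -
  let ?O = "one_lalg K T"
  note [simp] = one_lalg_lax
  have ex: "\<exists>F. lax_morphism K T F \<and> ldom F = A \<and> lcod F = ?O" if [simp]: "lax_algebra K T A" for A
  proof -
    obtain f where f: "f \<in> Tight K" "dom1 K f = carr A" "cod1 K f = One K"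
      using one_arr_ex[of "carr A"] by auto
    then have [simp]: "f \<in> Arr K" "dom1 K f = carr A" "cod1 K f = One K" by simp_all
    have [simp]: "f \<cdot> act A = act ?O \<cdot> T1 T f" "f \<cdot> act A \<cdot> T1 T (act A) = act ?O \<cdot> T1 T (act ?O) \<cdot> T1 T (T1 T f)"
      "act ?O \<cdot> T1 T f \<cdot> T1 T (act A) = act ?O \<cdot> T1 T (act ?O) \<cdot> T1 T (T1 T f)" by (rule one_arr_eq; simp)+
    have "lax_morphism K T (LMor A ?O f (Id2 K (act ?O \<cdot> T1 T f)))"
      by (rule lax_morphismI; (rule one_cell_eq)?; simp)
    then show ?thesis by auto
  qed
  have eq: "F = G" if [simp]: "lax_morphism K T F" "lax_morphism K T G" "ldom F = ldom G" "lcod F = ?O" "lcod G = ?O" for F G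
  proof -
    have "und1 F = und1 G" by (rule one_arr_eq) simp_all
    moreover have "str2 F = str2 G" by (rule one_cell_eq) simp_all
    ultimately show ?thesis by (intro lmor.expand) simp
  qed
  have tight: "F \<in> Tight (LaxAlg K T)" if [simp]: "lax_morphism K T F" "lcod F = ?O" for F
  proof -
    obtain f where f: "f \<in> Tight K" "dom1 K f = carr (ldom F)" "cod1 K f = One K"
      using one_arr_ex[of "carr (ldom F)"] by auto
    then have "und1 F = f" by (intro one_arr_eq) simp_all
    moreover have "str2 F = Id2 K (dom2 K (str2 F))" by (rule one_cell_eq) simp_all
    then have "iso2 K (str2 F)" using iso2_id2[of "dom2 K (str2 F)"] by simp
    ultimately show ?thesis using f by (simp add: pseudo_morphism_def)
  qed
  have cell: "\<exists>!\<Phi>. \<Phi> \<in> hom2 (LaxAlg K T) F G"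
    if [simp]: "lax_morphism K T F" "lax_morphism K T G" "ldom F = ldom G" "lcod F = ?O" "lcod G = ?O" for F G
  proof -
    have G: "F = G" by (rule eq) simp_all
    have uniq: "\<Phi> = LCell F F (Id2 K (und1 F))"
      if "T_two_morphism K T \<Phi>" "ldom2 \<Phi> = F" "lcod2 \<Phi> = F" for \<Phi>
    proof -
      have "und2 \<Phi> = Id2 K (und1 F)" by (rule one_cell_eq) (simp_all add: that)
      then show ?thesis by (intro lcell.expand) (simp add: that)
    qed
    show ?thesis
    proof (rule ex1I[of _ "LCell F F (Id2 K (und1 F))"])
      show "LCell F F (Id2 K (und1 F)) \<in> hom2 (LaxAlg K T) F G"
        using T_two_id[of F] by (simp flip: G)
    next
      fix \<Phi> assume "\<Phi> \<in> hom2 (LaxAlg K T) F G"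
      then show "\<Phi> = LCell F F (Id2 K (und1 F))" by (intro uniq) (simp_all add: G)
    qed
  qed
  show ?thesis
    unfolding tight_terminal_def
  proof (intro conjI ballI)
    show "one_lalg K T \<in> Obj (LaxAlg K T)" by simp
  next
    fix X assume "X \<in> Obj (LaxAlg K T)"
    then show "\<exists>!f. f \<in> hom1 (LaxAlg K T) X ?O" "hom1 (LaxAlg K T) X ?O \<subseteq> Tight (LaxAlg K T)"
      using ex[of X] eq tight by auto
  next
    fix X f g assume "f \<in> hom1 (LaxAlg K T) X ?O" "g \<in> hom1 (LaxAlg K T) X ?O"
    then show "\<exists>!\<phi>. \<phi> \<in> hom2 (LaxAlg K T) f g" using cell[of f g] by auto
  qed
qed

end

section \<open>Strict discrete opfibrations reflect and lift algebraic structure\<close>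

context enhanced_two_monad
begin

text \<open>Rewriting cannot find these instances of naturality by itself, because \<open>T1\<close> is distributed over
  composites first.\<close>

lemma T_unt_nat [simp]:
  assumes "f \<in> Arr K" "cod1 K f = Y"
  shows "T1 T (unt T Y) \<cdot> T1 T f = T1 T (T1 T f) \<cdot> T1 T (unt T (dom1 K f))"
proof -
  have "Y \<in> Obj K" using assms by auto
  then show ?thesis
    using arg_cong[OF unt_nat[OF assms], of "T1 T"] assms by (simp del: unt_nat)
qed

lemma T_mul_nat [simp]:
  assumes "f \<in> Arr K" "cod1 K f = Y"
  shows "T1 T (mul T Y) \<cdot> T1 T (T1 T (T1 T f)) = T1 T (T1 T f) \<cdot> T1 T (mul T (dom1 K f))"
proof -
  have "Y \<in> Obj K" using assms by auto
  then show ?thesis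
    using arg_cong[OF mul_nat[OF assms], of "T1 T"] assms by (simp del: mul_nat)
qed

lemma strict_typing [simp]:
  assumes "strict_morphism K T P"
  shows "lax_morphism K T P" "str2 P = Id2 K (act (lcod P) \<cdot> T1 T (und1 P))"
proof -
  show l: "lax_morphism K T P" using assms by (simp add: strict_morphism_def)
  have "str2 P = Id2 K (dom2 K (str2 P))" using assms unfolding strict_morphism_def by blast
  then show "str2 P = Id2 K (act (lcod P) \<cdot> T1 T (und1 P))" using l by simp
qed

text \<open>In this and the following rules the domain of \<open>P\<close> is a separate variable \<open>A\<close>, so that they also
  apply when that algebra is written differently.\<close>

lemma strict_comm [simp]:
  assumes "strict_morphism K T P" "ldom P = A"
  shows "und1 P \<cdot> act A = act (lcod P) \<cdot> T1 T (und1 P)"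
proof -
  have l: "lax_morphism K T P" using assms by simp
  have "und1 P \<cdot> act (ldom P) = cod2 K (str2 P)" using lax_morphism_typing(8)[OF l] by (rule sym)
  also have "\<dots> = act (lcod P) \<cdot> T1 T (und1 P)"
    using assms l by simp
  finally show ?thesis unfolding assms(2) .
qed

lemma strict_comm_tail [simp]:
  assumes "strict_morphism K T P" "ldom P = A" "x \<in> Arr K" "cod1 K x = T0 T (carr A)"
  shows "und1 P \<cdot> act A \<cdot> x = act (lcod P) \<cdot> T1 T (und1 P) \<cdot> x"
proof -
  have [simp]: "lax_morphism K T P" using assms by simp
  have [simp]: "lax_algebra K T A" using lax_morphism_typing(1)[of P] assms by simp
  show ?thesis
    unfolding assms(2)[symmetric]
    using comp1_rewrite_tail[OF strict_comm[OF assms(1) refl], of x] assms(2-) by simp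
qed

lemma strict_unitor [simp]:
  assumes "strict_morphism K T P" "ldom P = A"
  shows "und1 P \<rhd> unitor A = unitor (lcod P) \<lhd> und1 P"
proof -
  have l [simp]: "lax_morphism K T P" using assms by simp
  show ?thesis unfolding assms(2)[symmetric] lax_morphism_laws(1)[OF l]
    using assms(1) by simp
qed

lemma T_strict_comm [simp]:
  assumes "strict_morphism K T P" "ldom P = A"
  shows "T1 T (und1 P) \<cdot> T1 T (act A) = T1 T (act (lcod P)) \<cdot> T1 T (T1 T (und1 P))"
proof -
  have l [simp]: "lax_morphism K T P" using assms by simp
  have [simp]: "lax_algebra K T A" using lax_morphism_typing(1)[of P] assms by simp
  show ?thesis
    using arg_cong[OF strict_comm[OF assms(1) refl], of "T1 T"] assms(2) by (simp del: strict_comm)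
qed

lemma strict_multor [simp]:
  assumes "strict_morphism K T P" "ldom P = A"
  shows "und1 P \<rhd> multor A = multor (lcod P) \<lhd> T1 T (T1 T (und1 P))"
proof -
  have l [simp]: "lax_morphism K T P" using assms by simp
  have [simp]: "lax_algebra K T A" using lax_morphism_typing(1)[of P] assms by simp
  show ?thesis using lax_morphism_laws(2)[OF l] assms by simp
qed

lemma strict_morphismI:
  assumes "lax_morphism K T P" "str2 P = Id2 K f" "f \<in> Arr K"
  shows "strict_morphism K T P"
  unfolding strict_morphism_def using assms(1) id2_typing(2)[OF assms(3)] unfolding assms(2) by simp

text \<open>Both sides of either law start at the same 1-cell into the domain of the opfibration, so it is enough
  that they agree after whiskering with \<open>und1 P\<close>. As \<open>P\<close> is strict, this is the law for the composite
  of \<open>P\<close> with the candidate.\<close>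

lemma lax_morphism_reflect:
  assumes P: "strict_morphism K T P" and p: "tight_discrete_opfibration K (und1 P)"
    and A: "lax_algebra K T A" and e: "e \<in> Arr K" "dom1 K e = carr A" "cod1 K e = carr (ldom P)"
    and s: "s \<in> Cell K" "dom2 K s = act (ldom P) \<cdot> T1 T e" "cod2 K s = e \<cdot> act A"
    and L: "lax_morphism K T (LMor A (lcod P) (und1 P \<cdot> e) (und1 P \<rhd> s))"
  shows "lax_morphism K T (LMor A (ldom P) e s)"
proof -
  note [simp] = P A e s
  show ?thesis
  proof (rule lax_morphismI)
    show "e \<rhd> unitor A = (s \<lhd> unt T (carr A)) \<bullet> (unitor (ldom P) \<lhd> e)"
      by (rule opf_eqI[OF p]) (use lax_morphism_laws(1)[OF L] in simp_all)
    show "(e \<rhd> multor A) \<bullet> (s \<lhd> T1 T (act A)) \<bullet> (act (ldom P) \<rhd> T2 T s)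
        = (s \<lhd> mul T (carr A)) \<bullet> (multor (ldom P) \<lhd> T1 T (T1 T e))"
      by (rule opf_eqI[OF p]) (use lax_morphism_laws(2)[OF L] in simp_all)
  qed simp_all
qed

text \<open>The whiskered laws are those of \<open>B\<close>, precomposed with \<open>p\<close> to which \<open>T\<close> has been applied once
  or three times.\<close>

lemma lax_algebra_reflect:
  assumes p: "tight_discrete_opfibration K p" and B: "lax_algebra K T B"
    and dc: "dom1 K p = X" "cod1 K p = carr B"
    and a: "a \<in> Tight K" "dom1 K a = T0 T X" "cod1 K a = X" and pa: "p \<cdot> a = act B \<cdot> T1 T p"
    and y: "y \<in> Cell K" "dom2 K y = Id1 K X" "cod2 K y = a \<cdot> unt T X" and py: "p \<rhd> y = unitor B \<lhd> p"
    and m: "m \<in> Cell K" "dom2 K m = a \<cdot> T1 T a" "cod2 K m = a \<cdot> mul T X"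
    and pm: "p \<rhd> m = multor B \<lhd> T1 T (T1 T p)"
  shows "lax_algebra K T (LAlg X a y m)"
    and "strict_morphism K T (LMor (LAlg X a y m) B p (Id2 K (act B \<cdot> T1 T p)))"
proof -
  have [simp]: "p \<in> Arr K" using p by (rule opf_arr)
  have X [simp]: "X \<in> Obj K" using dc(1) by auto
  have [simp]: "a \<in> Arr K" using a by simp
  note [simp] = B dc a pa y py m pm
  have pat [simp]: "p \<cdot> a \<cdot> x = act B \<cdot> T1 T p \<cdot> x" if "x \<in> Arr K" "cod1 K x = T0 T X" for x
    using comp1_rewrite_tail[OF pa, of x] that by simp
  have Tpa [simp]: "T1 T p \<cdot> T1 T a = T1 T (act B) \<cdot> T1 T (T1 T p)"
    using arg_cong[OF pa, of "T1 T"] by (simp del: pa)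
  have Tpat [simp]: "T1 T p \<cdot> T1 T a \<cdot> x = T1 T (act B) \<cdot> T1 T (T1 T p) \<cdot> x"
    if "x \<in> Arr K" "cod1 K x = T0 T (T0 T X)" for x
    using comp1_rewrite_tail[OF Tpa, of x] that by simp
  have TTpa [simp]: "T1 T (T1 T p) \<cdot> T1 T (T1 T a) = T1 T (T1 T (act B)) \<cdot> T1 T (T1 T (T1 T p))"
    using arg_cong[OF Tpa, of "T1 T"] by (simp del: Tpa)
  have Ty [simp]: "(act B \<cdot> T1 T p) \<rhd> T2 T y = (act B \<rhd> T2 T (unitor B)) \<lhd> T1 T p"
    using arg_cong[OF py, of "\<lambda>z. act B \<rhd> T2 T z"] by (simp del: py)
  have Tm [simp]: "(act B \<cdot> T1 T p) \<rhd> T2 T m = (act B \<rhd> T2 T (multor B)) \<lhd> T1 T (T1 T (T1 T p))"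
    using arg_cong[OF pm, of "\<lambda>z. act B \<rhd> T2 T z"] by (simp del: pm)
  show alg [simp]: "lax_algebra K T (LAlg X a y m)"
  proof (rule lax_algebraI)
    show "(m \<lhd> unt T (T0 T X)) \<bullet> (y \<lhd> a) = Id2 K a"
      by (rule opf_eqI[OF p])
        (use arg_cong[OF lax_algebra_laws(1)[OF B], of "\<lambda>z. z \<lhd> T1 T p"] in simp_all)
    show "(m \<lhd> T1 T (unt T X)) \<bullet> (a \<rhd> T2 T y) = Id2 K a"
      by (rule opf_eqI[OF p])
        (use arg_cong[OF lax_algebra_laws(2)[OF B], of "\<lambda>z. z \<lhd> T1 T p"] in simp_all)
    show "(m \<lhd> mul T (T0 T X)) \<bullet> (m \<lhd> T1 T (T1 T a)) = (m \<lhd> T1 T (mul T X)) \<bullet> (a \<rhd> T2 T m)"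
      by (rule opf_eqI[OF p])
        (use arg_cong[OF lax_algebra_laws(3)[OF B], of "\<lambda>z. z \<lhd> T1 T (T1 T (T1 T p))"] in simp_all)
  qed simp_all
  have "lax_morphism K T (LMor (LAlg X a y m) B p (Id2 K (act B \<cdot> T1 T p)))"
    by (rule lax_morphismI) simp_all
  then show "strict_morphism K T (LMor (LAlg X a y m) B p (Id2 K (act B \<cdot> T1 T p)))"
    by (rule strict_morphismI[where f = "act B \<cdot> T1 T p"]) simp_all
qed

lemma T_two_morphism_reflect:
  assumes P: "strict_morphism K T P" and p: "tight_discrete_opfibration K (und1 P)"
    and F: "lax_morphism K T F" "lcod F = ldom P" and G: "lax_morphism K T G" "lcod G = ldom P"
    and FG: "ldom G = ldom F" and k: "\<kappa> \<in> Cell K" "dom2 K \<kappa> = und1 F" "cod2 K \<kappa> = und1 G"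
    and L: "T_two_morphism K T (LCell (lmor_comp K T P F) (lmor_comp K T P G) (und1 P \<rhd> \<kappa>))"
  shows "T_two_morphism K T (LCell F G \<kappa>)"
proof -
  note [simp] = P F G FG k
  show ?thesis
  proof (rule T_two_morphismI)
    show "(\<kappa> \<lhd> act (ldom F)) \<bullet> str2 F = str2 G \<bullet> (act (lcod F) \<rhd> T2 T \<kappa>)"
      by (rule opf_eqI[OF p]) (use T_two_morphism_law[OF L] in simp_all)
  qed simp_all
qed

end

section \<open>The plumbus of lax algebras\<close>

context plumbus_monad
begin

text \<open>A 2-cell from \<open>P \<cdot> E\<close> to \<open>B\<close> is lifted in \<open>K\<close>; the codomain \<open>e\<close> of the lift becomes a lax
  morphism by lifting the structure cell of \<open>B\<close> as well. That this second lift ends at the composite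
  of \<open>e\<close> with the action, as it should, is forced by the law of the given 2-cell.\<close>

lemma strict_opfibration:
  assumes P: "strict_morphism K T P" and p: "tight_discrete_opfibration K (und1 P)"
  shows "tight_discrete_opfibration (LaxAlg K T) P"
  unfolding tight_discrete_opfibration_def
proof (intro conjI ballI)
  have "und1 P \<in> Tight K" using p by (simp add: tight_discrete_opfibration_def)
  then show "P \<in> Tight (LaxAlg K T)" using P by (simp add: pseudo_morphism_def)
next
  fix X E B \<Phi>
  assume E: "E \<in> hom1 (LaxAlg K T) X (dom1 (LaxAlg K T) P)"
    and B: "B \<in> hom1 (LaxAlg K T) X (cod1 (LaxAlg K T) P)"
    and \<Phi>: "\<Phi> \<in> hom2 (LaxAlg K T) (P \<cdot>\<^bsub>LaxAlg K T\<^esub> E) B"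
  have [simp]: "lax_morphism K T E" "ldom E = X" "lcod E = ldom P"
    "lax_morphism K T B" "ldom B = X" "lcod B = lcod P"
    and \<Phi>' [simp]: "T_two_morphism K T \<Phi>" "ldom2 \<Phi> = lmor_comp K T P E" "lcod2 \<Phi> = B"
    using E B \<Phi> by simp_all
  note [simp] = P
  have X [simp]: "lax_algebra K T X" using lax_morphism_typing(1)[of E] by simp
  let ?p = "und1 P" and ?\<epsilon> = "act (ldom P)" and ?\<beta> = "act (lcod P)" and ?\<xi> = "act X"
  obtain \<kappa> where \<kappa> [simp]: "\<kappa> \<in> Cell K" "dom2 K \<kappa> = und1 E" "?p \<rhd> \<kappa> = und2 \<Phi>"
    by (rule opf_lift[OF p, of "und1 E" "und2 \<Phi>"]) simp_all
  define e where "e = cod2 K \<kappa>"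
  have e [simp]: "e \<in> Arr K" "cod2 K \<kappa> = e" "dom1 K e = carr X" "cod1 K e = carr (ldom P)"
    unfolding e_def by simp_all
  have "cod2 K (?p \<rhd> \<kappa>) = cod2 K (und2 \<Phi>)" by (simp only: \<kappa>)
  then have pe [simp]: "?p \<cdot> e = und1 B" by (simp del: \<kappa>(3))
  have Tpe [simp]: "T1 T ?p \<cdot> T1 T e = T1 T (und1 B)"
    using arg_cong[OF pe, of "T1 T"] by (simp del: pe)
  have pet [simp]: "?p \<cdot> e \<cdot> x = und1 B \<cdot> x" if "x \<in> Arr K" "cod1 K x = carr X" for x
    using comp1_rewrite_tail[OF pe, of x] that by simp
  have T\<kappa> [simp]: "(?\<beta> \<cdot> T1 T ?p) \<rhd> T2 T \<kappa> = ?\<beta> \<rhd> T2 T (und2 \<Phi>)"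
    using arg_cong[OF \<kappa>(3), of "\<lambda>z. ?\<beta> \<rhd> T2 T z"] by (simp del: \<kappa>(3))
  obtain s where s [simp]: "s \<in> Cell K" "dom2 K s = ?\<epsilon> \<cdot> T1 T e" "?p \<rhd> s = str2 B"
    by (rule opf_lift[OF p, of "?\<epsilon> \<cdot> T1 T e" "str2 B"]) simp_all
  have sq: "(\<kappa> \<lhd> ?\<xi>) \<bullet> str2 E = s \<bullet> (?\<epsilon> \<rhd> T2 T \<kappa>)"
    by (rule opf_eqI[OF p]) (use T_two_morphism_law[OF \<Phi>'(1)] in simp_all)
  have "cod2 K ((\<kappa> \<lhd> ?\<xi>) \<bullet> str2 E) = cod2 K (s \<bullet> (?\<epsilon> \<rhd> T2 T \<kappa>))" unfolding sq ..
  then have s4 [simp]: "cod2 K s = e \<cdot> ?\<xi>" by simp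
  define E' where "E' = LMor X (ldom P) e s"
  have PE': "LMor X (lcod P) (?p \<cdot> e) (?p \<rhd> s) = B" by (rule lmor.expand) simp
  have lE' [simp]: "lax_morphism K T E'"
    unfolding E'_def by (rule lax_morphism_reflect[OF P p]) (use PE' in simp_all)
  have E'_sel [simp]: "ldom E' = X" "lcod E' = ldom P" "und1 E' = e" "str2 E' = s"
    by (simp_all add: E'_def)
  have [simp]: "lmor_comp K T P E' = B" by (rule lmor.expand) simp
  have two: "T_two_morphism K T (LCell E E' \<kappa>)"
    by (rule T_two_morphismI) (simp_all add: sq)
  show "\<exists>!\<Theta>. \<Theta> \<in> Cell (LaxAlg K T) \<and> dom2 (LaxAlg K T) \<Theta> = E \<and> P \<rhd>\<^bsub>LaxAlg K T\<^esub> \<Theta> = \<Phi>"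
  proof (rule ex1I[of _ "LCell E E' \<kappa>"], goal_cases)
    case 1
    show ?case using two by (auto intro!: lcell.expand)
  next
    case (2 \<Theta>)
    then have k [simp]: "T_two_morphism K T \<Theta>" "ldom2 \<Theta> = E"
      and L: "LCell (lmor_comp K T P E) (lmor_comp K T P (lcod2 \<Theta>)) (?p \<rhd> und2 \<Theta>) = \<Phi>" by auto
    have [simp]: "ldom (lcod2 \<Theta>) = X" "lcod (lcod2 \<Theta>) = ldom P" 
      using T_two_morphism_typing(3,4)[OF k(1)] by simp_all
    have pk: "?p \<rhd> und2 \<Theta> = und2 \<Phi>" and pl: "lmor_comp K T P (lcod2 \<Theta>) = B"
      using arg_cong[OF L, of und2] arg_cong[OF L, of lcod2] by simp_all
    have k\<kappa>: "und2 \<Theta> = \<kappa>" by (rule opf_eqI[OF p]) (simp_all add: pk)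
    have "und1 (lcod2 \<Theta>) = cod2 K (und2 \<Theta>)" by simp
    then have u [simp]: "und1 (lcod2 \<Theta>) = e" unfolding k\<kappa> by simp
    have ps: "?p \<rhd> str2 (lcod2 \<Theta>) = str2 B" using arg_cong[OF pl, of str2] by simp
    have "str2 (lcod2 \<Theta>) = s" by (rule opf_eqI[OF p]) (simp_all add: ps)
    then have "lcod2 \<Theta> = E'" by (intro lmor.expand) simp
    with k\<kappa> show ?case by (intro lcell.expand) simp
  qed
qed

lemma strict_reflects_tight:
  assumes P: "strict_morphism K T P" and p: "tight_discrete_opfibration K (und1 P)"
    and F: "lax_morphism K T F" "lcod F = ldom P" and PF: "pseudo_morphism K T (lmor_comp K T P F)"
  shows "pseudo_morphism K T F"
proof -
  note [simp] = P F
  have i: "iso2 K (und1 P \<rhd> str2 F)" using PF by (simp add: pseudo_morphism_def)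
  have "iso2 K (str2 F)" by (rule opf_reflect_iso[OF p]) (simp_all add: i)
  then show ?thesis by (simp add: pseudo_morphism_def)
qed

text \<open>The defining property of \<open>lax_pb\<close>, for an arbitrary pullback with projections \<open>p'\<close> and \<open>q\<close> in place
  of the chosen one.\<close>

definition strict_pb_square ::
    "('o, 'a, 'c) lmor \<Rightarrow> ('o, 'a, 'c) lmor \<Rightarrow> 'a \<Rightarrow> 'a \<Rightarrow> ('o, 'a, 'c) lmor \<times> ('o, 'a, 'c) lmor \<Rightarrow> bool" where
  "strict_pb_square P F p' q s \<longleftrightarrow>
     strict_morphism K T (fst s) \<and> lax_morphism K T (snd s) \<and>
     ldom (snd s) = ldom (fst s) \<and> lcod (fst s) = ldom F \<and> lcod (snd s) = ldom P \<and>
     und1 (fst s) = p' \<and> und1 (snd s) = q \<and>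
     lmor_comp K T P (snd s) = lmor_comp K T F (fst s)"

text \<open>The 2-cell \<open>\<kappa>\<close> obtained by lifting the structure cell of \<open>F\<close> is the structure cell of the projection
  \<open>q\<close>, and its codomain determines the action \<open>r\<close> on the pullback. The unitor and the
  multiplicator are lifted along \<open>p'\<close>. To see that these lifts have the required codomains, one
  compares their images under \<open>q\<close> with composites involving \<open>\<kappa>\<close>, which is possible because those
  agree after applying \<open>P\<close>.\<close>

lemma strict_pb_square_exists:
  assumes P: "strict_morphism K T P" and p: "tight_discrete_opfibration K (und1 P)"
    and F: "lax_morphism K T F" "lcod F = lcod P"
    and ltp: "left_tight_pullback K (und1 P) (und1 F) p' q" and p': "tight_discrete_opfibration K p'"
  shows "\<exists>s. strict_pb_square P F p' q s"
proof -
  note pbk = left_tight_pullbackD(1)[OF ltp]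
  note [simp] = P F
  let ?p = "und1 P" and ?f = "und1 F" and ?A = "ldom F" and ?E = "ldom P" and ?B = "lcod P"
  let ?\<epsilon> = "act (ldom P)" and ?\<alpha> = "act (ldom F)" and ?\<beta> = "act (lcod P)"
  define Q where "Q = dom1 K p'"
  have [simp]: "p' \<in> Arr K" "dom1 K p' = Q" "cod1 K p' = carr ?A" "q \<in> Arr K" "dom1 K q = Q" "cod1 K q = carr ?E"
    and sq [simp]: "?p \<cdot> q = ?f \<cdot> p'"
    using pullback_typing[OF pbk] by (simp_all add: Q_def)
  have [simp]: "Q \<in> Obj K" using arr_dom_cod(1)[of p'] by simp
  have Tsq [simp]: "T1 T ?p \<cdot> T1 T q = T1 T ?f \<cdot> T1 T p'"
    using arg_cong[OF sq, of "T1 T"] by (simp del: sq)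
  have TTsq [simp]: "T1 T (T1 T ?p) \<cdot> T1 T (T1 T q) = T1 T (T1 T ?f) \<cdot> T1 T (T1 T p')"
    using arg_cong[OF Tsq, of "T1 T"] by (simp del: Tsq)
  have sqt [simp]: "?p \<cdot> q \<cdot> x = ?f \<cdot> p' \<cdot> x" if "x \<in> Arr K" "cod1 K x = Q" for x
    using comp1_rewrite_tail[OF sq, of x] that by simp
  have Tsqt [simp]: "T1 T ?p \<cdot> T1 T q \<cdot> x = T1 T ?f \<cdot> T1 T p' \<cdot> x" if "x \<in> Arr K" "cod1 K x = T0 T Q" for x
    using comp1_rewrite_tail[OF Tsq, of x] that by simp
  obtain \<kappa> where \<kappa> [simp]: "\<kappa> \<in> Cell K" "dom2 K \<kappa> = ?\<epsilon> \<cdot> T1 T q" "?p \<rhd> \<kappa> = str2 F \<lhd> T1 T p'"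
    by (rule opf_lift[OF p, of "?\<epsilon> \<cdot> T1 T q" "str2 F \<lhd> T1 T p'"]) simp_all
  define e where "e = cod2 K \<kappa>"
  have e [simp]: "e \<in> Arr K" "cod2 K \<kappa> = e" "dom1 K e = T0 T Q" "cod1 K e = carr ?E"
    unfolding e_def by simp_all
  have "cod2 K (?p \<rhd> \<kappa>) = cod2 K (str2 F \<lhd> T1 T p')" by (simp only: \<kappa>)
  then have pe: "?p \<cdot> e = ?f \<cdot> ?\<alpha> \<cdot> T1 T p'" by (simp del: \<kappa>(3))
  obtain r where r [simp]: "r \<in> Arr K" "dom1 K r = T0 T Q" "cod1 K r = Q" and pr [simp]: "p' \<cdot> r = ?\<alpha> \<cdot> T1 T p'"
    and qr: "q \<cdot> r = e"
    by (rule pullback_arr[OF pbk, of "?\<alpha> \<cdot> T1 T p'" e]) (simp_all add: pe)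
  \<comment> \<open>From here on the codomain of \<open>\<kappa>\<close> is to be written \<open>q \<cdot> r\<close>.\<close>
  note e(2) [simp del]
  have \<kappa>4 [simp]: "cod2 K \<kappa> = q \<cdot> r" using e(2) qr by simp
  have rt: "r \<in> Tight K"
  proof (rule left_tight_pullbackD(4)[OF ltp])
    have "?\<alpha> \<in> Tight K" by (rule lax_algebra_tight) simp
    then show "p' \<cdot> r \<in> Tight K"
      using left_tight_pullbackD(3)[OF ltp] unfolding pr by (intro tight_comp1 T1_tight) simp_all
  qed simp_all
  have prt [simp]: "p' \<cdot> r \<cdot> x = ?\<alpha> \<cdot> T1 T p' \<cdot> x" if "x \<in> Arr K" "cod1 K x = T0 T Q" for x
    using comp1_rewrite_tail[OF pr, of x] that by simp
  have Tpr [simp]: "T1 T p' \<cdot> T1 T r = T1 T ?\<alpha> \<cdot> T1 T (T1 T p')"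
    using arg_cong[OF pr, of "T1 T"] by (simp del: pr)
  have T\<kappa> [simp]: "(?\<beta> \<cdot> T1 T ?p) \<rhd> T2 T \<kappa> = (?\<beta> \<rhd> T2 T (str2 F)) \<lhd> T1 T (T1 T p')"
    using arg_cong[OF \<kappa>(3), of "\<lambda>z. ?\<beta> \<rhd> T2 T z"] by (simp del: \<kappa>(3))
  obtain y where y [simp]: "y \<in> Cell K" "dom2 K y = Id1 K Q" "p' \<rhd> y = unitor ?A \<lhd> p'"
    by (rule opf_lift[OF p', of "Id1 K Q" "unitor ?A \<lhd> p'"]) simp_all
  have fy [simp]: "(?f \<cdot> p') \<rhd> y = (?f \<rhd> unitor ?A) \<lhd> p'"
    using arg_cong[OF y(3), of "\<lambda>z. ?f \<rhd> z"] by (simp del: y(3))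
  have qy: "q \<rhd> y = (\<kappa> \<lhd> unt T Q) \<bullet> (unitor ?E \<lhd> q)"
    by (rule opf_eqI[OF p]) (simp_all add: lax_morphism_laws(1)[OF F(1)])
  have y4 [simp]: "cod2 K y = r \<cdot> unt T Q"
  proof (rule pullback_arr_eqI[OF pbk])
    have "cod2 K (q \<rhd> y) = cod2 K ((\<kappa> \<lhd> unt T Q) \<bullet> (unitor ?E \<lhd> q))" unfolding qy ..
    then show "q \<cdot> cod2 K y = q \<cdot> r \<cdot> unt T Q" by simp
    have "cod2 K (p' \<rhd> y) = cod2 K (unitor ?A \<lhd> p')" by (simp only: y)
    then show "p' \<cdot> cod2 K y = p' \<cdot> r \<cdot> unt T Q" by (simp del: y(3))
  qed simp_all
  obtain m where m [simp]: "m \<in> Cell K" "dom2 K m = r \<cdot> T1 T r" "p' \<rhd> m = multor ?A \<lhd> T1 T (T1 T p')"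
    by (rule opf_lift[OF p', of "r \<cdot> T1 T r" "multor ?A \<lhd> T1 T (T1 T p')"]) simp_all
  have fm [simp]: "(?f \<cdot> p') \<rhd> m = (?f \<rhd> multor ?A) \<lhd> T1 T (T1 T p')"
    using arg_cong[OF m(3), of "\<lambda>z. ?f \<rhd> z"] by (simp del: m(3))
  \<comment> \<open>As \<open>\<kappa>\<close> need not be invertible, this determines \<open>q \<rhd> m\<close> only after precomposition, which is
    enough to read off its codomain.\<close>
  have qm: "(q \<rhd> m) \<bullet> (\<kappa> \<lhd> T1 T r) \<bullet> (?\<epsilon> \<rhd> T2 T \<kappa>) = (\<kappa> \<lhd> mul T Q) \<bullet> (multor ?E \<lhd> T1 T (T1 T q))"
    by (rule opf_eqI[OF p])
      (use arg_cong[OF lax_morphism_laws(2)[OF F(1)], of "\<lambda>z. z \<lhd> T1 T (T1 T p')"] in simp_all)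
  have m4 [simp]: "cod2 K m = r \<cdot> mul T Q"
  proof (rule pullback_arr_eqI[OF pbk])
    have "cod2 K ((q \<rhd> m) \<bullet> (\<kappa> \<lhd> T1 T r) \<bullet> (?\<epsilon> \<rhd> T2 T \<kappa>))
      = cod2 K ((\<kappa> \<lhd> mul T Q) \<bullet> (multor ?E \<lhd> T1 T (T1 T q)))" unfolding qm ..
    then show "q \<cdot> cod2 K m = q \<cdot> r \<cdot> mul T Q" by simp
    have "cod2 K (p' \<rhd> m) = cod2 K (multor ?A \<lhd> T1 T (T1 T p'))" by (simp only: m)
    then show "p' \<cdot> cod2 K m = p' \<cdot> r \<cdot> mul T Q" by (simp del: m(3))
  qed simp_all
  let ?Q = "LAlg Q r y m" and ?S = "LMor (LAlg Q r y m) ?A p' (Id2 K (?\<alpha> \<cdot> T1 T p'))"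
  have Q [simp]: "lax_algebra K T ?Q"
    by (rule lax_algebra_reflect(1)[OF p', of ?A]) (use rt in simp_all)
  have S [simp]: "strict_morphism K T ?S"
    by (rule lax_algebra_reflect(2)[OF p', of ?A]) (use rt in simp_all)
  have FS: "LMor ?Q ?B (?p \<cdot> q) (?p \<rhd> \<kappa>) = lmor_comp K T F ?S"
    by (rule lmor.expand) simp
  have R [simp]: "lax_morphism K T (LMor ?Q ?E q \<kappa>)"
    by (rule lax_morphism_reflect[OF P p]) (use FS in simp_all)
  have "lmor_comp K T P (LMor ?Q ?E q \<kappa>) = lmor_comp K T F ?S"
    by (rule lmor.expand) simp
  then have "strict_pb_square P F p' q (?S, LMor ?Q ?E q \<kappa>)"
    unfolding strict_pb_square_def by simp
  then show ?thesis ..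
qed

lemma strict_pb_square_unique:
  assumes P: "strict_morphism K T P" and p: "tight_discrete_opfibration K (und1 P)"
    and F: "lax_morphism K T F" "lcod F = lcod P"
    and pbk: "pullback K (und1 P) (und1 F) p' q" and p': "tight_discrete_opfibration K p'"
    and s: "strict_pb_square P F p' q s" and s': "strict_pb_square P F p' q s'"
  shows "s = s'"
proof -
  obtain S R where sSR: "s = (S, R)" by (cases s)
  obtain S' R' where sSR': "s' = (S', R')" by (cases s')
  note [simp] = P F
  have S [simp]: "strict_morphism K T S" "lax_morphism K T R" "ldom R = ldom S" "lcod S = ldom F" "lcod R = ldom P"
    "und1 S = p'" "und1 R = q" and SR: "lmor_comp K T P R = lmor_comp K T F S"
    using s unfolding sSR strict_pb_square_def by simp_all
  have S' [simp]: "strict_morphism K T S'" "lax_morphism K T R'" "ldom R' = ldom S'" "lcod S' = ldom F" "lcod R' = ldom P"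
    "und1 S' = p'" "und1 R' = q" and SR': "lmor_comp K T P R' = lmor_comp K T F S'"
    using s' unfolding sSR' strict_pb_square_def by simp_all
  let ?p = "und1 P"
  have ty [simp]: "p' \<in> Arr K" "cod1 K p' = carr (ldom F)" "q \<in> Arr K" "dom1 K q = dom1 K p'" "cod1 K q = carr (ldom P)"
    "carr (ldom S) = dom1 K p'" "carr (ldom S') = dom1 K p'"
    using pullback_typing[OF pbk] lax_morphism_typing(4)[of S] lax_morphism_typing(4)[of S'] by simp_all
  have sq: "?p \<cdot> q = und1 F \<cdot> p'" by (rule pullback_typing[OF pbk])
  have Tsq [simp]: "T1 T ?p \<cdot> T1 T q = T1 T (und1 F) \<cdot> T1 T p'"
    using arg_cong[OF sq, of "T1 T"] by simp
  have pR: "?p \<rhd> str2 R = str2 F \<lhd> T1 T p'" "?p \<rhd> str2 R' = str2 F \<lhd> T1 T p'"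
    using arg_cong[OF SR, of str2] arg_cong[OF SR', of str2] by simp_all
  have R: "str2 R = str2 R'"
    by (rule opf_eqI[OF p]) (simp_all add: pR)
  have qS: "q \<cdot> act (ldom S) = q \<cdot> act (ldom S')" using arg_cong[OF R, of "cod2 K"] by simp
  have pS: "p' \<cdot> act (ldom S) = p' \<cdot> act (ldom S')"
    using strict_comm[of S] strict_comm[of S'] by simp
  have act: "act (ldom S) = act (ldom S')"
    by (rule pullback_arr_eqI[OF pbk]) (use qS pS in simp_all)
  have "unitor (ldom S) = unitor (ldom S')"
    by (rule opf_eqI[OF p']) (use strict_unitor[of S] strict_unitor[of S'] in simp_all)
  moreover have "multor (ldom S) = multor (ldom S')"
    by (rule opf_eqI[OF p']) (use strict_multor[of S] strict_multor[of S'] act in simp_all)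
  ultimately have "ldom S = ldom S'"
    using act by (intro lalg.expand) simp
  with R show ?thesis unfolding sSR sSR' by (auto intro!: lmor.expand)
qed

text \<open>The underlying mediating arrow \<open>l\<close> exists already. Its structure cell is the lift along \<open>S\<close> of that of
  \<open>H\<close>; as for the pullback algebra, the codomain of the lift is found by comparing images under \<open>R\<close> and
  \<open>S\<close>.\<close>

lemma pullback_lift:
  assumes P: "strict_morphism K T P" and p: "tight_discrete_opfibration K (und1 P)"
    and F: "lax_morphism K T F" "lcod F = lcod P"
    and S: "strict_morphism K T S" and p': "tight_discrete_opfibration K (und1 S)"
    and R: "lax_morphism K T R" "ldom R = ldom S" "lcod R = ldom P" "lcod S = ldom F"
    and SR: "lmor_comp K T P R = lmor_comp K T F S"
    and pbk: "pullback K (und1 P) (und1 F) (und1 S) (und1 R)"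
  shows "pullback (LaxAlg K T) P F S R"
proof -
  interpret L: two_category "LaxAlg K T" by (rule LaxAlg_two_category)
  note [simp] = P F S R
  let ?p = "und1 P" and ?f = "und1 F" and ?p' = "und1 S" and ?q = "und1 R"
  have sq [simp]: "?p \<cdot> ?q = ?f \<cdot> ?p'" by (rule pullback_typing[OF pbk])
  have psR [simp]: "?p \<rhd> str2 R = str2 F \<lhd> T1 T ?p'" using arg_cong[OF SR, of str2] by simp
  show ?thesis
  proof (rule L.pullbackI, goal_cases)
    case 9
    show ?case using SR by simp
  next
    case (10 H M)
    then have HM [simp]: "lax_morphism K T H" "lax_morphism K T M" "ldom M = ldom H" "lcod H = ldom F"
      "lcod M = ldom P" and PM: "lmor_comp K T P M = lmor_comp K T F H" by simp_all
    have pm: "?p \<cdot> und1 M = ?f \<cdot> und1 H" using arg_cong[OF PM, of und1] by simp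
    obtain l where l [simp]: "l \<in> Arr K" "dom1 K l = carr (ldom H)" "cod1 K l = carr (ldom S)"
      and pl [simp]: "?p' \<cdot> l = und1 H" and ql [simp]: "?q \<cdot> l = und1 M"
      by (rule pullback_arr[OF pbk, of "und1 H" "und1 M"]) (simp_all add: pm)
    have Tpl [simp]: "T1 T ?p' \<cdot> T1 T l = T1 T (und1 H)"
      using arg_cong[OF pl, of "T1 T"] by (simp del: pl)
    have Tql [simp]: "T1 T ?q \<cdot> T1 T l = T1 T (und1 M)"
      using arg_cong[OF ql, of "T1 T"] by (simp del: ql)
    have plt [simp]: "?p' \<cdot> l \<cdot> x = und1 H \<cdot> x" if "x \<in> Arr K" "cod1 K x = carr (ldom H)" for x
      using comp1_rewrite_tail[OF pl, of x] that by simp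
    have qlt [simp]: "?q \<cdot> l \<cdot> x = und1 M \<cdot> x" if "x \<in> Arr K" "cod1 K x = carr (ldom H)" for x
      using comp1_rewrite_tail[OF ql, of x] that by simp
    obtain s where s [simp]: "s \<in> Cell K" "dom2 K s = act (ldom S) \<cdot> T1 T l" "?p' \<rhd> s = str2 H"
      by (rule opf_lift[OF p', of "act (ldom S) \<cdot> T1 T l" "str2 H"]) simp_all
    have fs [simp]: "(?f \<cdot> ?p') \<rhd> s = ?f \<rhd> str2 H"
      using arg_cong[OF s(3), of "\<lambda>z. ?f \<rhd> z"] by (simp del: s(3))
    have qs: "(?q \<rhd> s) \<bullet> (str2 R \<lhd> T1 T l) = str2 M"
      by (rule opf_eqI[OF p]) (use arg_cong[OF PM, of str2] arg_cong[OF PM, of und1] in simp_all)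
    have s4 [simp]: "cod2 K s = l \<cdot> act (ldom H)"
    proof (rule pullback_arr_eqI[OF pbk])
      have "cod2 K ((?q \<rhd> s) \<bullet> (str2 R \<lhd> T1 T l)) = cod2 K (str2 M)" unfolding qs ..
      then show "?q \<cdot> cod2 K s = ?q \<cdot> l \<cdot> act (ldom H)" by simp
      have "cod2 K (?p' \<rhd> s) = cod2 K (str2 H)" by (simp only: s)
      then show "?p' \<cdot> cod2 K s = ?p' \<cdot> l \<cdot> act (ldom H)" by (simp del: s(3))
    qed simp_all
    have PE': "LMor (ldom H) (lcod S) (?p' \<cdot> l) (?p' \<rhd> s) = H" by (rule lmor.expand) simp
    have L [simp]: "lax_morphism K T (LMor (ldom H) (ldom S) l s)"
      by (rule lax_morphism_reflect[OF S p']) (use PE' in simp_all)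
    have "lmor_comp K T S (LMor (ldom H) (ldom S) l s) = H" "lmor_comp K T R (LMor (ldom H) (ldom S) l s) = M"
      by (rule lmor.expand; simp add: qs)+
    then show ?case by (intro exI[of _ "LMor (ldom H) (ldom S) l s"]) simp
  next
    case (11 L L')
    then have LL' [simp]: "lax_morphism K T L" "lax_morphism K T L'" "ldom L = ldom L'" "lcod L = ldom S"
      "lcod L' = ldom S" and 1: "lmor_comp K T S L = lmor_comp K T S L'" "lmor_comp K T R L = lmor_comp K T R L'" by simp_all
    have u: "und1 L = und1 L'"
      by (rule pullback_arr_eqI[OF pbk]) (use 1[THEN arg_cong[of _ _ und1]] in simp_all)
    have "str2 L = str2 L'"
      by (rule opf_eqI[OF p']) (use 1(1)[THEN arg_cong[of _ _ str2]] u in simp_all)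
    with u show ?case by (intro lmor.expand) simp
  next
    case (12 L L' \<Phi> \<Psi>)
    then have LL' [simp]: "lax_morphism K T L" "lax_morphism K T L'" "ldom L = ldom L'" "lcod L = ldom S"
      "lcod L' = ldom S" and two [simp]: "T_two_morphism K T \<Phi>" "T_two_morphism K T \<Psi>"
      and c [simp]: "ldom2 \<Phi> = lmor_comp K T S L" "lcod2 \<Phi> = lmor_comp K T S L'"
       "ldom2 \<Psi> = lmor_comp K T R L" "lcod2 \<Psi> = lmor_comp K T R L'"
      and e: "P \<rhd>\<^bsub>LaxAlg K T\<^esub> \<Psi> = F \<rhd>\<^bsub>LaxAlg K T\<^esub> \<Phi>" by simp_all
    have pm: "?p \<rhd> und2 \<Psi> = ?f \<rhd> und2 \<Phi>" using arg_cong[OF e, of und2] by simp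
    obtain \<kappa> where k [simp]: "\<kappa> \<in> Cell K" "dom2 K \<kappa> = und1 L" "cod2 K \<kappa> = und1 L'"
      "?p' \<rhd> \<kappa> = und2 \<Phi>" "?q \<rhd> \<kappa> = und2 \<Psi>"
      by (rule pullback_cell[OF pbk, of "und1 L" "und1 L'" "und2 \<Phi>" "und2 \<Psi>"]) (simp_all add: pm)
    have \<Phi>: "LCell (lmor_comp K T S L) (lmor_comp K T S L') (?p' \<rhd> \<kappa>) = \<Phi>"
      by (rule lcell.expand) simp
    have "T_two_morphism K T (LCell L L' \<kappa>)"
      by (rule T_two_morphism_reflect[OF S p']) (use \<Phi> in simp_all)
    then show ?case
      by (intro exI[of _ "LCell L L' \<kappa>"]) (auto intro!: lcell.expand)
  next
    case (13 \<Theta> \<Theta>')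
    then have two [simp]: "T_two_morphism K T \<Theta>" "T_two_morphism K T \<Theta>'"
      and c [simp]: "ldom2 \<Theta> = ldom2 \<Theta>'" "lcod2 \<Theta> = lcod2 \<Theta>'" and l: "lcod (ldom2 \<Theta>) = ldom S"
      and e: "S \<rhd>\<^bsub>LaxAlg K T\<^esub> \<Theta> = S \<rhd>\<^bsub>LaxAlg K T\<^esub> \<Theta>'" by simp_all
    have [simp]: "lcod (ldom2 \<Theta>') = ldom S" using l by simp
    have "und2 \<Theta> = und2 \<Theta>'"
      by (rule opf_eqI[OF p']) (use arg_cong[OF e, of und2] in simp_all)
    then show ?case by (intro lcell.expand) simp
  qed simp_all
qed

lemma small_strictD [simp]:
  assumes "small_strict K T P"
  shows "strict_morphism K T P" "und1 P \<in> Small K" "tight_discrete_opfibration K (und1 P)"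
  using assms small_opfib by (auto simp: small_strict_def)

lemma lax_pb_square:
  assumes P: "small_strict K T P" and F: "lax_morphism K T F" "lcod F = lcod P"
  shows "strict_pb_square P F (pb K (und1 P) (und1 F)) (pbtop K (und1 P) (und1 F)) (lax_pb K T P F)"
    and "strict_pb_square P F (pb K (und1 P) (und1 F)) (pbtop K (und1 P) (und1 F)) s \<Longrightarrow> lax_pb K T P F = s"
proof -
  note [simp] = P F
  let ?sq = "strict_pb_square P F (pb K (und1 P) (und1 F)) (pbtop K (und1 P) (und1 F))"
  have [simp]: "und1 F \<in> Arr K" "cod1 K (und1 F) = cod1 K (und1 P)" by simp_all
  have ltp: "left_tight_pullback K (und1 P) (und1 F) (pb K (und1 P) (und1 F)) (pbtop K (und1 P) (und1 F))"
    by (rule pb_pullback) simp_all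
  have p': "tight_discrete_opfibration K (pb K (und1 P) (und1 F))"
    by (intro small_opfib pb_small) simp_all
  have eq: "s = s'" if "?sq s" "?sq s'" for s s'
    using that by (intro strict_pb_square_unique[OF _ _ _ _ left_tight_pullbackD(1)[OF ltp] p' that]) simp_all
  obtain s0 where s0: "?sq s0"
    using strict_pb_square_exists[OF _ _ _ _ ltp p'] by auto
  have the: "lax_pb K T P F = (THE s. ?sq s)"
    unfolding lax_pb_def strict_pb_square_def ..
  have "lax_pb K T P F = s0" unfolding the by (rule the_equality[where P = ?sq, OF s0]) (rule eq[OF _ s0])
  then show "?sq (lax_pb K T P F)" using s0 by simp
  then show "?sq s \<Longrightarrow> lax_pb K T P F = s" by (intro eq)
qed

lemma lax_pb_left_tight:
  assumes P: "small_strict K T P" and F: "lax_morphism K T F" "lcod F = lcod P"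
  shows "small_strict K T (fst (lax_pb K T P F))"
    and "left_tight_pullback (LaxAlg K T) P F (fst (lax_pb K T P F)) (snd (lax_pb K T P F))"
    and "pullback K (und1 P) (und1 F) (und1 (fst (lax_pb K T P F))) (und1 (snd (lax_pb K T P F)))"
proof -
  note [simp] = P F
  obtain S R where SR: "lax_pb K T P F = (S, R)" by (cases "lax_pb K T P F")
  have [simp]: "und1 F \<in> Arr K" "cod1 K (und1 F) = cod1 K (und1 P)" by simp_all
  have ltp: "left_tight_pullback K (und1 P) (und1 F) (pb K (und1 P) (und1 F)) (pbtop K (und1 P) (und1 F))"
    by (rule pb_pullback) simp_all
  have sm: "pb K (und1 P) (und1 F) \<in> Small K" by (rule pb_small) simp_all
  have S [simp]: "strict_morphism K T S" "lax_morphism K T R" "ldom R = ldom S" "lcod S = ldom F" "lcod R = ldom P"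
    and u: "und1 S = pb K (und1 P) (und1 F)" "und1 R = pbtop K (und1 P) (und1 F)"
    and PR: "lmor_comp K T P R = lmor_comp K T F S"
    using lax_pb_square(1)[OF P F] unfolding SR strict_pb_square_def by simp_all
  show S' [simp]: "small_strict K T (fst (lax_pb K T P F))"
    unfolding SR using sm u by (simp add: small_strict_def)
  have opf: "tight_discrete_opfibration K (und1 S)" using small_strictD(3)[OF S'] unfolding SR by simp
  show pbk: "pullback K (und1 P) (und1 F) (und1 (fst (lax_pb K T P F))) (und1 (snd (lax_pb K T P F)))"
    unfolding SR using left_tight_pullbackD(1)[OF ltp] by (simp add: u)
  have L: "pullback (LaxAlg K T) P F S R"
    by (rule pullback_lift) (use pbk opf PR in \<open>simp_all add: SR\<close>)
  have "H \<in> Tight (LaxAlg K T)" if "lax_morphism K T H" "lcod H = ldom S" "lmor_comp K T S H \<in> Tight (LaxAlg K T)" for H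
    using that strict_reflects_tight[OF S(1) opf that(1,2)] left_tight_pullbackD(4)[OF ltp, of "und1 H"]
    by (simp flip: u)
  moreover have "P \<in> Tight (LaxAlg K T)" "S \<in> Tight (LaxAlg K T)"
    using opf_tight[OF strict_opfibration[OF S(1) opf]] opf_tight[OF strict_opfibration[of P]]
    by (simp_all only: small_strictD P)
  ultimately show "left_tight_pullback (LaxAlg K T) P F (fst (lax_pb K T P F)) (snd (lax_pb K T P F))"
    unfolding SR left_tight_pullback_def using L by simp
qed

lemma lax_pb_id:
  assumes P: "small_strict K T P"
  shows "lax_pb K T P (lmor_id K (lcod P)) = (P, lmor_id K (ldom P))"
proof (rule lax_pb_square(2)[OF P])
  note [simp] = P
  show "strict_pb_square P (lmor_id K (lcod P)) (pb K (und1 P) (und1 (lmor_id K (lcod P))))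
     (pbtop K (und1 P) (und1 (lmor_id K (lcod P)))) (P, lmor_id K (ldom P))"
    using pb_id1[of "und1 P"] unfolding strict_pb_square_def by simp
qed (use P in simp_all)

text \<open>Pasting two chosen squares gives a square with the defining property of the chosen pullback along
  the composite.\<close>

lemma lax_pb_comp:
  assumes P: "small_strict K T P" and F: "lax_morphism K T F" "lcod F = lcod P"
    and G: "lax_morphism K T G" "lcod G = ldom F"
  defines "S \<equiv> fst (lax_pb K T P F)" and "R \<equiv> snd (lax_pb K T P F)"
  shows "lax_pb K T P (lmor_comp K T F G) = (fst (lax_pb K T S G), lmor_comp K T R (snd (lax_pb K T S G)))"
proof -
  note [simp] = P F G
  have S' [simp]: "small_strict K T S" unfolding S_def by (rule lax_pb_left_tight[OF P F])
  have S [simp]: "lax_morphism K T R" "ldom R = ldom S" "lcod S = ldom F" "lcod R = ldom P"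
    and u: "und1 S = pb K (und1 P) (und1 F)" "und1 R = pbtop K (und1 P) (und1 F)"
    and PR: "lmor_comp K T P R = lmor_comp K T F S"
    using lax_pb_square(1)[OF P F] unfolding strict_pb_square_def S_def R_def by simp_all
  obtain S2 R2 where SR2: "lax_pb K T S G = (S2, R2)" by (cases "lax_pb K T S G")
  have S2 [simp]: "strict_morphism K T S2" "lax_morphism K T R2" "ldom R2 = ldom S2" "lcod S2 = ldom G" "lcod R2 = ldom S"
    and u2: "und1 S2 = pb K (und1 S) (und1 G)" "und1 R2 = pbtop K (und1 S) (und1 G)"
    and PR2: "lmor_comp K T S R2 = lmor_comp K T G S2"
    using lax_pb_square(1)[OF S', of G] unfolding SR2 strict_pb_square_def by simp_all
  have "lmor_comp K T P (lmor_comp K T R R2) = lmor_comp K T (lmor_comp K T P R) R2" by simp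
  also have "\<dots> = lmor_comp K T F (lmor_comp K T S R2)" unfolding PR by simp
  also have "\<dots> = lmor_comp K T (lmor_comp K T F G) S2" unfolding PR2 by simp
  finally have 1: "lmor_comp K T P (lmor_comp K T R R2) = lmor_comp K T (lmor_comp K T F G) S2" .
  have 2: "pb K (und1 P) (und1 F \<cdot> und1 G) = und1 S2 \<and> pbtop K (und1 P) (und1 F \<cdot> und1 G) = und1 R \<cdot> und1 R2"
    unfolding u2 u by (rule pb_comp1) simp_all
  show ?thesis
    unfolding SR2 by (rule lax_pb_square(2)[OF P]) (use 1 2 in \<open>simp_all add: strict_pb_square_def\<close>)
qed

theorem LaxAlg_plumbus: "plumbus (LaxAlg K T)"
proof -
  interpret L: repletely_enhanced_two_category "LaxAlg K T" by (rule LaxAlg_repletely_enhanced)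
  show ?thesis
  proof (unfold_locales, goal_cases)
    case 1
    show ?case using LaxAlg_terminal by simp
  next
    case (2 p)
    then show ?case by (simp add: strict_opfibration)
  next
    case (3 p f)
    then show ?case using lax_pb_left_tight(1) by simp
  next
    case (4 p f)
    then show ?case using lax_pb_left_tight(2) by simp
  next
    case (5 p)
    then show ?case using lax_pb_id by simp
  next
    case (6 p f g)
    then show ?case using lax_pb_comp[of p f g] by simp
  qed
qed

end

section \<open>Pullback squares are initial\<close>

text \<open>Initiality in the category whose objects are the commuting squares from \<open>p\<close> to \<open>u\<close> and whose
  morphisms are the compatible pairs of 2-cells.\<close>

definition initial_square :: "('o, 'a, 'c, 'm) two_cat_scheme \<Rightarrow> 'a \<Rightarrow> 'a \<Rightarrow> 'a \<times> 'a \<Rightarrow> bool" where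
  "initial_square K p u s \<longleftrightarrow> comm_square K p u s \<and>
     (\<forall>s'. comm_square K p u s' \<longrightarrow> (\<exists>!\<gamma>. \<gamma> \<in> square_cells K p u s s'))"

lemma comm_square_iff [simp]:
  "comm_square K p u (g, f) \<longleftrightarrow> g \<in> Arr K \<and> dom1 K g = dom1 K p \<and> cod1 K g = dom1 K u \<and>
     f \<in> Arr K \<and> dom1 K f = cod1 K p \<and> cod1 K f = cod1 K u \<and> u \<cdot>\<^bsub>K\<^esub> g = f \<cdot>\<^bsub>K\<^esub> p"
  by (auto simp: comm_square_def)

lemma mem_square_cells [simp]:
  "(a, b) \<in> square_cells K p u (g, f) (g', f') \<longleftrightarrow>
    a \<in> Cell K \<and> dom2 K a = g \<and> cod2 K a = g' \<and> b \<in> Cell K \<and> dom2 K b = f \<and> cod2 K b = f' \<and>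
    u \<rhd>\<^bsub>K\<^esub> a = b \<lhd>\<^bsub>K\<^esub> p"
  by (simp add: square_cells_def)

context two_category
begin

text \<open>Initiality is used up to isomorphism, both of the square that is initial and of the squares it is
  compared with.\<close>

lemma ex1_square_cells_iso:
  assumes u: "u \<in> Arr K" and p: "p \<in> Arr K" and r: "comm_square K p u r" and t: "comm_square K p u t"
    and ab: "(a, b) \<in> square_cells K p u r t" and iso: "iso2 K a" "iso2 K b"
  shows "comm_square K p u s \<Longrightarrow> \<exists>!\<gamma>. \<gamma> \<in> square_cells K p u s r \<Longrightarrow> \<exists>!\<gamma>. \<gamma> \<in> square_cells K p u s t"
    and "\<exists>!\<gamma>. \<gamma> \<in> square_cells K p u r s \<Longrightarrow> comm_square K p u s \<Longrightarrow> \<exists>!\<gamma>. \<gamma> \<in> square_cells K p u t s"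
proof -
  obtain r1 r2 t1 t2 where rt: "r = (r1, r2)" "t = (t1, t2)" by (cases r; cases t)
  have ab' [simp]: "a \<in> Cell K" "dom2 K a = r1" "cod2 K a = t1" "b \<in> Cell K" "dom2 K b = r2" "cod2 K b = t2"
    and uab: "u \<rhd> a = b \<lhd> p" using ab unfolding rt by simp_all
  have [simp]: "r1 \<in> Arr K" "r2 \<in> Arr K" "dom1 K r1 = dom1 K p" "cod1 K r1 = dom1 K u" "dom1 K r2 = cod1 K p" "cod1 K r2 = cod1 K u"
     and ur: "u \<cdot> r1 = r2 \<cdot> p"
    using r unfolding rt by simp_all
  have [simp]: "t1 \<in> Arr K" "t2 \<in> Arr K" "dom1 K t1 = dom1 K p" "cod1 K t1 = dom1 K u" "dom1 K t2 = cod1 K p" "cod1 K t2 = cod1 K u"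
     and ut: "u \<cdot> t1 = t2 \<cdot> p"
    using t unfolding rt by simp_all
  obtain a' where a' [simp]: "a' \<in> Cell K" "dom2 K a' = t1" "cod2 K a' = r1" 
    and aa: "a' \<bullet> a = Id2 K r1" "a \<bullet> a' = Id2 K t1"
    using iso(1) by (rule iso2E) simp
  obtain b' where b' [simp]: "b' \<in> Cell K" "dom2 K b' = t2" "cod2 K b' = r2" 
    and bb: "b' \<bullet> b = Id2 K r2" "b \<bullet> b' = Id2 K t2"
    using iso(2) by (rule iso2E) simp
  note [simp] = u p ur ut uab
  have 1: "(b' \<lhd> p) \<bullet> (b \<lhd> p) = Id2 K (r2 \<cdot> p)" using bb(1) by (simp flip: whiskR_vcomp)
  have 2: "(u \<rhd> a) \<bullet> (u \<rhd> a') = Id2 K (t2 \<cdot> p)" using aa(2) by (simp flip: whiskL_vcomp del: uab)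
  have "u \<rhd> a' = ((b' \<lhd> p) \<bullet> (b \<lhd> p)) \<bullet> (u \<rhd> a')" unfolding 1 by simp
  also have "\<dots> = (b' \<lhd> p) \<bullet> ((u \<rhd> a) \<bullet> (u \<rhd> a'))" by simp
  also have "\<dots> = b' \<lhd> p" unfolding 2 by simp
  finally have uab' [simp]: "u \<rhd> a' = b' \<lhd> p" .
  have aat: "a' \<bullet> a \<bullet> x = x" if "x \<in> Cell K" "cod2 K x = r1" for x
    using vcomp_cong_tail[OF aa(1), of x] that by simp
  have aat': "a \<bullet> a' \<bullet> x = x" if "x \<in> Cell K" "cod2 K x = t1" for x
    using vcomp_cong_tail[OF aa(2), of x] that by simp
  have bbt: "b' \<bullet> b \<bullet> x = x" if "x \<in> Cell K" "cod2 K x = r2" for x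
    using vcomp_cong_tail[OF bb(1), of x] that by simp
  have bbt': "b \<bullet> b' \<bullet> x = x" if "x \<in> Cell K" "cod2 K x = t2" for x
    using vcomp_cong_tail[OF bb(2), of x] that by simp
  {
    assume s: "comm_square K p u s" and ex: "\<exists>!\<gamma>. \<gamma> \<in> square_cells K p u s r"
    obtain s1 s2 where ss: "s = (s1, s2)" by (cases s)
    have [simp]: "s1 \<in> Arr K" "s2 \<in> Arr K" "dom1 K s1 = dom1 K p" "cod1 K s1 = dom1 K u" "dom1 K s2 = cod1 K p" "cod1 K s2 = cod1 K u"
     "u \<cdot> s1 = s2 \<cdot> p" using s unfolding ss by simp_all
    obtain c1 c2 where c: "(c1, c2) \<in> square_cells K p u s r" using ex by (metis surj_pair)
    have 3: "(a' \<bullet> d1, b' \<bullet> d2) \<in> square_cells K p u s r" if "(d1, d2) \<in> square_cells K p u s t" for d1 d2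
      using that unfolding ss rt by simp
    have 4: "(a \<bullet> c1, b \<bullet> c2) \<in> square_cells K p u s t"
      using c unfolding ss rt by simp
    have 5: "d1 = a \<bullet> c1 \<and> d2 = b \<bullet> c2" if d: "(d1, d2) \<in> square_cells K p u s t" for d1 d2
    proof -
      have "(a' \<bullet> d1, b' \<bullet> d2) = (c1, c2)" using ex c 3[OF d] by blast
      then have "a' \<bullet> d1 = c1" "b' \<bullet> d2 = c2" by (simp_all only: prod.inject)
      then show ?thesis using d unfolding ss rt by (auto simp: aat' bbt')
    qed
    show "\<exists>!\<gamma>. \<gamma> \<in> square_cells K p u s t"
      by (rule ex1I, rule 4, metis 5 surj_pair)
  next
    assume s: "comm_square K p u s" and ex: "\<exists>!\<gamma>. \<gamma> \<in> square_cells K p u r s"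
    obtain s1 s2 where ss: "s = (s1, s2)" by (cases s)
    have [simp]: "s1 \<in> Arr K" "s2 \<in> Arr K" "dom1 K s1 = dom1 K p" "cod1 K s1 = dom1 K u" "dom1 K s2 = cod1 K p" "cod1 K s2 = cod1 K u"
     "u \<cdot> s1 = s2 \<cdot> p" using s unfolding ss by simp_all
    obtain c1 c2 where c: "(c1, c2) \<in> square_cells K p u r s" using ex by (metis surj_pair)
    have 3: "(d1 \<bullet> a, d2 \<bullet> b) \<in> square_cells K p u r s" if "(d1, d2) \<in> square_cells K p u t s" for d1 d2
      using that unfolding ss rt by simp
    have 4: "(c1 \<bullet> a', c2 \<bullet> b') \<in> square_cells K p u t s"
      using c unfolding ss rt by simp
    have 5: "d1 = c1 \<bullet> a' \<and> d2 = c2 \<bullet> b'" if d: "(d1, d2) \<in> square_cells K p u t s" for d1 d2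
    proof -
      have "(c1, c2) = (d1 \<bullet> a, d2 \<bullet> b)" using ex c 3[OF d] by blast
      then have "c1 = d1 \<bullet> a" "c2 = d2 \<bullet> b" by (simp_all only: prod.inject)
      then show ?thesis using d unfolding ss rt by (auto simp: aa bb)
    qed
    show "\<exists>!\<gamma>. \<gamma> \<in> square_cells K p u t s"
      by (rule ex1I, rule 4, metis 5 surj_pair)
  }
qed

end

context enhanced_two_classifier
begin

lemma u_opf: "tight_discrete_opfibration K u"
  by (rule small_opfib[OF u_small])

lemma u_arr [simp]: "u \<in> Arr K"
  by (rule opf_arr[OF u_opf])

lemma small_arr: "p \<in> Small K \<Longrightarrow> p \<in> Arr K"
  by (rule opf_arr[OF small_opfib])

text \<open>For the target \<open>u\<close>, the axioms speak of squares of the form \<open>(dt u \<cdot> g, d u \<cdot> f)\<close>. As \<open>(dt u, d u)\<close>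
  is isomorphic to the identity square, these are isomorphic to \<open>(g, f)\<close>.\<close>

lemma small_initial:
  assumes p: "p \<in> Small K"
  shows "initial_square K p u (dt p, d p)"
  unfolding initial_square_def
proof (intro conjI allI impI)
  note [simp] = small_arr[OF p] small_arr
  show c: "comm_square K p u (dt p, d p)" using classify[OF p] by simp
  fix s' assume s': "comm_square K p u s'"
  obtain g f where s: "s' = (g, f)" by (cases s')
  have gf [simp]: "g \<in> Arr K" "f \<in> Arr K" "dom1 K g = dom1 K p" "cod1 K g = dom1 K u" "dom1 K f = cod1 K p" "cod1 K f = cod1 K u"
     "u \<cdot> g = f \<cdot> p" using s' unfolding s by simp_all
  have du [simp]: "dt u \<in> Arr K" "dom1 K (dt u) = dom1 K u" "cod1 K (dt u) = dom1 K u"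
    "d u \<in> Arr K" "dom1 K (d u) = cod1 K u" "cod1 K (d u) = cod1 K u" "u \<cdot> dt u = d u \<cdot> u"
    using classify[OF u_small] by simp_all
  obtain a b where ab: "(a, b) \<in> square_cells K u u (dt u, d u) (Id1 K (dom1 K u), Id1 K (cod1 K u))"
     and iso: "iso2 K a" "iso2 K b" using classify_u by blast
  have ab' [simp]: "a \<in> Cell K" "dom2 K a = dt u" "cod2 K a = Id1 K (dom1 K u)"
    "b \<in> Cell K" "dom2 K b = d u" "cod2 K b = Id1 K (cod1 K u)" "u \<rhd> a = b \<lhd> u"
    using ab by simp_all
  have t: "u \<cdot> dt u \<cdot> g = d u \<cdot> f \<cdot> p"
    using comp1_rewrite_tail[OF du(7), of g] by simp
  show "\<exists>!\<gamma>. \<gamma> \<in> square_cells K p u (dt p, d p) s'"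
  proof (rule ex1_square_cells_iso(1)[of u p "(dt u \<cdot> g, d u \<cdot> f)" s' "a \<lhd> g" "b \<lhd> f"])
    show "comm_square K p u (dt u \<cdot> g, d u \<cdot> f)" by (simp add: t)
    show "(a \<lhd> g, b \<lhd> f) \<in> square_cells K p u (dt u \<cdot> g, d u \<cdot> f) s'" unfolding s by simp
    show "iso2 K (a \<lhd> g)" "iso2 K (b \<lhd> f)" using iso by (auto intro!: iso2_whiskR)
    show "\<exists>!\<gamma>. \<gamma> \<in> square_cells K p u (dt p, d p) (dt u \<cdot> g, d u \<cdot> f)"
      by (rule classify_cells[OF p u_small]) simp
  qed (use p c s' in simp_all)
qed

text \<open>By the axiom on pullback squares, such a square is isomorphic to the classifying square of \<open>p\<close>, so it
  inherits initiality.\<close>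

lemma small_pullback_initial:
  assumes p: "p \<in> Small K" and pbk: "pullback K u f p q"
  shows "initial_square K p u (q, f)"
  unfolding initial_square_def
proof (intro conjI allI impI)
  note [simp] = small_arr[OF p]
  have gf [simp]: "q \<in> Arr K" "f \<in> Arr K" "dom1 K q = dom1 K p" "cod1 K q = dom1 K u" "dom1 K f = cod1 K p" "cod1 K f = cod1 K u"
     "u \<cdot> q = f \<cdot> p" using pullback_typing[OF pbk] by simp_all
  show c: "comm_square K p u (q, f)" by simp
  have c0: "comm_square K p u (dt p, d p)" using classify[OF p] by simp
  have du [simp]: "dt u \<in> Arr K" "dom1 K (dt u) = dom1 K u" "cod1 K (dt u) = dom1 K u"
    "d u \<in> Arr K" "dom1 K (d u) = cod1 K u" "cod1 K (d u) = cod1 K u" "u \<cdot> dt u = d u \<cdot> u"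
    using classify[OF u_small] by simp_all
  have dp [simp]: "dt p \<in> Arr K" "dom1 K (dt p) = dom1 K p" "cod1 K (dt p) = dom1 K u"
    "d p \<in> Arr K" "dom1 K (d p) = cod1 K p" "cod1 K (d p) = cod1 K u" "u \<cdot> dt p = d p \<cdot> p"
    using classify[OF p] by simp_all
  obtain a b where ab: "(a, b) \<in> square_cells K u u (dt u, d u) (Id1 K (dom1 K u), Id1 K (cod1 K u))"
     and iso: "iso2 K a" "iso2 K b" using classify_u by blast
  have ab' [simp]: "a \<in> Cell K" "dom2 K a = dt u" "cod2 K a = Id1 K (dom1 K u)"
    "b \<in> Cell K" "dom2 K b = d u" "cod2 K b = Id1 K (cod1 K u)" "u \<rhd> a = b \<lhd> u"
    using ab by simp_all
  obtain x y where xy: "(x, y) \<in> square_cells K p u (dt p, d p) (dt u \<cdot> q, d u \<cdot> f)"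
    using classify_cells[OF p u_small, of q f] c by (metis surj_pair)
  then have xy' [simp]: "x \<in> Cell K" "dom2 K x = dt p" "cod2 K x = dt u \<cdot> q"
    "y \<in> Cell K" "dom2 K y = d p" "cod2 K y = d u \<cdot> f" "u \<rhd> x = y \<lhd> p" by simp_all
  have i: "iso2 K x" "iso2 K y"
    using classify_iso[OF p u_small _ pbk xy] c by simp_all
  fix s' assume s': "comm_square K p u s'"
  have t: "(((a \<lhd> q) \<bullet> x), ((b \<lhd> f) \<bullet> y)) \<in> square_cells K p u (dt p, d p) (q, f)" by simp
  have i': "iso2 K ((a \<lhd> q) \<bullet> x)" "iso2 K ((b \<lhd> f) \<bullet> y)" 
    using iso i by (auto intro!: iso2_vcomp iso2_whiskR)
  show "\<exists>!\<gamma>. \<gamma> \<in> square_cells K p u (q, f) s'"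
  proof (rule ex1_square_cells_iso(2)[OF _ _ c0 c t i' _ s'])
    show "\<exists>!\<gamma>. \<gamma> \<in> square_cells K p u (dt p, d p) s'"
      using small_initial[OF p] s' unfolding initial_square_def by blast
  qed simp_all
qed

text \<open>Smallness is closed under the chosen pullbacks only, and \<open>p\<close> is merely isomorphic to one of them, say
  \<open>p0\<close>. Precomposing with the isomorphism identifies the squares from \<open>p\<close> with the squares from \<open>p0\<close>.\<close>

lemma pullback_initial:
  assumes pbk: "pullback K u f p q"
  shows "initial_square K p u (q, f)"
  unfolding initial_square_def
proof (intro conjI allI impI)
  have gf [simp]: "p \<in> Arr K" "q \<in> Arr K" "f \<in> Arr K" "dom1 K q = dom1 K p" "cod1 K q = dom1 K u" "dom1 K f = cod1 K p" "cod1 K f = cod1 K u"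
     "u \<cdot> q = f \<cdot> p" using pullback_typing[OF pbk] by simp_all
  show c: "comm_square K p u (q, f)" by simp
  define p0 where "p0 = pb K u f"
  define q0 where "q0 = pbtop K u f"
  have p0: "p0 \<in> Small K" unfolding p0_def by (rule pb_small[OF u_small]) simp_all
  have "left_tight_pullback K u f p0 q0" unfolding p0_def q0_def by (rule pb_pullback[OF u_small]) simp_all
  then have pbk0: "pullback K u f p0 q0" by (rule left_tight_pullbackD)
  have gf0 [simp]: "p0 \<in> Arr K" "q0 \<in> Arr K" "dom1 K q0 = dom1 K p0" "cod1 K q0 = dom1 K u" "cod1 K p0 = cod1 K p"
     "u \<cdot> q0 = f \<cdot> p0" using pullback_typing[OF pbk0] by simp_all
  obtain j where j [simp]: "j \<in> Arr K" "dom1 K j = dom1 K p" "cod1 K j = dom1 K p0" "p0 \<cdot> j = p" "q0 \<cdot> j = q"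
    by (rule pullback_arr[OF pbk0, of p q]) simp_all
  obtain k where k [simp]: "k \<in> Arr K" "dom1 K k = dom1 K p0" "cod1 K k = dom1 K p" "p \<cdot> k = p0" "q \<cdot> k = q0"
    by (rule pullback_arr[OF pbk, of p0 q0]) simp_all
  have pjt: "p0 \<cdot> j \<cdot> x = p \<cdot> x" "q0 \<cdot> j \<cdot> x = q \<cdot> x" if "x \<in> Arr K" "cod1 K x = dom1 K p" for x
    using comp1_rewrite_tail[OF j(4), of x] comp1_rewrite_tail[OF j(5), of x] that by simp_all
  have pkt: "p \<cdot> k \<cdot> x = p0 \<cdot> x" "q \<cdot> k \<cdot> x = q0 \<cdot> x" if "x \<in> Arr K" "cod1 K x = dom1 K p0" for x
    using comp1_rewrite_tail[OF k(4), of x] comp1_rewrite_tail[OF k(5), of x] that by simp_all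
  have jk: "j \<cdot> k = Id1 K (dom1 K p0)"
    by (rule pullback_arr_eqI[OF pbk0]) (simp_all add: pjt)
  have kj: "k \<cdot> j = Id1 K (dom1 K p)"
    by (rule pullback_arr_eqI[OF pbk]) (simp_all add: pkt)
  fix s' assume s': "comm_square K p u s'"
  obtain g h where s: "s' = (g, h)" by (cases s')
  have gh [simp]: "g \<in> Arr K" "h \<in> Arr K" "dom1 K g = dom1 K p" "cod1 K g = dom1 K u" "dom1 K h = cod1 K p" "cod1 K h = cod1 K u"
     and ug: "u \<cdot> g = h \<cdot> p" using s' unfolding s by simp_all
  have "u \<cdot> g \<cdot> k = h \<cdot> p0" using comp1_rewrite_tail[OF ug, of k] by simp
  then have "comm_square K p0 u (g \<cdot> k, h)" by simp
  then have ex: "\<exists>!\<gamma>. \<gamma> \<in> square_cells K p0 u (q0, f) (g \<cdot> k, h)"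
    using small_pullback_initial[OF p0 pbk0] unfolding initial_square_def by blast
  have 1: "(a \<lhd> k, b) \<in> square_cells K p0 u (q0, f) (g \<cdot> k, h)" if "(a, b) \<in> square_cells K p u (q, f) s'" for a b
    using that unfolding s by simp
  have 2: "(a \<lhd> j, b) \<in> square_cells K p u (q, f) s'" if "(a, b) \<in> square_cells K p0 u (q0, f) (g \<cdot> k, h)" for a b
    using that unfolding s by (simp add: kj)
  have 3: "(a \<lhd> k) \<lhd> j = a" if "(a, b) \<in> square_cells K p u (q, f) s'" for a b
    using that unfolding s by (simp add: kj)
  show "\<exists>!\<gamma>. \<gamma> \<in> square_cells K p u (q, f) s'"
  proof -
    \<comment> \<open>Whiskering with \<open>k\<close> and with \<open>j\<close> are mutually inverse, so the unique pair for \<open>p0\<close> gives one for \<open>p\<close>.\<close>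
    obtain a b where ab: "(a, b) \<in> square_cells K p0 u (q0, f) (g \<cdot> k, h)" using ex by (metis surj_pair)
    have 4: "(a', b') = (a \<lhd> j, b)" if "(a', b') \<in> square_cells K p u (q, f) s'" for a' b'
    proof -
      have "(a' \<lhd> k, b') = (a, b)" using ex ab 1[OF that] by blast
      then have "a' \<lhd> k = a" "b' = b" by (simp_all only: prod.inject)
      then show ?thesis using 3[OF that] by (simp only:)
    qed
    show ?thesis by (rule ex1I, rule 2[OF ab], metis 4 surj_pair)
  qed
qed

text \<open>How initiality is applied: the two equations of a pair are proved together, from the compatibility of
  both sides with \<open>u\<close>.\<close>

lemma pullback_cells_eqI:
  assumes pbk: "pullback K u f p q"
    and "a \<in> Cell K" "b \<in> Cell K" "dom2 K a = q" "dom2 K b = f" "u \<rhd> a = b \<lhd> p"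
    and "a' \<in> Cell K" "b' \<in> Cell K" "dom2 K a' = q" "dom2 K b' = f" "u \<rhd> a' = b' \<lhd> p"
    and cod: "cod2 K a' = cod2 K a" "cod2 K b' = cod2 K b"
  shows "a = a' \<and> b = b'"
proof -
  have gf [simp]: "p \<in> Arr K" "q \<in> Arr K" "f \<in> Arr K" "dom1 K q = dom1 K p" "cod1 K q = dom1 K u" "dom1 K f = cod1 K p" "cod1 K f = cod1 K u"
    using pullback_typing[OF pbk] by simp_all
  note [simp] = assms(2-5)
  have "u \<cdot> cod2 K a = cod2 K b \<cdot> p"
    using arg_cong[OF assms(6), of "cod2 K"] by simp
  then have "comm_square K p u (cod2 K a, cod2 K b)" by simp
  then have "\<exists>!\<gamma>. \<gamma> \<in> square_cells K p u (q, f) (cod2 K a, cod2 K b)"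
    using pullback_initial[OF pbk] unfolding initial_square_def by blast
  moreover have "(a, b) \<in> square_cells K p u (q, f) (cod2 K a, cod2 K b)"
    "(a', b') \<in> square_cells K p u (q, f) (cod2 K a, cod2 K b)" using assms by simp_all
  ultimately have "(a, b) = (a', b')" by blast
  then show ?thesis by (simp only: prod.inject)
qed

text \<open>As \<open>u\<close> is small, its chosen pullback along an identity is \<open>u\<close> itself.\<close>

lemma left_tight_pullback_u_id: "left_tight_pullback K u (Id1 K (cod1 K u)) u (Id1 K (dom1 K u))"
  using pb_pullback[OF u_small, of "Id1 K (cod1 K u)"] pb_id1[OF u_small] by simp

lemmas pullback_u_id = left_tight_pullbackD(1)[OF left_tight_pullback_u_id]

lemma u_detects_tight:
  assumes "h \<in> Arr K" "cod1 K h = dom1 K u" "u \<cdot> h \<in> Tight K"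
  shows "h \<in> Tight K"
  by (rule left_tight_pullbackD(4)[OF left_tight_pullback_u_id]) (use assms in simp_all)

end

section \<open>The canonical algebras and the classifier of lax algebras\<close>

locale opfibrantly_cartesian_plumbus =
  representable_plumbus K u dt d + opfibrantly_cartesian K T u d
  for K :: "('o, 'a, 'c, 'm) plumbus_data_scheme" (structure)
    and T :: "('o, 'a, 'c) monad_data"
    and u :: 'a and dt :: "'a \<Rightarrow> 'a" and d :: "'a \<Rightarrow> 'a"
begin

sublocale plumbus_monad K T by unfold_locales

abbreviation "\<omega> \<equiv> d (T1 T u)"
abbreviation "\<omega>t \<equiv> dt (T1 T u)"
abbreviation "\<Omega> \<equiv> cod1 K u"
abbreviation "\<Omega>t \<equiv> dom1 K u"

lemma omega_pullback: "pullback K u \<omega> (T1 T u) \<omega>t"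
  using classify[OF T_u_small] by simp

lemma omega_typing [simp]:
  "\<omega> \<in> Arr K" "dom1 K \<omega> = T0 T \<Omega>" "cod1 K \<omega> = \<Omega>"
  "\<omega>t \<in> Arr K" "dom1 K \<omega>t = T0 T \<Omega>t" "cod1 K \<omega>t = \<Omega>t" "u \<cdot> \<omega>t = \<omega> \<cdot> T1 T u"
  using classify[OF T_u_small] by simp_all

lemma omega_tail [simp]:
  "x \<in> Arr K \<Longrightarrow> cod1 K x = T0 T \<Omega>t \<Longrightarrow> u \<cdot> \<omega>t \<cdot> x = \<omega> \<cdot> T1 T u \<cdot> x"
  using comp1_rewrite_tail[OF omega_typing(7), of x] by simp

lemma T_omega [simp]: "T1 T u \<cdot> T1 T \<omega>t = T1 T \<omega> \<cdot> T1 T (T1 T u)"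
  using arg_cong[OF omega_typing(7), of "T1 T"] by (simp del: omega_typing(7))

lemma TT_omega [simp]: "T1 T (T1 T u) \<cdot> T1 T (T1 T \<omega>t) = T1 T (T1 T \<omega>) \<cdot> T1 T (T1 T (T1 T u))"
  using arg_cong[OF T_omega, of "T1 T"] by (simp del: T_omega)

lemma omega_tight: "\<omega> \<in> Tight K" "\<omega>t \<in> Tight K"
proof -
  show 1: "\<omega> \<in> Tight K" using T_u_perfect by (simp add: perfect_def)
  have 2: "u \<cdot> \<omega>t \<in> Tight K"
    unfolding omega_typing(7) using 1 opf_tight[OF u_opf] by (intro tight_comp1 T1_tight) simp_all
  show "\<omega>t \<in> Tight K" by (rule u_detects_tight[OF _ _ 2]) simp_all
qed

text \<open>The algebra laws apply \<open>T\<close> to structure cells; this evaluates \<open>u\<close> on the resulting cells.\<close>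

lemma omega_T_cells:
  assumes "a \<in> Cell K" "b \<in> Cell K" "p \<in> Arr K" "cod1 K (dom2 K a) = \<Omega>t" "cod1 K (dom2 K b) = \<Omega>"
    "cod1 K p = dom1 K (dom2 K b)" and e: "u \<rhd> a = b \<lhd> p"
  shows "(\<omega> \<cdot> T1 T u) \<rhd> T2 T a = (\<omega> \<rhd> T2 T b) \<lhd> T1 T p"
  using arg_cong[OF e, of "\<lambda>z. \<omega> \<rhd> T2 T z"] assms(1-6) by simp

text \<open>Applied to the classifying square of \<open>T u\<close>, and then to the result, this yields the pullback squares
  from \<open>T (T u)\<close> and \<open>T (T (T u))\<close> at which the cells in the algebra laws start.\<close>

lemma pullback_T_step:
  assumes "pullback K u f p q"
  shows "pullback K u (\<omega> \<cdot> T1 T f) (T1 T p) (\<omega>t \<cdot> T1 T q)"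
  by (rule pullback_paste[OF omega_pullback T_pullback_u[OF assms]])

abbreviation "base_alg \<equiv> canonical_base K T u dt d"
abbreviation "top_alg \<equiv> canonical_top K T u dt d"
abbreviation "U \<equiv> canonical_u K T u dt d"

lemma canonical_cells:
  shows "(unitor top_alg, unitor base_alg) \<in> square_cells K u u (Id1 K \<Omega>t, Id1 K \<Omega>) (\<omega>t \<cdot> unt T \<Omega>t, \<omega> \<cdot> unt T \<Omega>)"
    and "(multor top_alg, multor base_alg) \<in> square_cells K (T1 T (T1 T u)) u
        (\<omega>t \<cdot> T1 T \<omega>t, \<omega> \<cdot> T1 T \<omega>) (\<omega>t \<cdot> mul T \<Omega>t, \<omega> \<cdot> mul T \<Omega>)"
proof -
  let ?s = "\<lambda>\<gamma>. \<gamma> \<in> square_cells K u u (Id1 K \<Omega>t, Id1 K \<Omega>) (\<omega>t \<cdot> unt T \<Omega>t, \<omega> \<cdot> unt T \<Omega>)"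
  have c: "comm_square K u u (\<omega>t \<cdot> unt T \<Omega>t, \<omega> \<cdot> unt T \<Omega>)" by simp
  have "\<exists>!\<gamma>. ?s \<gamma>"
    using pullback_initial[OF pullback_u_id] c unfolding initial_square_def by blast
  then have "?s (canonical_unitors K T u dt d)"
    unfolding canonical_unitors_def Let_def by (rule theI')
  then show "(unitor top_alg, unitor base_alg) \<in> square_cells K u u (Id1 K \<Omega>t, Id1 K \<Omega>) (\<omega>t \<cdot> unt T \<Omega>t, \<omega> \<cdot> unt T \<Omega>)"
    unfolding canonical_top_def canonical_base_def lalg.sel prod.collapse .
  let ?s = "\<lambda>\<gamma>. \<gamma> \<in> square_cells K (T1 T (T1 T u)) u
        (\<omega>t \<cdot> T1 T \<omega>t, \<omega> \<cdot> T1 T \<omega>) (\<omega>t \<cdot> mul T \<Omega>t, \<omega> \<cdot> mul T \<Omega>)"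
  have c: "comm_square K (T1 T (T1 T u)) u (\<omega>t \<cdot> mul T \<Omega>t, \<omega> \<cdot> mul T \<Omega>)" by simp
  have "\<exists>!\<gamma>. ?s \<gamma>"
    using pullback_initial[OF pullback_T_step[OF omega_pullback]] c unfolding initial_square_def by blast
  then have "?s (canonical_multors K T u dt d)"
    unfolding canonical_multors_def Let_def by (rule theI')
  then show "(multor top_alg, multor base_alg) \<in> square_cells K (T1 T (T1 T u)) u
        (\<omega>t \<cdot> T1 T \<omega>t, \<omega> \<cdot> T1 T \<omega>) (\<omega>t \<cdot> mul T \<Omega>t, \<omega> \<cdot> mul T \<Omega>)"
    unfolding canonical_top_def canonical_base_def lalg.sel prod.collapse .
qed

lemma canonical_sel [simp]:
  "carr top_alg = \<Omega>t" "act top_alg = \<omega>t" "carr base_alg = \<Omega>" "act base_alg = \<omega>"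
  "ldom U = top_alg" "lcod U = base_alg" "und1 U = u" "str2 U = Id2 K (\<omega> \<cdot> T1 T u)"
  by (simp_all add: canonical_top_def canonical_base_def canonical_u_def)

lemma canonical_unitor [simp]:
  "unitor top_alg \<in> Cell K" "dom2 K (unitor top_alg) = Id1 K \<Omega>t" "cod2 K (unitor top_alg) = \<omega>t \<cdot> unt T \<Omega>t"
  "unitor base_alg \<in> Cell K" "dom2 K (unitor base_alg) = Id1 K \<Omega>" "cod2 K (unitor base_alg) = \<omega> \<cdot> unt T \<Omega>"
  "u \<rhd> unitor top_alg = unitor base_alg \<lhd> u"
  using canonical_cells(1) unfolding mem_square_cells by blast+

lemma canonical_multor [simp]:
  "multor top_alg \<in> Cell K" "dom2 K (multor top_alg) = \<omega>t \<cdot> T1 T \<omega>t" "cod2 K (multor top_alg) = \<omega>t \<cdot> mul T \<Omega>t"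
  "multor base_alg \<in> Cell K" "dom2 K (multor base_alg) = \<omega> \<cdot> T1 T \<omega>" "cod2 K (multor base_alg) = \<omega> \<cdot> mul T \<Omega>"
  "u \<rhd> multor top_alg = multor base_alg \<lhd> T1 T (T1 T u)"
  using canonical_cells(2) unfolding mem_square_cells by blast+

text \<open>Each law is an equation between 2-cells whose source is the lower side of a pullback square, paired
  with the same law for the algebra on the domain of \<open>u\<close>.\<close>

lemma canonical_base_lax [simp]: "lax_algebra K T base_alg"
proof -
  let ?y = "unitor base_alg" and ?yt = "unitor top_alg" and ?m = "multor base_alg" and ?mt = "multor top_alg"
  have y: "(\<omega> \<cdot> T1 T u) \<rhd> T2 T ?yt = (\<omega> \<rhd> T2 T ?y) \<lhd> T1 T u"
    by (rule omega_T_cells) simp_all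
  have m: "(\<omega> \<cdot> T1 T u) \<rhd> T2 T ?mt = (\<omega> \<rhd> T2 T ?m) \<lhd> T1 T (T1 T (T1 T u))"
    by (rule omega_T_cells) simp_all
  have 1: "(?mt \<lhd> unt T (T0 T \<Omega>t)) \<bullet> (?yt \<lhd> \<omega>t) = Id2 K \<omega>t \<and>
    (?m \<lhd> unt T (T0 T \<Omega>)) \<bullet> (?y \<lhd> \<omega>) = Id2 K \<omega>"
    by (rule pullback_cells_eqI[OF omega_pullback]) simp_all
  have 2: "(?mt \<lhd> T1 T (unt T \<Omega>t)) \<bullet> (\<omega>t \<rhd> T2 T ?yt) = Id2 K \<omega>t \<and>
    (?m \<lhd> T1 T (unt T \<Omega>)) \<bullet> (\<omega> \<rhd> T2 T ?y) = Id2 K \<omega>"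
    by (rule pullback_cells_eqI[OF omega_pullback]) (simp_all add: y)
  have 3: "(?mt \<lhd> mul T (T0 T \<Omega>t)) \<bullet> (?mt \<lhd> T1 T (T1 T \<omega>t))
      = (?mt \<lhd> T1 T (mul T \<Omega>t)) \<bullet> (\<omega>t \<rhd> T2 T ?mt) \<and>
    (?m \<lhd> mul T (T0 T \<Omega>)) \<bullet> (?m \<lhd> T1 T (T1 T \<omega>))
      = (?m \<lhd> T1 T (mul T \<Omega>)) \<bullet> (\<omega> \<rhd> T2 T ?m)"
    by (rule pullback_cells_eqI[OF pullback_T_step[OF pullback_T_step[OF omega_pullback]]]) (simp_all add: m)
  have "lax_algebra K T (LAlg \<Omega> \<omega> ?y ?m)"
    by (rule lax_algebraI) (simp_all add: omega_tight 1 2 3)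
  also have "LAlg \<Omega> \<omega> ?y ?m = base_alg" by (rule lalg.expand) simp
  finally show ?thesis .
qed

text \<open>The structure on the domain of \<open>u\<close> lies over that on the codomain, so its laws are reflected.\<close>

lemma canonical_top_lax [simp]: "lax_algebra K T top_alg"
  and canonical_u_strict [simp]: "strict_morphism K T U"
proof -
  have *: "LAlg \<Omega>t \<omega>t (unitor top_alg) (multor top_alg) = top_alg" by (rule lalg.expand) simp
  have "lax_algebra K T (LAlg \<Omega>t \<omega>t (unitor top_alg) (multor top_alg))"
    by (rule lax_algebra_reflect(1)[OF u_opf, of base_alg]) (simp_all add: omega_tight)
  then show "lax_algebra K T top_alg" by (simp only: *)
  have "strict_morphism K T (LMor (LAlg \<Omega>t \<omega>t (unitor top_alg) (multor top_alg)) base_alg u (Id2 K (act base_alg \<cdot> T1 T u)))"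
    by (rule lax_algebra_reflect(2)[OF u_opf, of base_alg]) (simp_all add: omega_tight)
  also have "LMor (LAlg \<Omega>t \<omega>t (unitor top_alg) (multor top_alg)) base_alg u (Id2 K (act base_alg \<cdot> T1 T u)) = U"
    unfolding * by (rule lmor.expand) simp
  finally show "strict_morphism K T U" .
qed

lemma canonical_u_small [simp]: "small_strict K T U"
  by (simp add: small_strict_def u_small)

lemma classifying_pullback: "p \<in> Small K \<Longrightarrow> pullback K u (d p) p (dt p)"
  using classify by blast

lemma classifying_typing [simp]:
  assumes "p \<in> Small K"
  shows "d p \<in> Arr K" "dom1 K (d p) = cod1 K p" "cod1 K (d p) = \<Omega>"
    "dt p \<in> Arr K" "dom1 K (dt p) = dom1 K p" "cod1 K (dt p) = \<Omega>t" "u \<cdot> dt p = d p \<cdot> p"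
  using classify[OF assms] by simp_all

text \<open>The pair of structure cells for the classifying maps of \<open>P\<close>: it starts at an initial square, so there
  is exactly one pair with the right codomains.\<close>

definition classifying_structure :: "('o, 'a, 'c) lmor \<Rightarrow> 'c \<times> 'c" where
  "classifying_structure P = (THE \<gamma>. \<gamma> \<in> square_cells K (T1 T (und1 P)) u
     (\<omega>t \<cdot> T1 T (dt (und1 P)), \<omega> \<cdot> T1 T (d (und1 P)))
     (dt (und1 P) \<cdot> act (ldom P), d (und1 P) \<cdot> act (lcod P)))"

definition classifying_top :: "('o, 'a, 'c) lmor \<Rightarrow> ('o, 'a, 'c) lmor" where
  "classifying_top P = LMor (ldom P) top_alg (dt (und1 P)) (fst (classifying_structure P))"

definition classifying_base :: "('o, 'a, 'c) lmor \<Rightarrow> ('o, 'a, 'c) lmor" where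
  "classifying_base P = LMor (lcod P) base_alg (d (und1 P)) (snd (classifying_structure P))"

lemma classifying_sel [simp]:
  "ldom (classifying_top P) = ldom P" "lcod (classifying_top P) = top_alg" "und1 (classifying_top P) = dt (und1 P)"
  "ldom (classifying_base P) = lcod P" "lcod (classifying_base P) = base_alg" "und1 (classifying_base P) = d (und1 P)"
  by (simp_all add: classifying_top_def classifying_base_def)

context
  fixes P assumes P [simp]: "small_strict K T P"
begin

lemma classifying_square_T [simp]:
  "T1 T u \<cdot> T1 T (dt (und1 P)) = T1 T (d (und1 P)) \<cdot> T1 T (und1 P)"
  "T1 T (T1 T u) \<cdot> T1 T (T1 T (dt (und1 P))) = T1 T (T1 T (d (und1 P))) \<cdot> T1 T (T1 T (und1 P))"
proof -
  show 1: "T1 T u \<cdot> T1 T (dt (und1 P)) = T1 T (d (und1 P)) \<cdot> T1 T (und1 P)"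
    using arg_cong[OF classifying_typing(7)[OF small_strictD(2)[OF P]], of "T1 T"]
    by (simp del: classifying_typing(7))
  show "T1 T (T1 T u) \<cdot> T1 T (T1 T (dt (und1 P))) = T1 T (T1 T (d (und1 P))) \<cdot> T1 T (T1 T (und1 P))"
    using arg_cong[OF 1, of "T1 T"] by simp
qed

lemma classifying_square_tail [simp]:
  assumes "x \<in> Arr K" "cod1 K x = carr (ldom P)"
  shows "u \<cdot> dt (und1 P) \<cdot> x = d (und1 P) \<cdot> und1 P \<cdot> x"
  using comp1_rewrite_tail[OF classifying_typing(7)[of "und1 P"], of x] assms by simp

lemma classifying_structure_cells [simp]:
  "str2 (classifying_top P) \<in> Cell K" "dom2 K (str2 (classifying_top P)) = \<omega>t \<cdot> T1 T (dt (und1 P))"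
  "cod2 K (str2 (classifying_top P)) = dt (und1 P) \<cdot> act (ldom P)"
  "str2 (classifying_base P) \<in> Cell K" "dom2 K (str2 (classifying_base P)) = \<omega> \<cdot> T1 T (d (und1 P))"
  "cod2 K (str2 (classifying_base P)) = d (und1 P) \<cdot> act (lcod P)"
  "u \<rhd> str2 (classifying_top P) = str2 (classifying_base P) \<lhd> T1 T (und1 P)"
proof -
  let ?s = "\<lambda>\<gamma>. \<gamma> \<in> square_cells K (T1 T (und1 P)) u
     (\<omega>t \<cdot> T1 T (dt (und1 P)), \<omega> \<cdot> T1 T (d (und1 P)))
     (dt (und1 P) \<cdot> act (ldom P), d (und1 P) \<cdot> act (lcod P))"
  have c: "comm_square K (T1 T (und1 P)) u (dt (und1 P) \<cdot> act (ldom P), d (und1 P) \<cdot> act (lcod P))" by simp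
  have "\<exists>!\<gamma>. ?s \<gamma>"
    using pullback_initial[OF pullback_T_step[OF classifying_pullback, of "und1 P"]] c
    unfolding initial_square_def by (metis P small_strictD(2))
  then have "?s (classifying_structure P)"
    unfolding classifying_structure_def by (rule theI')
  then have "?s (str2 (classifying_top P), str2 (classifying_base P))"
    by (simp only: classifying_top_def classifying_base_def lmor.sel prod.collapse)
  then show "str2 (classifying_top P) \<in> Cell K" "dom2 K (str2 (classifying_top P)) = \<omega>t \<cdot> T1 T (dt (und1 P))"
  "cod2 K (str2 (classifying_top P)) = dt (und1 P) \<cdot> act (ldom P)"
  "str2 (classifying_base P) \<in> Cell K" "dom2 K (str2 (classifying_base P)) = \<omega> \<cdot> T1 T (d (und1 P))"
  "cod2 K (str2 (classifying_base P)) = d (und1 P) \<cdot> act (lcod P)"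
  "u \<rhd> str2 (classifying_top P) = str2 (classifying_base P) \<lhd> T1 T (und1 P)"
    unfolding mem_square_cells by blast+
qed

text \<open>The unit law is an equation between cells that start at the classifying square of \<open>und1 P\<close>, the
  multiplication law one between cells that start at its twofold \<open>T\<close>-step.\<close>

lemma classifying_base_lax [simp]: "lax_morphism K T (classifying_base P)"
proof -
  let ?p = "und1 P" and ?f = "d (und1 P)" and ?q = "dt (und1 P)"
  let ?s = "str2 (classifying_base P)" and ?st = "str2 (classifying_top P)" and ?E = "ldom P" and ?B = "lcod P"
  have pbk: "pullback K u ?f ?p ?q" by (rule classifying_pullback) simp
  have y: "(?f \<cdot> ?p) \<rhd> unitor ?E = (?f \<rhd> unitor ?B) \<lhd> ?p"
    using arg_cong[OF strict_unitor[of P ?E], of "\<lambda>z. ?f \<rhd> z"] by (simp del: strict_unitor)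
  have m: "(?f \<cdot> ?p) \<rhd> multor ?E = (?f \<rhd> multor ?B) \<lhd> T1 T (T1 T ?p)"
    using arg_cong[OF strict_multor[of P ?E], of "\<lambda>z. ?f \<rhd> z"] by (simp del: strict_multor)
  have s: "(\<omega> \<cdot> T1 T u) \<rhd> T2 T ?st = (\<omega> \<rhd> T2 T ?s) \<lhd> T1 T (T1 T ?p)"
    by (rule omega_T_cells) simp_all
  have 1: "?q \<rhd> unitor ?E = (?st \<lhd> unt T (carr ?E)) \<bullet> (unitor top_alg \<lhd> ?q) \<and>
    ?f \<rhd> unitor ?B = (?s \<lhd> unt T (carr ?B)) \<bullet> (unitor base_alg \<lhd> ?f)"
    by (rule pullback_cells_eqI[OF pbk]) (simp_all add: y)
  have 2: "(?q \<rhd> multor ?E) \<bullet> (?st \<lhd> T1 T (act ?E)) \<bullet> (\<omega>t \<rhd> T2 T ?st)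
        = (?st \<lhd> mul T (carr ?E)) \<bullet> (multor top_alg \<lhd> T1 T (T1 T ?q)) \<and>
    (?f \<rhd> multor ?B) \<bullet> (?s \<lhd> T1 T (act ?B)) \<bullet> (\<omega> \<rhd> T2 T ?s)
        = (?s \<lhd> mul T (carr ?B)) \<bullet> (multor base_alg \<lhd> T1 T (T1 T ?f))"
    by (rule pullback_cells_eqI[OF pullback_T_step[OF pullback_T_step[OF pbk]]]) (simp_all add: m s)
  have "lax_morphism K T (LMor ?B base_alg ?f ?s)"
    by (rule lax_morphismI) (simp_all add: 1 2)
  also have "LMor ?B base_alg ?f ?s = classifying_base P" by (rule lmor.expand) simp
  finally show ?thesis .
qed

text \<open>Composed with the canonical morphism over \<open>u\<close>, this is the lax morphism \<open>classifying_base P\<close>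
  precomposed with \<open>P\<close>, so the laws are reflected.\<close>

lemma classifying_top_lax [simp]: "lax_morphism K T (classifying_top P)"
proof -
  have *: "LMor (ldom P) (lcod U) (und1 U \<cdot> dt (und1 P)) (und1 U \<rhd> str2 (classifying_top P)) = lmor_comp K T (classifying_base P) P"
    by (rule lmor.expand) simp
  have "lax_morphism K T (LMor (ldom P) (ldom U) (dt (und1 P)) (str2 (classifying_top P)))"
    by (rule lax_morphism_reflect) (use * u_opf in simp_all)
  also have "LMor (ldom P) (ldom U) (dt (und1 P)) (str2 (classifying_top P)) = classifying_top P" by (rule lmor.expand) simp
  finally show ?thesis .
qed

lemma classifying_square: "lmor_comp K T U (classifying_top P) = lmor_comp K T (classifying_base P) P"
  by (rule lmor.expand) simp

lemma classifying_square_pullback: "pullback (LaxAlg K T) U (classifying_base P) P (classifying_top P)"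
  by (rule pullback_lift) (use classifying_pullback[of "und1 P"] u_opf classifying_square in simp_all)

end

text \<open>The compatibility of \<open>(a, b)\<close> with the structure cells is a pair of equations whose source is the
  \<open>T\<close>-step of the classifying square of \<open>P\<close>.\<close>

lemma square_cells_lift:
  assumes P [simp]: "small_strict K T P"
    and C: "lax_morphism K T C" "ldom C = ldom P" "lcod C = top_alg"
    and B: "lax_morphism K T B" "ldom B = lcod P" "lcod B = base_alg"
    and CB: "lmor_comp K T U C = lmor_comp K T B P"
    and ab: "(a, b) \<in> square_cells K (und1 P) u (dt (und1 P), d (und1 P)) (und1 C, und1 B)"
  shows "T_two_morphism K T (LCell (classifying_top P) C a)" "T_two_morphism K T (LCell (classifying_base P) B b)"
proof -
  note [simp] = C B
  let ?p = "und1 P" and ?f = "d (und1 P)" and ?q = "dt (und1 P)"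
  have [simp]: "a \<in> Cell K" "dom2 K a = ?q" "cod2 K a = und1 C" "b \<in> Cell K" "dom2 K b = ?f" "cod2 K b = und1 B"
    and uab [simp]: "u \<rhd> a = b \<lhd> ?p" using ab unfolding mem_square_cells by blast+
  have uC [simp]: "u \<rhd> str2 C = str2 B \<lhd> T1 T ?p" using arg_cong[OF CB, of str2] by simp
  have uc: "u \<cdot> und1 C = und1 B \<cdot> ?p" using arg_cong[OF CB, of und1] by simp
  have Tuc [simp]: "T1 T u \<cdot> T1 T (und1 C) = T1 T (und1 B) \<cdot> T1 T ?p"
    using arg_cong[OF uc, of "T1 T"] by simp
  have s: "(\<omega> \<cdot> T1 T u) \<rhd> T2 T a = (\<omega> \<rhd> T2 T b) \<lhd> T1 T ?p"
    by (rule omega_T_cells) simp_all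
  have pbk: "pullback K u ?f ?p ?q" by (rule classifying_pullback) simp
  have 1: "(a \<lhd> act (ldom P)) \<bullet> str2 (classifying_top P) = str2 C \<bullet> (\<omega>t \<rhd> T2 T a) \<and>
      (b \<lhd> act (lcod P)) \<bullet> str2 (classifying_base P) = str2 B \<bullet> (\<omega> \<rhd> T2 T b)"
    by (rule pullback_cells_eqI[OF pullback_T_step[OF pbk]]) (simp_all add: s)
  show "T_two_morphism K T (LCell (classifying_top P) C a)"
    by (rule T_two_morphismI) (simp_all add: 1)
  show "T_two_morphism K T (LCell (classifying_base P) B b)"
    by (rule T_two_morphismI) (simp_all add: 1)
qed

text \<open>The mediating morphisms between the given square and the chosen pullback are mutually inverse in the
  lax algebras, hence so are their underlying arrows.\<close>

lemma LaxAlg_pullback_underlying: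
  assumes P: "small_strict K T P" and pbk: "pullback (LaxAlg K T) P F S R"
  shows "pullback K (und1 P) (und1 F) (und1 S) (und1 R)"
proof -
  interpret L: plumbus "LaxAlg K T" by (rule LaxAlg_plumbus)
  have F [simp]: "lax_morphism K T F" "lcod F = lcod P" and SR [simp]: "lax_morphism K T S" "lcod S = ldom F"
    "lax_morphism K T R" "ldom R = ldom S" "lcod R = ldom P"
    using L.pullback_typing[OF pbk] by simp_all
  note [simp] = P
  obtain S0 R0 where SR0: "lax_pb K T P F = (S0, R0)" by (cases "lax_pb K T P F")
  have L0: "pullback (LaxAlg K T) P F S0 R0" and K0: "pullback K (und1 P) (und1 F) (und1 S0) (und1 R0)"
    using lax_pb_left_tight(2,3)[OF P F] unfolding SR0 left_tight_pullback_def by simp_all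
  have SR0 [simp]: "lax_morphism K T S0" "lcod S0 = ldom F"
    "lax_morphism K T R0" "ldom R0 = ldom S0" "lcod R0 = ldom P"
    using L.pullback_typing[OF L0] by simp_all
  have e: "lmor_comp K T P R = lmor_comp K T F S" "lmor_comp K T P R0 = lmor_comp K T F S0"
    using L.pullback_typing(9)[OF pbk] L.pullback_typing(9)[OF L0] by simp_all
  obtain J where J: "J \<in> Arr (LaxAlg K T)" "dom1 (LaxAlg K T) J = dom1 (LaxAlg K T) S"
    "cod1 (LaxAlg K T) J = dom1 (LaxAlg K T) S0" "S0 \<cdot>\<^bsub>LaxAlg K T\<^esub> J = S" "R0 \<cdot>\<^bsub>LaxAlg K T\<^esub> J = R"
    by (rule L.pullback_arr[OF L0, of S R]) (use e in simp_all)
  obtain I where I: "I \<in> Arr (LaxAlg K T)" "dom1 (LaxAlg K T) I = dom1 (LaxAlg K T) S0"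
    "cod1 (LaxAlg K T) I = dom1 (LaxAlg K T) S" "S \<cdot>\<^bsub>LaxAlg K T\<^esub> I = S0" "R \<cdot>\<^bsub>LaxAlg K T\<^esub> I = R0"
    by (rule L.pullback_arr[OF pbk, of S0 R0]) (use e in simp_all)
  have JI [simp]: "lax_morphism K T J" "ldom J = ldom S" "lcod J = ldom S0" "lax_morphism K T I" "ldom I = ldom S0" "lcod I = ldom S"
    and c: "lmor_comp K T S0 J = S" "lmor_comp K T R0 J = R" "lmor_comp K T S I = S0" "lmor_comp K T R I = R0"
    using J I by simp_all
  have "lmor_comp K T S0 (lmor_comp K T J I) = lmor_comp K T (lmor_comp K T S0 J) I"
     "lmor_comp K T R0 (lmor_comp K T J I) = lmor_comp K T (lmor_comp K T R0 J) I" by simp_all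
  then have e1: "lmor_comp K T S0 (lmor_comp K T J I) = S0" "lmor_comp K T R0 (lmor_comp K T J I) = R0"
    unfolding c by simp_all
  have JI1: "lmor_comp K T J I = lmor_id K (ldom S0)"
    by (rule L.pullback_arr_eqI[OF L0, unfolded LaxAlg_sel]) (use e1 in simp_all)
  have "lmor_comp K T S (lmor_comp K T I J) = lmor_comp K T (lmor_comp K T S I) J"
     "lmor_comp K T R (lmor_comp K T I J) = lmor_comp K T (lmor_comp K T R I) J" by simp_all
  then have e2: "lmor_comp K T S (lmor_comp K T I J) = S" "lmor_comp K T R (lmor_comp K T I J) = R"
    unfolding c by simp_all
  have IJ1: "lmor_comp K T I J = lmor_id K (ldom S)"
    by (rule L.pullback_arr_eqI[OF pbk, unfolded LaxAlg_sel]) (use e2 in simp_all)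
  have "pullback K (und1 P) (und1 F) (und1 S0 \<cdot> und1 J) (und1 R0 \<cdot> und1 J)"
    by (rule pullback_iso[OF K0, of "und1 J" "und1 I"])
      (use arg_cong[OF JI1, of und1] arg_cong[OF IJ1, of und1] in simp_all)
  then show ?thesis using c(1,2)[THEN arg_cong[of _ _ und1]] by simp
qed

text \<open>Every clause is inherited from the classifier of the underlying plumbus: the classifying 2-cells of the
  underlying squares are 2-cells of lax morphisms by \<open>square_cells_lift\<close>, and they remain unique because
  a 2-cell of lax morphisms is determined by its underlying cell and its end points.\<close>

theorem LaxAlg_representable: "representable_plumbus (LaxAlg K T) U classifying_top classifying_base"
proof -
  interpret L: plumbus "LaxAlg K T" by (rule LaxAlg_plumbus)
  show ?thesis
  proof (unfold_locales, goal_cases)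
    case 1
    show ?case by simp
  next
    case (2 P)
    then show ?case using classifying_square_pullback[of P] classifying_square[of P] by simp
  next
    case (3 P P' G F)
    then have P [simp]: "small_strict K T P" "small_strict K T P'"
      and GF [simp]: "lax_morphism K T G" "ldom G = ldom P" "lcod G = ldom P'"
        "lax_morphism K T F" "ldom F = lcod P" "lcod F = lcod P'" 
      and sq: "lmor_comp K T P' G = lmor_comp K T F P" by simp_all
    have "comm_square K (und1 P) (und1 P') (und1 G, und1 F)" using arg_cong[OF sq, of und1] by simp
    then have ex: "\<exists>!\<gamma>. \<gamma> \<in> square_cells K (und1 P) u (dt (und1 P), d (und1 P))
        (dt (und1 P') \<cdot> und1 G, d (und1 P') \<cdot> und1 F)"
      by (intro classify_cells) simp_all
    then obtain a b where ab: "(a, b) \<in> square_cells K (und1 P) u (dt (und1 P), d (und1 P))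
        (dt (und1 P') \<cdot> und1 G, d (und1 P') \<cdot> und1 F)" by (metis surj_pair)
    let ?C = "lmor_comp K T (classifying_top P') G" and ?B = "lmor_comp K T (classifying_base P') F"
    have "lmor_comp K T U ?C = lmor_comp K T (lmor_comp K T U (classifying_top P')) G" by simp
    also have "\<dots> = lmor_comp K T (classifying_base P') (lmor_comp K T P' G)" unfolding classifying_square[OF P(2)] by simp
    also have "\<dots> = lmor_comp K T ?B P" unfolding sq by simp
    finally have CB: "lmor_comp K T U ?C = lmor_comp K T ?B P" .
    have ab': "(a, b) \<in> square_cells K (und1 P) u (dt (und1 P), d (und1 P)) (und1 ?C, und1 ?B)"
      using ab by (simp only: lmor_comp_sel classifying_sel)
    have two: "T_two_morphism K T (LCell (classifying_top P) ?C a)" "T_two_morphism K T (LCell (classifying_base P) ?B b)"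
      by (rule square_cells_lift[OF P(1) _ _ _ _ _ _ CB ab']; simp)+
    let ?sq = "square_cells (LaxAlg K T) P U (classifying_top P, classifying_base P) (?C, ?B)"
    have 1: "(LCell (classifying_top P) ?C a, LCell (classifying_base P) ?B b) \<in> ?sq"
      using two ab CB classifying_square[OF P(1)] by simp
    have 2: "\<Gamma>t = LCell (classifying_top P) ?C a \<and> \<Gamma> = LCell (classifying_base P) ?B b" if "(\<Gamma>t, \<Gamma>) \<in> ?sq" for \<Gamma>t \<Gamma>
    proof -
      have g [simp]: "T_two_morphism K T \<Gamma>t" "ldom2 \<Gamma>t = classifying_top P" "lcod2 \<Gamma>t = ?C"
        "T_two_morphism K T \<Gamma>" "ldom2 \<Gamma> = classifying_base P" "lcod2 \<Gamma> = ?B" and e: "U \<rhd>\<^bsub>LaxAlg K T\<^esub> \<Gamma>t = \<Gamma> \<lhd>\<^bsub>LaxAlg K T\<^esub> P"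
        using that unfolding mem_square_cells LaxAlg_sel mem_Collect_eq by blast+
      have "(und2 \<Gamma>t, und2 \<Gamma>) \<in> square_cells K (und1 P) u (dt (und1 P), d (und1 P))
        (dt (und1 P') \<cdot> und1 G, d (und1 P') \<cdot> und1 F)"
        using arg_cong[OF e, of und2] by simp
      then have "(und2 \<Gamma>t, und2 \<Gamma>) = (a, b)" using ex ab by blast
      then show ?thesis by (auto intro!: lcell.expand)
    qed
    have "\<exists>!\<Gamma>. \<Gamma> \<in> ?sq" by (rule ex1I, rule 1, metis 2 surj_pair)
    then show ?case by simp
  next
    case (4 P P' G F \<Gamma>t \<Gamma>)
    then have P [simp]: "small_strict K T P" "small_strict K T P'"
      and GF [simp]: "lax_morphism K T G" "ldom G = ldom P" "lcod G = ldom P'"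
        "lax_morphism K T F" "ldom F = lcod P" "lcod F = lcod P'" 
      and sq: "lmor_comp K T P' G = lmor_comp K T F P" by simp_all
    have pbk: "pullback K (und1 P') (und1 F) (und1 P) (und1 G)"
      by (rule LaxAlg_pullback_underlying[OF P(2) 4(4)])
    have g [simp]: "T_two_morphism K T \<Gamma>t" "ldom2 \<Gamma>t = classifying_top P" "lcod2 \<Gamma>t = lmor_comp K T (classifying_top P') G"
        "T_two_morphism K T \<Gamma>" "ldom2 \<Gamma> = classifying_base P" "lcod2 \<Gamma> = lmor_comp K T (classifying_base P') F"
        and e: "U \<rhd>\<^bsub>LaxAlg K T\<^esub> \<Gamma>t = \<Gamma> \<lhd>\<^bsub>LaxAlg K T\<^esub> P"
        using 4(5) unfolding mem_square_cells LaxAlg_sel mem_Collect_eq by blast+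
    have c: "comm_square K (und1 P) (und1 P') (und1 G, und1 F)" using arg_cong[OF sq, of und1] by simp
    have "(und2 \<Gamma>t, und2 \<Gamma>) \<in> square_cells K (und1 P) u (dt (und1 P), d (und1 P))
        (dt (und1 P') \<cdot> und1 G, d (und1 P') \<cdot> und1 F)"
        using arg_cong[OF e, of und2] by simp
    then have "iso2 K (und2 \<Gamma>t) \<and> iso2 K (und2 \<Gamma>)"
      by (intro classify_iso[OF _ _ c pbk]) simp_all
    then show ?case by (simp add: LaxAlg_iso2)
  next
    case 5
    obtain a b where ab: "(a, b) \<in> square_cells K u u (dt u, d u) (Id1 K \<Omega>t, Id1 K \<Omega>)"
     and iso: "iso2 K a" "iso2 K b" using classify_u by blast
    have CB: "lmor_comp K T U (lmor_id K top_alg) = lmor_comp K T (lmor_id K base_alg) U" by simp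
    have ab': "(a, b) \<in> square_cells K (und1 U) u (dt (und1 U), d (und1 U))
        (und1 (lmor_id K top_alg), und1 (lmor_id K base_alg))"
      using ab by (simp only: lmor_id_sel canonical_sel)
    have two: "T_two_morphism K T (LCell (classifying_top U) (lmor_id K top_alg) a)"
       "T_two_morphism K T (LCell (classifying_base U) (lmor_id K base_alg) b)"
      by (rule square_cells_lift[OF canonical_u_small _ _ _ _ _ _ CB ab']; simp)+
    have sqc: "(LCell (classifying_top U) (lmor_id K top_alg) a, LCell (classifying_base U) (lmor_id K base_alg) b)
        \<in> square_cells (LaxAlg K T) U U (classifying_top U, classifying_base U) (lmor_id K top_alg, lmor_id K base_alg)"
      using two ab CB classifying_square[OF canonical_u_small] by simp
    have "iso2 (LaxAlg K T) (LCell (classifying_top U) (lmor_id K top_alg) a)"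
      "iso2 (LaxAlg K T) (LCell (classifying_base U) (lmor_id K base_alg) b)"
      unfolding LaxAlg_iso2 using two iso by simp_all
    with sqc show ?case unfolding LaxAlg_sel canonical_sel by blast
  next
    case 6
    have "strict_morphism K T (lmor_id K (one_lalg K T))"
      by (rule strict_morphismI[where f = "act (one_lalg K T)"]) (simp_all add: one_lalg_lax)
    then show ?case
      using id_one_small
      unfolding LaxAlg_sel mem_Collect_eq small_strict_def lmor_id_sel one_lalg_carr by blast
  qed
qed

end

theorem theorem6p14:
  fixes K :: "('o, 'a, 'c) plumbus_data"
    and T :: "('o, 'a, 'c) monad_data"
    and u :: 'a and dt d :: "'a \<Rightarrow> 'a"
  assumes "representable_plumbus K u dt d"
    and "opfibrantly_cartesian K T u d"
  shows "\<exists>Dt D. representable_plumbus (LaxAlg K T) (canonical_u K T u dt d) Dt D"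
proof -
  interpret opfibrantly_cartesian_plumbus K T u dt d
    using assms by (rule opfibrantly_cartesian_plumbus.intro)
  show ?thesis using LaxAlg_representable by blast
qed

end
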